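(* Let $\mathbb K$ be a field of characteristic zero and $\mathfrak b\subset\mathfrak{sl}_2(\mathbb K)$ the two-dimensional Borel subalgebra, with basis $e_1,e_2$ and $[e_1,e_2]=2e_1$. Then the DGLA of Drinfeld $\bigotimes\mathcal U_{\mathfrak b}$ is formal: there exists an $L_\infty$ quasi-isomorphism from the graded Lie algebra $E(\mathfrak b)$ (its cohomology) to $\bigotimes\mathcal U_{\mathfrak b}$.
   Context: For a Lie algebra $\mathfrak g$, the DGLA of Drinfeld $\bigotimes\mathcal U_{\mathfrak g}=D$ has $D^{-1}=\mathbb K$, $D^k=\mathcal U_{\mathfrak g}^{\otimes(k+1)}$ ($k\ge0$), differential $\delta\Phi=\Phi\otimes1-\sum_{l=0}^k(-1)^{k-l}\Delta_l\Phi+(-1)^k1\otimes\Phi$ ($\Delta_l$ = standard coproduct $\Delta e=e\otimes1+1\otimes e$ applied to the $l$-th factor), and bracket $[\Phi_1,\Phi_2]_G=\Phi_1\circ\Phi_2-(-1)^{k_1k_2}\Phi_2\circ\Phi_1$, where $\Phi_1\circ\Phi_2=\sum_{i=0}^{k_1}(-1)^{ik_2}\Delta^{k_2}_i(\Phi_1)(1^{\otimes i}\otimes\Phi_2\otimes1\otimes\cdots\otimes1)$ and $\Delta^{k}_i$ applies the $k$-fold iterated coproduct $\Delta^k=(\Delta\otimes1^{\otimes(k-1)})\cdots(\Delta\otimes1)\Delta$ to the $i$-th factor. Its cohomology is the exterior algebra $E(\mathfrak g)$ ($\wedge^{k+1}\mathfrak g$ in degree $k$) with graded Lie bracket extending that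 of $\mathfrak g$ by the Leibniz rule $[\gamma,\gamma_1\wedge\gamma_2]=[\gamma,\gamma_1]\wedge\gamma_2+(-1)^{k(k_1+1)}\gamma_1\wedge[\gamma,\gamma_2]$. A DGLA is formal if there is an $L_\infty$ quasi-isomorphism from its cohomology graded Lie algebra to it (an $L_\infty$-morphism whose first component induces an isomorphism in cohomology). *)

theory Defs
  imports Main
begin

definition supp :: "('a \<Rightarrow> 'k::zero) \<Rightarrow> 'a set" where
  "supp f = {x. f x \<noteq> 0}"

definition bas :: "'a \<Rightarrow> 'a \<Rightarrow> 'k::zero_neq_one" where
  "bas a = (\<lambda>x. if x = a then 1 else 0)"

definition sg :: "int \<Rightarrow> 'k::comm_ring_1" where
  "sg i = (if even i then 1 else - 1)"

definition lext :: "('a \<Rightarrow> 'b \<Rightarrow> 'k::comm_ring_1) \<Rightarrow> ('a \<Rightarrow> 'k) \<Rightarrow> 'b \<Rightarrow> 'k" where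
  "lext g f = (\<lambda>z. \<Sum>a\<in>supp f. f a * g a z)"

definition lext2 :: "('a \<Rightarrow> 'b \<Rightarrow> 'c \<Rightarrow> 'k::comm_ring_1) \<Rightarrow> ('a \<Rightarrow> 'k) \<Rightarrow> ('b \<Rightarrow> 'k) \<Rightarrow> 'c \<Rightarrow> 'k" where
  "lext2 g f h = (\<lambda>z. \<Sum>a\<in>supp f. \<Sum>b\<in>supp h. f a * h b * g a b z)"

inductive_set lspan :: "('a \<Rightarrow> 'k::comm_ring_1) set \<Rightarrow> ('a \<Rightarrow> 'k) set" for S where
  zero: "(\<lambda>_. 0) \<in> lspan S"
| gen: "x \<in> S \<Longrightarrow> x \<in> lspan S"
| add: "x \<in> lspan S \<Longrightarrow> y \<in> lspan S \<Longrightarrow> (\<lambda>z. x z + y z) \<in> lspan S"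
| smul: "x \<in> lspan S \<Longrightarrow> (\<lambda>z. c * x z) \<in> lspan S"

section \<open>Tensor powers of the tensor algebra T(b); letter False = e1, True = e2\<close>

text \<open>An element of the direct sum of the T(b)^{\<otimes>n}: coefficients of
  pure tensors of words w_1 \<otimes> ... \<otimes> w_n, indexed by the list [w_1,...,w_n].\<close>
type_synonym 'k tens = "bool list list \<Rightarrow> 'k"

definition tmul :: "'k::comm_ring_1 tens \<Rightarrow> 'k tens \<Rightarrow> 'k tens" where
  "tmul = lext2 (\<lambda>xs ys. bas (map2 (@) xs ys))"

definition ttens :: "'k::comm_ring_1 tens \<Rightarrow> 'k tens \<Rightarrow> 'k tens" where
  "ttens = lext2 (\<lambda>xs ys. bas (xs @ ys))"

definition tone :: "nat \<Rightarrow> 'k::comm_ring_1 tens" where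
  "tone i = bas (replicate i [])"

definition subword :: "bool list \<Rightarrow> nat list \<Rightarrow> nat \<Rightarrow> bool list" where
  "subword w cs j = map fst (filter (\<lambda>p. snd p = j) (zip w cs))"

definition colorings :: "bool list \<Rightarrow> nat \<Rightarrow> nat list set" where
  "colorings w m = {cs. length cs = length w \<and> set cs \<subseteq> {..<m}}"

text \<open>expand_b l m ws: apply the (m-1)-fold iterated coproduct (m output factors;
  m = 0 is the counit) of the standard coproduct (letters primitive) to factor l.\<close>
definition expand_b :: "nat \<Rightarrow> nat \<Rightarrow> bool list list \<Rightarrow> 'k::comm_ring_1 tens" where
  "expand_b l m ws = (\<lambda>z. \<Sum>cs\<in>colorings (ws ! l) m.
      bas (take l ws @ map (subword (ws ! l) cs) [0..<m] @ drop (Suc l) ws) z)"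

definition delta_b :: "bool list list \<Rightarrow> 'k::comm_ring_1 tens" where
  "delta_b ws = (let n = length ws; k = int n - 1 in
     (\<lambda>z. bas (ws @ [[]]) z - (\<Sum>l<n. sg (k - int l) * expand_b l 2 ws z)
          + sg k * bas ([] # ws) z))"

definition hdiff :: "'k::comm_ring_1 tens \<Rightarrow> 'k tens" where
  "hdiff = lext delta_b"

definition circ_b :: "bool list list \<Rightarrow> bool list list \<Rightarrow> 'k::comm_ring_1 tens" where
  "circ_b xs ys = (let n1 = length xs; n2 = length ys in
     (\<lambda>z. \<Sum>i<n1. sg (int i * (int n2 - 1)) *
        tmul (expand_b i n2 xs) (ttens (ttens (tone i) (bas ys)) (tone (n1 - 1 - i))) z))"

definition gbr_b :: "bool list list \<Rightarrow> bool list list \<Rightarrow> 'k::comm_ring_1 tens" where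
  "gbr_b xs ys = (\<lambda>z. circ_b xs ys z
      - sg ((int (length xs) - 1) * (int (length ys) - 1)) * circ_b ys xs z)"

definition gbr :: "'k::comm_ring_1 tens \<Rightarrow> 'k tens \<Rightarrow> 'k tens" where
  "gbr = lext2 gbr_b"

text \<open>decalage of the bracket: r2(x,y) = (-1)^{|x|} [x,y]\<close>
definition r2D :: "'k::comm_ring_1 tens \<Rightarrow> 'k tens \<Rightarrow> 'k tens" where
  "r2D = lext2 (\<lambda>xs ys z. sg (int (length xs) - 1) * gbr_b xs ys z)"

text \<open>Relator e1 e2 - e2 e1 - 2 e1 of U(b) = T(b)/I, and the kernel J of
  T(b)^{\<otimes>m} \<rightarrow> U(b)^{\<otimes>m} (sum over the slots of T\<otimes>..\<otimes>I\<otimes>..\<otimes>T).\<close>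
definition rel :: "'k::comm_ring_1 tens" where
  "rel = (\<lambda>z. bas [[False, True]] z - bas [[True, False]] z - 2 * bas [[False]] z)"

definition rel_at :: "nat \<Rightarrow> nat \<Rightarrow> 'k::comm_ring_1 tens" where
  "rel_at i m = ttens (ttens (tone i) rel) (tone (m - 1 - i))"

definition Jgen :: "'k::comm_ring_1 tens set" where
  "Jgen = {tmul (tmul (bas us) (rel_at i m)) (bas vs) | us vs i m.
              length us = m \<and> length vs = m \<and> i < m}"

text \<open>equality in the quotient U(b)^{\<otimes>m}\<close>
definition Jeq :: "'k::comm_ring_1 tens \<Rightarrow> 'k tens \<Rightarrow> bool" where
  "Jeq a b \<longleftrightarrow> (\<lambda>z. a z - b z) \<in> lspan Jgen"

text \<open>homogeneous (representative of an) element of D^k = U(b)^{\<otimes>(k+1)}\<close>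
definition Dhom :: "int \<Rightarrow> 'k::comm_ring_1 tens \<Rightarrow> bool" where
  "Dhom k \<Phi> \<longleftrightarrow> finite (supp \<Phi>) \<and> (\<forall>ws\<in>supp \<Phi>. int (length ws) = k + 1)"

type_synonym 'k ext = "bool list \<Rightarrow> 'k"

text \<open>basis monomials e_{i1} \<and> ... \<and> e_{ip}, i1 < ... < ip, of degree p - 1\<close>
definition Emon :: "bool list \<Rightarrow> bool" where
  "Emon m \<longleftrightarrow> sorted_wrt (<) m"

definition ninv :: "bool list \<Rightarrow> nat" where
  "ninv zs = card {(i, j). i < j \<and> j < length zs \<and> zs ! j < zs ! i}"

definition wedge_b :: "bool list \<Rightarrow> bool list \<Rightarrow> 'k::comm_ring_1 ext" where
  "wedge_b xs ys = (if distinct (xs @ ys)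
     then (\<lambda>z. sg (int (ninv (xs @ ys))) * bas (sort (xs @ ys)) z) else (\<lambda>_. 0))"

definition wedge :: "'k::comm_ring_1 ext \<Rightarrow> 'k ext \<Rightarrow> 'k ext" where
  "wedge = lext2 wedge_b"

definition lbr :: "bool \<Rightarrow> bool \<Rightarrow> 'k::comm_ring_1 ext" where
  "lbr a c = (if \<not> a \<and> c then (\<lambda>z. 2 * bas [False] z)
              else if a \<and> \<not> c then (\<lambda>z. - 2 * bas [False] z) else (\<lambda>_. 0))"

definition remove_nth :: "nat \<Rightarrow> 'a list \<Rightarrow> 'a list" where
  "remove_nth i xs = take i xs @ drop (Suc i) xs"

text \<open>[x1..xp, y1..yq] = sum (-1)^{i+j} [xi,yj] \<and> x1..^xi..xp \<and> y1..^yj..yq,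
  the unique extension of the bracket of b satisfying the stated Leibniz rule\<close>
definition sch_b :: "bool list \<Rightarrow> bool list \<Rightarrow> 'k::comm_ring_1 ext" where
  "sch_b xs ys = (\<lambda>z. \<Sum>i<length xs. \<Sum>j<length ys. sg (int i + int j) *
      wedge (wedge (lbr (xs ! i) (ys ! j)) (bas (remove_nth i xs))) (bas (remove_nth j ys)) z)"

definition q2E :: "bool list \<Rightarrow> bool list \<Rightarrow> 'k::comm_ring_1 ext" where
  "q2E xs ys = (\<lambda>z. sg (int (length xs) - 1) * sch_b xs ys z)"

text \<open>parity of a monomial in the shifted space E(b)[1]\<close>
definition sdeg :: "bool list \<Rightarrow> int" where
  "sdeg m = int (length m) - 2"

definition koz :: "bool list list \<Rightarrow> nat set \<Rightarrow> 'k::comm_ring_1" where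
  "koz ms A = sg (\<Sum>a\<in>A. \<Sum>b\<in>{..<length ms} - A.
                    if b < a then sdeg (ms ! a) * sdeg (ms ! b) else 0)"

text \<open>f ms = F_n(m_1,...,m_n) on basis monomials, representative in T(b)^{\<otimes>}.
  Equations of a morphism of the associated L-infinity[1] algebras (coalgebra
  morphism commuting with the codifferentials), holding in D.\<close>
definition Linf_morphism :: "(bool list list \<Rightarrow> 'k::field_char_0 tens) \<Rightarrow> bool" where
  "Linf_morphism f \<longleftrightarrow>
    (\<forall>ms. ms \<noteq> [] \<and> (\<forall>m\<in>set ms. Emon m) \<longrightarrow>
      (let n = length ms in
        Dhom ((\<Sum>m\<leftarrow>ms. int (length m) - 1) + 1 - int n) (f ms)
      \<and> (\<forall>i. Suc i < n \<longrightarrow>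
           Jeq (f ms) (\<lambda>z. sg (sdeg (ms ! i) * sdeg (ms ! Suc i)) *
                           f (ms[i := ms ! Suc i, Suc i := ms ! i]) z))
      \<and> Jeq (\<lambda>z. \<Sum>A\<in>{A. A \<subseteq> {..<n} \<and> card A = 2}. koz ms A *
                 lext (\<lambda>c. f (c # nths ms ({..<n} - A)))
                      (q2E (nths ms A ! 0) (nths ms A ! 1)) z)
            (\<lambda>z. hdiff (f ms) z + (1 / 2) *
                 (\<Sum>A\<in>Pow {..<n} - {{}, {..<n}}. koz ms A *
                    r2D (f (nths ms A)) (f (nths ms ({..<n} - A))) z))))"

definition F1 :: "(bool list list \<Rightarrow> 'k::field_char_0 tens) \<Rightarrow> 'k ext \<Rightarrow> 'k tens" where
  "F1 f c = lext (\<lambda>m. f [m]) c"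

definition Ehom :: "int \<Rightarrow> 'k::zero ext \<Rightarrow> bool" where
  "Ehom k c \<longleftrightarrow> finite (supp c) \<and> (\<forall>m\<in>supp c. Emon m \<and> int (length m) = k + 1)"

definition quasi_iso :: "(bool list list \<Rightarrow> 'k::field_char_0 tens) \<Rightarrow> bool" where
  "quasi_iso f \<longleftrightarrow>
    (\<forall>k c. Ehom k c \<and> (\<exists>\<Psi>. Dhom (k - 1) \<Psi> \<and> Jeq (F1 f c) (hdiff \<Psi>)) \<longrightarrow> (\<forall>m. c m = 0))
  \<and> (\<forall>k \<Phi>. Dhom k \<Phi> \<and> Jeq (hdiff \<Phi>) (\<lambda>_. 0) \<longrightarrow>
       (\<exists>c \<Psi>. Ehom k c \<and> Dhom (k - 1) \<Psi> \<and> Jeq \<Phi> (\<lambda>z. F1 f c z + hdiff \<Psi> z)))"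

end

(* Write x = e1 and y = e2, so that x y = (y + 2) x in U(b).

   In E(b)[1] a component F_n can only be nonzero on r, ..., r (with r = e1 /\ e2), on one further
   basis monomial together with copies of r, or on two elements of b together with copies of r.
   The values on copies of r assemble into a formal family of solutions of the Maurer-Cartan equation,
   that is, into a Drinfeld twist J = 1 - sum_n h^n F_n(r, ..., r) / n!.  The Jordanian twist
   J = (1 + h x_2)^(y_1 / 2) is such a family.  The values on e1, r, ..., r have to assemble into an
   element which is primitive for the coproduct twisted by J, and ln (1 + h x) / h is one; on e2 one can take y
   and 0 in the higher orders, since the adjoint action of y rescales h.  All other components vanish.
   Each relation then becomes a binomial identity (Vandermonde).

   For the quasi-isomorphism, the basis y^a x^b of U(b) identifies its coalgebra with the dual of the
   monoid algebra of N^2, hence D with the finitely supported cochains of the bar complex of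
   N^2 with trivial coefficients (both generators acting by 0).  The class of r is detected by
   antisymmetrizing at the two generators. *)
theory Submission
  imports Defs "HOL-Computational_Algebra.Formal_Power_Series" "HOL-Computational_Algebra.Polynomial"
    "HOL-Library.Product_Plus" "HOL-Library.Multiset"
begin

section \<open>Finitely supported functions and linear extension\<close>

text \<open>Equality in a tensor power of U(b) is congruence modulo \<open>Jgen\<close>, so it has
  to be tested by functions. A word is sent to a function on a commutative monoid such that
  appending a letter acts by an operator obeying a Leibniz rule and the coproduct becomes addition
  in the monoid. The rewriting x y -> y x + 2 x reduces every tensor to ordered words, on which
  these functions are independent; hence congruence is equality of functions. Two monoids serve two
  ends. On N^2 the functions are coordinates in the basis y^a x^b: finite support is visible there,
  as the cohomology requires. On K x N a polynomial in y is evaluated at a scalar s: right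
  multiplication by a word is then a shift of the argument times a factor, so that products lose
  their sums and binomial polynomials in y / 2 become generalized binomial coefficients. The
  exponent y_1 / 2 reflects [y / 2, x] = - x. The restriction on arguments is one of degree: F_n has
  values in tensors whose length is 2 plus the sum of the shifted degrees, which are 0 for r, -1 on
  b and -2 for the unit.\<close>

lemma sg_diff: "sg (a - b) = sg a * sg b"
  by (simp add: sg_def)

lemma sg_mult_self [simp]: "sg a * sg a = 1" "sg a * (sg a * x) = x"
  by (simp_all add: sg_def)

lemma sg_simps [simp]: "sg 0 = 1" "sg 1 = - 1" "sg 2 = 1"
  by (simp_all add: sg_def)

lemma supp_bas [simp]: "supp (bas a :: 'a \<Rightarrow> 'k::zero_neq_one) = {a}"
  by (auto simp: supp_def bas_def)

lemma supp_zero [simp]: "supp (\<lambda>_. 0) = {}"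
  by (simp add: supp_def)

lemma fin_add: "finite (supp f) \<Longrightarrow> finite (supp g) \<Longrightarrow> finite (supp (\<lambda>z. f z + g z :: 'k::comm_ring_1))"
  by (rule finite_subset[of _ "supp f \<union> supp g"]) (auto simp: supp_def)

lemma fin_diff: "finite (supp f) \<Longrightarrow> finite (supp g) \<Longrightarrow> finite (supp (\<lambda>z. f z - g z :: 'k::comm_ring_1))"
  by (rule finite_subset[of _ "supp f \<union> supp g"]) (auto simp: supp_def)

lemma fin_uminus: "finite (supp f) \<Longrightarrow> finite (supp (\<lambda>z. - f z :: 'k::comm_ring_1))"
  by (simp add: supp_def)

lemma fin_smul: "finite (supp f) \<Longrightarrow> finite (supp (\<lambda>z. c * f z :: 'k::comm_ring_1))"
  by (rule finite_subset[of _ "supp f"]) (auto simp: supp_def)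

lemma fin_sum: "(\<And>i. i \<in> I \<Longrightarrow> finite (supp (F i))) \<Longrightarrow> finite (supp (\<lambda>z. \<Sum>i\<in>I. F i z :: 'k::comm_ring_1))"
proof (induction I rule: infinite_finite_induct)
  case (insert x I)
  then show ?case by (simp add: fin_add)
qed simp_all

text \<open>The supports of f, h and f + h differ, so the defining sums cannot be added as they
  stand; over a common finite superset they can.\<close>

lemma lext_on:
  assumes "finite S" "supp f \<subseteq> S"
  shows "lext g f z = (\<Sum>a\<in>S. f a * g a z)"
  unfolding lext_def using assms by (intro sum.mono_neutral_left) (auto simp: supp_def)

lemma lext_add:
  assumes "finite (supp f)" "finite (supp h)"
  shows "lext g (\<lambda>z. f z + h z) z = lext g f z + lext g h z"
proof -
  have "supp (\<lambda>z. f z + h z) \<subseteq> supp f \<union> supp h"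
    by (auto simp: supp_def)
  then show ?thesis
    using assms by (simp add: lext_on[of "supp f \<union> supp h"] distrib_right sum.distrib)
qed

lemma lext_smul:
  assumes "finite (supp f)"
  shows "lext g (\<lambda>z. c * f z) z = c * lext g f z"
proof -
  have "supp (\<lambda>z. c * f z) \<subseteq> supp f" by (auto simp: supp_def)
  then show ?thesis using assms
    by (simp add: lext_on[of "supp f"] sum_distrib_left mult.assoc)
qed

lemma lext_uminus: "finite (supp f) \<Longrightarrow> lext g (\<lambda>z. - f z) z = - lext g f z"
  using lext_smul[of f g "-1" z] by simp

lemma lext_diff:
  assumes "finite (supp f)" "finite (supp h)"
  shows "lext g (\<lambda>z. f z - h z) z = lext g f z - lext g h z"
  using lext_add[OF assms(1) fin_uminus[OF assms(2)], of g z] lext_uminus[OF assms(2), of g z] by simp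

lemma lext_zero [simp]: "lext g (\<lambda>_. 0) z = 0"
  by (simp add: lext_def)

lemma lext_bas [simp]: "lext g (bas a) = g a"
  unfolding lext_def by (simp, simp add: bas_def)

lemma lext_sum:
  assumes "\<And>i. i \<in> I \<Longrightarrow> finite (supp (F i))"
  shows "lext g (\<lambda>z. \<Sum>i\<in>I. F i z) z = (\<Sum>i\<in>I. lext g (F i) z)"
  using assms
proof (induction I rule: infinite_finite_induct)
  case (insert x I)
  then show ?case by (simp add: lext_add fin_sum)
qed simp_all

lemma lext_cong: "(\<And>a. a \<in> supp f \<Longrightarrow> g a z = h a z) \<Longrightarrow> lext g f z = lext h f z"
  unfolding lext_def by (intro sum.cong) auto

lemma fin_lext:
  assumes "finite (supp f)" "\<And>a. a \<in> supp f \<Longrightarrow> finite (supp (g a))"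
  shows "finite (supp (lext g f))"
  unfolding lext_def using assms by (intro fin_sum fin_smul)

lemma lext_lext:
  assumes "finite (supp f)" "\<And>a. a \<in> supp f \<Longrightarrow> finite (supp (g a))"
  shows "lext h (lext g f) z = lext (\<lambda>a. lext h (g a)) f z"
  unfolding lext_def[of g f] using assms
  by (subst lext_sum) (auto simp: lext_smul fin_smul lext_def[of "\<lambda>a. lext h (g a)"])

lemma supp_lextE:
  assumes "z \<in> supp (lext g f)"
  obtains a where "a \<in> supp f" "z \<in> supp (g a)"
proof -
  have "(\<Sum>a\<in>supp f. f a * g a z) \<noteq> 0"
    using assms by (simp add: supp_def lext_def)
  then obtain a where "a \<in> supp f" "f a * g a z \<noteq> 0"
    by (meson sum.neutral)
  then have "z \<in> supp (g a)" by (auto simp: supp_def)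
  with \<open>a \<in> supp f\<close> show ?thesis by (rule that)
qed

lemma lext2_eq: "lext2 g f h = lext (\<lambda>a. lext (g a) h) f"
  by (simp add: lext2_def lext_def sum_distrib_left mult.assoc)

lemma lext2_bas [simp]: "lext2 g (bas a) (bas b) = g a b"
  by (simp add: lext2_eq)

lemma fin_lext2:
  assumes "finite (supp f)" "finite (supp h)" "\<And>a b. a \<in> supp f \<Longrightarrow> b \<in> supp h \<Longrightarrow> finite (supp (g a b))"
  shows "finite (supp (lext2 g f h))"
  unfolding lext2_eq using assms by (intro fin_lext) auto

lemma lext_lext2:
  assumes "finite (supp f)" "finite (supp h)" "\<And>a b. a \<in> supp f \<Longrightarrow> b \<in> supp h \<Longrightarrow> finite (supp (g a b))"
  shows "lext k (lext2 g f h) z = lext2 (\<lambda>a b. lext k (g a b)) f h z"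
proof -
  have "lext k (lext2 g f h) z = lext (\<lambda>a. lext k (lext (g a) h)) f z"
    unfolding lext2_eq using assms by (intro lext_lext fin_lext) auto
  also have "\<dots> = lext (\<lambda>a. lext (\<lambda>b. lext k (g a b)) h) f z"
    using assms by (intro lext_cong lext_lext) auto
  finally show ?thesis by (simp add: lext2_eq)
qed

lemma lext2_zero_left [simp]: "lext2 g (\<lambda>_. 0) h z = 0"
  by (simp add: lext2_def)

lemma lext2_zero_right [simp]: "lext2 g f (\<lambda>_. 0) z = 0"
  by (simp add: lext2_def)

lemma tmul_bas [simp]: "tmul (bas xs) (bas ys) = bas (map2 (@) xs ys)"
  by (simp add: tmul_def)

lemma ttens_bas [simp]: "ttens (bas xs) (bas ys) = bas (xs @ ys)"
  by (simp add: ttens_def)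

lemma lspan_sum:
  assumes "\<And>i. i \<in> I \<Longrightarrow> F i \<in> lspan S"
  shows "(\<lambda>z. \<Sum>i\<in>I. F i z) \<in> lspan S"
  using assms
proof (induction I rule: infinite_finite_induct)
  case (insert x I)
  then show ?case using lspan.add[of "F x" S "\<lambda>z. \<Sum>i\<in>I. F i z"] by simp
qed (simp_all add: lspan.zero)

lemma Jeq_refl: "Jeq a a"
  by (simp add: Jeq_def lspan.zero)

lemma Jeq_add: "Jeq a b \<Longrightarrow> Jeq c d \<Longrightarrow> Jeq (\<lambda>z. a z + c z) (\<lambda>z. b z + d z)"
  unfolding Jeq_def by (drule (1) lspan.add) (simp add: algebra_simps)

lemma Jeq_smul: "Jeq a b \<Longrightarrow> Jeq (\<lambda>z. c * a z) (\<lambda>z. c * b z)"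
  unfolding Jeq_def by (drule lspan.smul[of _ _ c]) (simp add: algebra_simps)

lemma Jeq_trans: "Jeq a b \<Longrightarrow> Jeq b c \<Longrightarrow> Jeq a c"
  unfolding Jeq_def by (drule (1) lspan.add) simp

lemma Jeq_sum:
  assumes "\<And>i. i \<in> I \<Longrightarrow> Jeq (F i) (G i)"
  shows "Jeq (\<lambda>z. \<Sum>i\<in>I. F i z) (\<lambda>z. \<Sum>i\<in>I. G i z)"
  using lspan_sum[of I "\<lambda>i z. F i z - G i z"] assms by (simp add: Jeq_def sum_subtractf)

section \<open>Evaluations of tensors compatible with the coproduct\<close>

lemma colorings_Nil [simp]: "colorings [] m = {[]}"
  by (auto simp: colorings_def)

text \<open>Words and colorings grow at the right end because evaluation is governed by right
  multiplication.\<close>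

lemma colorings_snoc:
  "colorings (w @ [b]) m = (\<lambda>(cs, j). cs @ [j]) ` (colorings w m \<times> {..<m})"
proof -
  have "cs \<in> (\<lambda>(cs, j). cs @ [j]) ` (colorings w m \<times> {..<m})" if "cs \<in> colorings (w @ [b]) m" for cs
  proof -
    from that have "cs \<noteq> []" by (auto simp: colorings_def)
    then obtain ds j where "cs = ds @ [j]" by (metis rev_exhaust)
    with that show ?thesis by (auto simp: colorings_def image_iff)
  qed
  then show ?thesis by (auto simp: colorings_def)
qed

lemma sum_colorings_snoc:
  "(\<Sum>cs\<in>colorings (w @ [b]) m. F cs) = (\<Sum>cs\<in>colorings w m. \<Sum>j<m. F (cs @ [j]))"
proof -
  have "inj_on (\<lambda>(cs, j). cs @ [j]) (colorings w m \<times> {..<m})"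
    by (auto simp: inj_on_def)
  then show ?thesis
    unfolding colorings_snoc by (simp add: sum.reindex sum.cartesian_product case_prod_unfold)
qed

lemma finite_colorings [simp]: "finite (colorings w m)"
proof (induction w rule: rev_induct)
  case (snoc b w)
  then show ?case by (simp add: colorings_snoc)
qed simp

lemma subword_Nil [simp]: "subword [] cs j = []"
  by (simp add: subword_def)

lemma subword_snoc:
  "length cs = length w \<Longrightarrow> subword (w @ [b]) (cs @ [i]) j = subword w cs j @ (if j = i then [b] else [])"
  by (auto simp: subword_def)

text \<open>On pairs of naturals this is the character of the trivial module, and also the function
  \<open>nf []\<close> of the unit element.\<close>

definition eps :: "'g::zero \<Rightarrow> 'k::comm_ring_1" where
  "eps g = (if g = 0 then 1 else 0)"

definition merge :: "nat \<Rightarrow> 'g::plus list \<Rightarrow> 'g list" where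
  "merge l gs = take l gs @ [gs ! l + gs ! Suc l] @ drop (Suc (Suc l)) gs"

text \<open>The differential of the bar complex, with an arbitrary counit; \<open>u\<close> is a cochain on
  lists of length \<open>n\<close>, evaluated at a list of length \<open>n + 1\<close>.\<close>
definition bard :: "('g::plus \<Rightarrow> 'k::comm_ring_1) \<Rightarrow> nat \<Rightarrow> ('g list \<Rightarrow> 'k) \<Rightarrow> 'g list \<Rightarrow> 'k" where
  "bard e n u gs = u (butlast gs) * e (last gs)
     - (\<Sum>l<n. sg (int n - 1 - int l) * u (merge l gs)) + sg (int n - 1) * (e (hd gs) * u (tl gs))"

text \<open>Here \<open>rop b\<close> is right multiplication by the letter b, seen on functions.
  \<open>rop_add\<close> says that the letter is primitive, where the coproduct of a function is u
  (g + h); \<open>rop_zero\<close> and \<open>e_Nil_0\<close> make evaluation at 0 the counit;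
  \<open>rop_rel\<close> is x y - y x = 2 x.\<close>

locale tens_eval =
  fixes e :: "bool list \<Rightarrow> 'g::comm_monoid_add \<Rightarrow> 'k::field_char_0"
    and rop :: "bool \<Rightarrow> ('g \<Rightarrow> 'k) \<Rightarrow> 'g \<Rightarrow> 'k"
  assumes e_snoc: "e (w @ [b]) = rop b (e w)"
    and e_Nil_add: "e [] (g + h) = e [] g * e [] h"
    and e_Nil_0: "e [] 0 = 1"
    and rop_linear: "rop b (\<lambda>g. x * u g + y * v g) g = x * rop b u g + y * rop b v g"
    and rop_zero: "rop b u 0 = 0"
    and rop_add: "rop b u (g + h) = rop b (\<lambda>x. u (x + h)) g + rop b (\<lambda>x. u (g + x)) h"
    and rop_rel: "rop True (rop False u) g - rop False (rop True u) g = 2 * rop False u g"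
begin

lemma rop_0 [simp]: "rop b (\<lambda>_. 0) g = 0"
  using rop_linear[of b 0 "\<lambda>_. 0" 0 "\<lambda>_. 0" g] by simp

lemma rop_smul: "rop b (\<lambda>g. x * u g) g = x * rop b u g"
  using rop_linear[of b x u 0 "\<lambda>_. 0" g] by simp

lemma rop_plus: "rop b (\<lambda>g. u g + v g) g = rop b u g + rop b v g"
  using rop_linear[of b 1 u 1 v g] by simp

lemma rop_sum: "rop b (\<lambda>g. \<Sum>i\<in>I. F i g) g = (\<Sum>i\<in>I. rop b (F i) g)"
  by (induction I rule: infinite_finite_induct) (simp_all add: rop_plus)

lemma rop_sum_arg:
  "finite I \<Longrightarrow> rop b u (\<Sum>i\<in>I. h i) = (\<Sum>j\<in>I. rop b (\<lambda>x. u (x + (\<Sum>i\<in>I - {j}. h i))) (h j))"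
proof (induction I arbitrary: u rule: finite_induct)
  case (insert k I)
  have 1: "(\<Sum>i\<in>insert k I - {j}. h i) = h k + (\<Sum>i\<in>I - {j}. h i)" if "j \<in> I" for j
  proof -
    have "insert k I - {j} = insert k (I - {j})" using insert that by auto
    then show ?thesis using insert by simp
  qed
  have "rop b u (\<Sum>i\<in>insert k I. h i) = rop b u (h k + (\<Sum>i\<in>I. h i))"
    using insert by simp
  also have "\<dots> = rop b (\<lambda>x. u (x + (\<Sum>i\<in>I. h i))) (h k) + rop b (\<lambda>x. u (h k + x)) (\<Sum>i\<in>I. h i)"
    by (rule rop_add)
  also have "rop b (\<lambda>x. u (h k + x)) (\<Sum>i\<in>I. h i)
      = (\<Sum>j\<in>I. rop b (\<lambda>x. u (x + (\<Sum>i\<in>insert k I - {j}. h i))) (h j))"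
    unfolding insert.IH using 1 by (intro sum.cong) (simp_all add: add_ac)
  finally show ?case
    using insert by simp
qed (simp add: rop_zero)

text \<open>A coloring sends the last letter to one of m slots, and the iterated Leibniz rule
  \<open>rop_sum_arg\<close> is a sum over the same slots. The arguments h vary in the induction
  because one of them becomes the variable on which \<open>rop\<close> acts.\<close>

lemma e_colorings:
  "(\<Sum>cs\<in>colorings w m. \<Prod>j<m. e (subword w cs j) (h j)) = e w (\<Sum>j<m. h j)"
proof (induction w arbitrary: h rule: rev_induct)
  case Nil
  have "(\<Prod>j<m. e [] (h j)) = e [] (\<Sum>j<m. h j)"
    by (induction m) (simp_all add: e_Nil_0 e_Nil_add)
  then show ?case by simp
next
  case (snoc b w)
  have "(\<Prod>j<m. e (subword (w @ [b]) (cs @ [i]) j) (h j))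
      = rop b (\<lambda>x. \<Prod>j<m. e (subword w cs j) ((h(i := x)) j)) (h i)"
    if "cs \<in> colorings w m" "i < m" for cs i
  proof -
    have len: "length cs = length w" using that by (simp add: colorings_def)
    \<comment> \<open>As a function of the entry in slot i the product is a constant times a single
      evaluation, so \<open>rop\<close> acts on that factor alone.\<close>
    have 1: "(\<Prod>j<m. e (subword w cs j) ((h(i := x)) j))
        = (\<Prod>j\<in>{..<m} - {i}. e (subword w cs j) (h j)) * e (subword w cs i) x" for x
      using that by (subst prod.remove[of "{..<m}" i]) (auto simp: mult.commute)
    have "(\<Prod>j<m. e (subword (w @ [b]) (cs @ [i]) j) (h j))
        = e (subword w cs i @ [b]) (h i) * (\<Prod>j\<in>{..<m} - {i}. e (subword w cs j) (h j))"
      using that len by (subst prod.remove[of "{..<m}" i]) (auto simp: subword_snoc)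
    then show ?thesis
      unfolding 1 by (simp add: rop_smul e_snoc)
  qed
  then have "(\<Sum>cs\<in>colorings (w @ [b]) m. \<Prod>j<m. e (subword (w @ [b]) cs j) (h j))
      = (\<Sum>cs\<in>colorings w m. \<Sum>i<m. rop b (\<lambda>x. \<Prod>j<m. e (subword w cs j) ((h(i := x)) j)) (h i))"
    unfolding sum_colorings_snoc by (intro sum.cong) auto
  also have "\<dots> = (\<Sum>i<m. rop b (\<lambda>x. \<Sum>cs\<in>colorings w m. \<Prod>j<m. e (subword w cs j) ((h(i := x)) j)) (h i))"
    by (subst sum.swap) (simp add: rop_sum)
  also have "\<dots> = (\<Sum>i<m. rop b (\<lambda>x. e w (x + (\<Sum>j\<in>{..<m} - {i}. h j))) (h i))"
  proof (intro sum.cong refl)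
    fix i assume "i \<in> {..<m}"
    then have "(\<Sum>j<m. (h(i := x)) j) = x + (\<Sum>j\<in>{..<m} - {i}. h j)" for x
      by (subst sum.remove[of "{..<m}" i]) auto
    then show "rop b (\<lambda>x. \<Sum>cs\<in>colorings w m. \<Prod>j<m. e (subword w cs j) ((h(i := x)) j)) (h i)
       = rop b (\<lambda>x. e w (x + (\<Sum>j\<in>{..<m} - {i}. h j))) (h i)"
      by (simp only: snoc.IH)
  qed
  also have "\<dots> = e (w @ [b]) (\<Sum>i<m. h i)"
    by (simp add: e_snoc rop_sum_arg[symmetric])
  finally show ?case .
qed

text \<open>The value 0 at lists of any other length lets a single function \<open>EV\<close> carry
  all tensor lengths at once.\<close>

definition evb :: "bool list list \<Rightarrow> 'g list \<Rightarrow> 'k" where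
  "evb ws gs = (if length ws = length gs then \<Prod>i<length ws. e (ws ! i) (gs ! i) else 0)"

definition EV :: "'k tens \<Rightarrow> 'g list \<Rightarrow> 'k" where
  "EV = lext evb"

lemma evb_Nil [simp]: "evb [] [] = 1" "evb [] (g # gs) = 0" "evb (w # ws) [] = 0"
  by (simp_all add: evb_def)

lemma evb_Cons [simp]: "evb (w # ws) (g # gs) = e w g * evb ws gs"
  by (simp add: evb_def prod.lessThan_Suc_shift del: prod.lessThan_Suc)

lemma evb_append: "length xs = length gs \<Longrightarrow> evb (xs @ ys) (gs @ hs) = evb xs gs * evb ys hs"
  by (induction xs gs rule: list_induct2) simp_all

lemma EV_bas [simp]: "EV (bas ws) = evb ws"
  by (simp add: EV_def)

lemma evb_len: "length ws \<noteq> length gs \<Longrightarrow> evb ws gs = 0"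
  by (simp add: evb_def)

lemma EV_add: "finite (supp f) \<Longrightarrow> finite (supp h) \<Longrightarrow> EV (\<lambda>z. f z + h z) gs = EV f gs + EV h gs"
  by (simp add: EV_def lext_add)

lemma EV_diff: "finite (supp f) \<Longrightarrow> finite (supp h) \<Longrightarrow> EV (\<lambda>z. f z - h z) gs = EV f gs - EV h gs"
  by (simp add: EV_def lext_diff)

lemma EV_smul: "finite (supp f) \<Longrightarrow> EV (\<lambda>z. c * f z) gs = c * EV f gs"
  by (simp add: EV_def lext_smul)

lemma EV_sum: "(\<And>i. i \<in> I \<Longrightarrow> finite (supp (F i))) \<Longrightarrow> EV (\<lambda>z. \<Sum>i\<in>I. F i z) gs = (\<Sum>i\<in>I. EV (F i) gs)"
  by (simp add: EV_def lext_sum)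

lemma EV_zero [simp]: "EV (\<lambda>_. 0) gs = 0"
  by (simp add: EV_def)

lemma EV_hom:
  assumes "\<And>ws. ws \<in> supp \<Phi> \<Longrightarrow> length ws = n" "length gs \<noteq> n"
  shows "EV \<Phi> gs = 0"
  unfolding EV_def lext_def using assms by (intro sum.neutral) (auto simp: evb_len)

lemma evb_map_upt:
  "length hs = m \<Longrightarrow> evb (map F [0..<m]) hs = (\<Prod>j<m. e (F j) (hs ! j))"
  by (simp add: evb_def)

text \<open>By \<open>e_colorings\<close> the factor l sees only the sum of its m entries. For m = 0
  this is the empty sum 0, where evaluation is the counit.\<close>

lemma EV_expand:
  assumes "l < length ws" "length gs = length ws - 1 + m"
  shows "EV (expand_b l m ws) gs = evb ws (take l gs @ [\<Sum>j<m. gs ! (l + j)] @ drop (l + m) gs)"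
proof -
  define G1 G2 G3 where "G1 = take l gs" and "G2 = take m (drop l gs)" and "G3 = drop (l + m) gs"
  have gs: "gs = G1 @ G2 @ G3"
    by (simp add: G1_def G2_def G3_def) (metis add.commute append_take_drop_id drop_drop)
  have len: "length G1 = l" "length G2 = m" "length G3 = length ws - 1 - l"
    using assms by (auto simp: G1_def G2_def G3_def)
  have G2n: "G2 ! j = gs ! (l + j)" if "j < m" for j
    using that assms by (simp add: G2_def)
  have ws: "ws = take l ws @ [ws ! l] @ drop (Suc l) ws"
    using assms by (simp add: id_take_nth_drop)
  have "EV (expand_b l m ws) gs
      = (\<Sum>cs\<in>colorings (ws ! l) m. evb (take l ws @ map (subword (ws ! l) cs) [0..<m] @ drop (Suc l) ws) gs)"
    unfolding expand_b_def by (subst EV_sum) simp_all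
  also have "\<dots> = (\<Sum>cs\<in>colorings (ws ! l) m. evb (take l ws) G1 * 
       ((\<Prod>j<m. e (subword (ws ! l) cs j) (gs ! (l + j))) * evb (drop (Suc l) ws) G3))"
    unfolding gs using assms len
    by (intro sum.cong refl) (simp add: evb_append evb_map_upt nth_append)
  also have "\<dots> = evb (take l ws) G1 * (e (ws ! l) (\<Sum>j<m. gs ! (l + j)) * evb (drop (Suc l) ws) G3)"
    by (simp add: sum_distrib_left[symmetric] sum_distrib_right[symmetric] e_colorings)
  also have "\<dots> = evb (take l ws @ [ws ! l] @ drop (Suc l) ws) (G1 @ [\<Sum>j<m. gs ! (l + j)] @ G3)"
    using assms len by (simp add: evb_append)
  finally show ?thesis using ws by (simp add: G1_def G3_def)
qed

lemma fin_expand: "finite (supp (expand_b l m ws :: 'k tens))"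
  unfolding expand_b_def by (intro fin_sum) simp

lemma fin_delta: "finite (supp (delta_b ws :: 'k tens))"
  unfolding delta_b_def Let_def by (intro fin_add fin_diff fin_sum fin_smul fin_expand) simp_all

lemma fin_hdiff: "finite (supp (\<Phi> :: 'k tens)) \<Longrightarrow> finite (supp (hdiff \<Phi>))"
  unfolding hdiff_def by (intro fin_lext fin_delta)

lemma supp_expand: "zs \<in> supp (expand_b l m ws :: 'k tens) \<Longrightarrow> l < length ws \<Longrightarrow> length zs = length ws - 1 + m"
proof -
  assume *: "zs \<in> supp (expand_b l m ws :: 'k tens)" "l < length ws"
  then obtain cs where "(bas (take l ws @ map (subword (ws ! l) cs) [0..<m] @ drop (Suc l) ws) :: 'k tens) zs \<noteq> 0"
    by (auto simp: supp_def expand_b_def elim: sum.not_neutral_contains_not_neutral)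
  then show ?thesis using *(2) by (auto simp: bas_def split: if_splits)
qed

lemma supp_delta: "zs \<in> supp (delta_b ws :: 'k tens) \<Longrightarrow> length zs = Suc (length ws)"
proof (rule ccontr)
  assume *: "zs \<in> supp (delta_b ws :: 'k tens)" "length zs \<noteq> Suc (length ws)"
  have "(expand_b l 2 ws :: 'k tens) zs = 0" if "l < length ws" for l
  proof (rule ccontr)
    assume "(expand_b l 2 ws :: 'k tens) zs \<noteq> 0"
    then have "length zs = length ws - 1 + 2" using supp_expand[of zs l 2 ws] that by (simp add: supp_def)
    then show False using that *(2) by linarith
  qed
  moreover have "(bas (ws @ [[]]) :: 'k tens) zs = 0" "(bas ([] # ws) :: 'k tens) zs = 0"
    using *(2) by (auto simp: bas_def)
  ultimately show False using *(1) by (simp add: supp_def delta_b_def Let_def)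
qed

lemma supp_hdiff:
  assumes "\<And>ws. ws \<in> supp \<Phi> \<Longrightarrow> length ws = n" "zs \<in> supp (hdiff (\<Phi> :: 'k tens))"
  shows "length zs = Suc n"
  using assms(2) assms(1) unfolding hdiff_def by (auto elim!: supp_lextE dest!: supp_delta)

text \<open>Doubling the factor l adds two neighbouring entries, and a tensor factor 1 contributes
  the counit; the Drinfeld differential thus becomes that of the bar complex.\<close>

lemma EV_delta:
  assumes "length gs = Suc (length ws)"
  shows "EV (delta_b ws) gs = bard (e []) (length ws) (evb ws) gs"
proof -
  have ne: "gs \<noteq> []" using assms by auto
  have 1: "evb (ws @ [[]]) gs = evb ws (butlast gs) * e [] (last gs)"
    by (subst append_butlast_last_id[OF ne, symmetric], subst evb_append) (use assms in auto)
  have 2: "evb ([] # ws) gs = e [] (hd gs) * evb ws (tl gs)"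
    using ne by (cases gs) auto
  have 3: "EV (expand_b l 2 ws) gs = evb ws (merge l gs)" if "l < length ws" for l
    using that assms by (subst EV_expand) (auto simp: merge_def numeral_2_eq_2)
  show ?thesis
    unfolding delta_b_def Let_def bard_def
    by (simp add: EV_add EV_diff EV_sum EV_smul fin_add fin_diff fin_sum fin_smul fin_expand 1 2 3)
qed

lemma EV_hdiff:
  assumes "finite (supp \<Phi>)" "\<And>ws. ws \<in> supp \<Phi> \<Longrightarrow> length ws = n" "length gs = Suc n"
  shows "EV (hdiff \<Phi>) gs = bard (e []) n (EV \<Phi>) gs"
proof -
  have "EV (hdiff \<Phi>) gs = lext (\<lambda>ws. EV (delta_b ws)) \<Phi> gs"
    unfolding EV_def hdiff_def using assms(1) by (intro lext_lext fin_delta)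
  also have "\<dots> = lext (\<lambda>ws. bard (e []) n (evb ws)) \<Phi> gs"
    using assms by (intro lext_cong) (simp add: EV_delta)
  also have "\<dots> = bard (e []) n (EV \<Phi>) gs"
    unfolding lext_def EV_def bard_def
    by (simp add: sum.distrib sum_subtractf sum_distrib_left sum_distrib_right algebra_simps)
       (rule sum.swap)
  finally show ?thesis .
qed

end

section \<open>Reduction to ordered words\<close>

lemma tmul_rel_at:
  assumes "length us = m" "length vs = m" "i < m"
  defines "L \<equiv> \<lambda>w. (map2 (@) us vs)[i := us ! i @ w @ vs ! i]"
  shows "tmul (tmul (bas us) (rel_at i m)) (bas vs)
    = (\<lambda>z. bas (L [False, True]) z - bas (L [True, False]) z - 2 * bas (L [False]) z :: 'k::comm_ring_1)"
proof -
  let ?D = "\<lambda>x y w z. bas x z - bas y z - 2 * bas w z :: 'k"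
  define M where "M = (\<lambda>w. replicate i [] @ [w] @ replicate (m - 1 - i) ([] :: bool list))"
  have lin: "lext g (?D x y w) z = g x z - g y z - 2 * g w z" for g x y w z
    by (simp add: lext_diff lext_smul fin_diff fin_smul)
  have 1: "rel_at i m = ?D (M [False, True]) (M [True, False]) (M [False])"
    unfolding rel_at_def ttens_def rel_def tone_def lext2_eq M_def by (simp add: lin fun_eq_iff)
  have 2: "tmul (tmul (bas us) (rel_at i m)) (bas vs)
    = ?D (map2 (@) (map2 (@) us (M [False, True])) vs) (map2 (@) (map2 (@) us (M [True, False])) vs)
       (map2 (@) (map2 (@) us (M [False])) vs)"
    unfolding 1 tmul_def lext2_eq by (simp add: lin fun_eq_iff)
  have 3: "map2 (@) (map2 (@) us (M w)) vs = L w" for w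
  proof (rule nth_equalityI)
    fix j assume "j < length (map2 (@) (map2 (@) us (M w)) vs)"
    then have "j < m" using assms by (simp add: M_def)
    moreover have "M w ! j = (if j = i then w else [])"
      using \<open>j < m\<close> assms by (auto simp: M_def nth_append nth_Cons')
    moreover have "length (M w) = m" using assms by (simp add: M_def)
    ultimately show "map2 (@) (map2 (@) us (M w)) vs ! j = L w ! j"
      using assms by (simp add: L_def nth_list_update)
  qed (use assms in \<open>simp add: M_def\<close>)
  show ?thesis unfolding 2 3 ..
qed

lemma JgenE:
  assumes "a \<in> Jgen"
  obtains us vs i where "length vs = length us" "i < length us"
    "a = (\<lambda>z. bas ((map2 (@) us vs)[i := us ! i @ [False, True] @ vs ! i]) z
       - bas ((map2 (@) us vs)[i := us ! i @ [True, False] @ vs ! i]) z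
       - 2 * bas ((map2 (@) us vs)[i := us ! i @ [False] @ vs ! i]) z :: 'k::comm_ring_1)"
proof -
  from assms obtain us vs i where *: "length vs = length us" "i < length us"
    "a = tmul (tmul (bas us) (rel_at i (length us))) (bas vs)"
    unfolding Jgen_def by auto
  show ?thesis
    by (rule that[OF *(1,2)]) (use * in \<open>simp add: tmul_rel_at\<close>)
qed

text \<open>One application of x y = y x + 2 x inside the factor i.\<close>

lemma Jeq_swap:
  assumes "i < length ws" "ws ! i = u @ [False, True] @ v"
  shows "Jeq (bas ws) (\<lambda>z. bas (ws[i := u @ [True, False] @ v]) z + 2 * bas (ws[i := u @ [False] @ v]) z :: 'k::comm_ring_1)"
proof -
  \<comment> \<open>All other factors are put entirely into the left multiplier; the right one is
    empty there.\<close>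
  define us vs where "us = ws[i := u]" and "vs = (replicate (length ws) [])[i := v]"
  have len: "length us = length ws" "length vs = length ws" by (simp_all add: us_def vs_def)
  have J: "tmul (tmul (bas us) (rel_at i (length ws))) (bas vs) \<in> (Jgen :: 'k tens set)"
    unfolding Jgen_def using assms len by blast
  have L: "(map2 (@) us vs)[i := us ! i @ w @ vs ! i] = ws[i := u @ w @ v]" for w
    using assms len by (intro nth_equalityI) (auto simp: us_def vs_def nth_list_update)
  have W: "ws[i := u @ [False, True] @ v] = ws"
    using assms by (metis list_update_id)
  have "(\<lambda>z. bas ws z - bas (ws[i := u @ [True, False] @ v]) z - 2 * bas (ws[i := u @ [False] @ v]) z :: 'k) \<in> Jgen"
    using J unfolding tmul_rel_at[OF len assms(1)] L W .
  then show ?thesis unfolding Jeq_def by (auto simp: algebra_simps dest: lspan.gen)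
qed

text \<open>The ordered word y^a x^b.\<close>

definition sw :: "nat \<times> nat \<Rightarrow> bool list" where
  "sw = (\<lambda>(a, b). replicate a True @ replicate b False)"

text \<open>Each y counts one more than the number of x before it, and c is the number of x already
  passed. Both words produced by rewriting x y are therefore smaller.\<close>

fun wmeas :: "nat \<Rightarrow> bool list \<Rightarrow> nat" where
  "wmeas c [] = 0"
| "wmeas c (b # w) = (if b then Suc c + wmeas c w else wmeas (Suc c) w)"

lemma wmeas_swap:
  "wmeas c (u @ True # False # v) < wmeas c (u @ False # True # v)"
  "wmeas c (u @ False # v) < wmeas c (u @ False # True # v)"
  by (induction u arbitrary: c) auto

lemma word_cases:
  obtains (sorted) x where "w = sw x" | (swap) u v where "w = u @ [False, True] @ v"
proof -
  have "(\<exists>x. w = sw x) \<or> (\<exists>u v. w = u @ [False, True] @ v)"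
  proof (induction w)
    case Nil
    then show ?case by (auto simp: sw_def intro: exI[of _ 0])
  next
    case (Cons b w)
    then consider a c where "w = sw (a, c)" | u v where "w = u @ [False, True] @ v" by auto
    then show ?case
    proof cases
      case (1 a c)
      show ?thesis
      proof (cases b)
        case True
        then have "b # w = sw (Suc a, c)" using 1 by (simp add: sw_def)
        then show ?thesis by blast
      next
        case False
        show ?thesis
        proof (cases a)
          case 0
          then have "b # w = sw (0, Suc c)" using 1 False by (simp add: sw_def)
          then show ?thesis by blast
        next
          case (Suc a')
          then have "b # w = [] @ [False, True] @ sw (a', c)" using 1 False by (simp add: sw_def)
          then show ?thesis by blast
        qed
      qed
    next
      case (2 u v)
      then have "b # w = (b # u) @ [False, True] @ v" by simp
      then show ?thesis by blast
    qed
  qed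
  then show ?thesis using that by blast
qed

lemma sum_list_update_less:
  "i < length ws \<Longrightarrow> f v < f (ws ! i) \<Longrightarrow> sum_list (map f (ws[i := v])) < (sum_list (map f ws) :: nat)"
proof (induction ws arbitrary: i)
  case (Cons a ws)
  then show ?case by (cases i) auto
qed simp

lemma bas_reduce:
  "\<exists>\<Phi>. finite (supp \<Phi>) \<and> supp \<Phi> \<subseteq> range (map sw) \<and> Jeq (bas ws) (\<Phi> :: 'k::comm_ring_1 tens)"
proof (induction "sum_list (map (wmeas 0) ws)" arbitrary: ws rule: less_induct)
  case less
  show ?case
  proof (cases "\<forall>i<length ws. \<exists>x. ws ! i = sw x")
    case True
    then obtain X where X: "\<And>i. i < length ws \<Longrightarrow> ws ! i = sw (X i)" by metis
    have "ws = map sw (map X [0..<length ws])"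
      by (intro nth_equalityI) (simp_all add: X)
    then have "supp (bas ws :: 'k tens) \<subseteq> range (map sw)" by (metis supp_bas empty_subsetI insert_subset rangeI)
    then show ?thesis using Jeq_refl[of "bas ws"] by (intro exI[of _ "bas ws"]) (auto simp del: supp_bas simp: supp_bas[of ws])
  next
    case False
    then obtain i where i: "i < length ws" "\<nexists>x. ws ! i = sw x" by blast
    then obtain u v where uv: "ws ! i = u @ [False, True] @ v" by (metis word_cases)
    from less[of "ws[i := u @ [True, False] @ v]"] obtain \<Phi>1 :: "'k tens" where
      1: "finite (supp \<Phi>1)" "supp \<Phi>1 \<subseteq> range (map sw)" "Jeq (bas (ws[i := u @ [True, False] @ v])) \<Phi>1"
      using sum_list_update_less[OF i(1)] wmeas_swap[of 0 u v] uv by fastforce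
    from less[of "ws[i := u @ [False] @ v]"] obtain \<Phi>2 :: "'k tens" where
      2: "finite (supp \<Phi>2)" "supp \<Phi>2 \<subseteq> range (map sw)" "Jeq (bas (ws[i := u @ [False] @ v])) \<Phi>2"
      using sum_list_update_less[OF i(1)] wmeas_swap[of 0 u v] uv by fastforce
    have "Jeq (bas ws) (\<lambda>z. \<Phi>1 z + 2 * \<Phi>2 z)"
      by (rule Jeq_trans[OF Jeq_swap[OF i(1) uv]]) (intro Jeq_add Jeq_smul 1 2)
    moreover have "supp (\<lambda>z. \<Phi>1 z + 2 * \<Phi>2 z) \<subseteq> range (map sw)"
    proof -
      have "supp (\<lambda>z. \<Phi>1 z + 2 * \<Phi>2 z) \<subseteq> supp \<Phi>1 \<union> supp \<Phi>2" by (auto simp: supp_def)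
      then show ?thesis using 1 2 by blast
    qed
    ultimately show ?thesis using fin_add[OF 1(1) fin_smul[OF 2(1), of 2]] by blast
  qed
qed

lemma reduce:
  assumes "finite (supp (\<Phi> :: 'k::comm_ring_1 tens))"
  obtains \<Phi>' where "finite (supp \<Phi>')" "supp \<Phi>' \<subseteq> range (map sw)" "Jeq \<Phi> \<Phi>'"
proof -
  obtain r where r: "\<And>ws. finite (supp (r ws)) \<and> supp (r ws) \<subseteq> range (map sw) \<and> Jeq (bas ws) (r ws :: 'k tens)"
    using bas_reduce by metis
  have "Jeq (\<lambda>z. \<Sum>ws\<in>supp \<Phi>. \<Phi> ws * bas ws z) (lext r \<Phi>)"
    unfolding lext_def by (intro Jeq_sum Jeq_smul) (use r in blast)
  moreover have "(\<lambda>z. \<Sum>ws\<in>supp \<Phi>. \<Phi> ws * bas ws z) = \<Phi>"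
  proof
    fix z
    have "(\<Sum>ws\<in>supp \<Phi>. \<Phi> ws * bas ws z) = (\<Sum>ws\<in>supp \<Phi>. if ws = z then \<Phi> z else 0)"
      by (intro sum.cong) (auto simp: bas_def)
    also have "\<dots> = \<Phi> z" using assms by (simp add: supp_def)
    finally show "(\<Sum>ws\<in>supp \<Phi>. \<Phi> ws * bas ws z) = \<Phi> z" .
  qed
  moreover have "supp (lext r \<Phi>) \<subseteq> range (map sw)"
    using r by (auto elim!: supp_lextE)
  moreover have "finite (supp (lext r \<Phi>))"
    using r assms by (intro fin_lext) auto
  ultimately show ?thesis using that by metis
qed

context tens_eval
begin

text \<open>Directly after u this is \<open>rop_rel\<close> applied to \<open>e u\<close>; each
  further letter of v applies a linear operator to an identity between functions and so preserves
  it.\<close>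

lemma e_rel: "e (u @ [False, True] @ v) g - e (u @ [True, False] @ v) g - 2 * e (u @ [False] @ v) g = 0"
proof (induction v arbitrary: g rule: rev_induct)
  case Nil
  have "e (u @ [a, b]) = rop b (rop a (e u))" for a b
    using e_snoc[of "u @ [a]" b] by (simp add: e_snoc)
  then show ?case by (simp add: e_snoc rop_rel)
next
  case (snoc b v)
  have 1: "e (u @ w @ v @ [b]) = rop b (e (u @ w @ v))" for w
    using e_snoc[of "u @ w @ v" b] by simp
  have "rop b (\<lambda>g. 1 * (e (u @ [False, True] @ v) g - e (u @ [True, False] @ v) g) + (-2) * e (u @ [False] @ v) g) g = 0"
    using snoc by simp
  then show ?case
    unfolding 1 rop_linear using rop_linear[of b 1 "e (u @ [False, True] @ v)" "-1" "e (u @ [True, False] @ v)" g]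
    by simp
qed

lemma evb_update:
  assumes "i < length ws" "length gs = length ws"
  shows "evb (ws[i := w]) gs = e w (gs ! i) * (\<Prod>j\<in>{..<length ws} - {i}. e (ws ! j) (gs ! j))"
  using assms by (simp add: evb_def prod.remove[of _ i])

lemma EV_Jgen:
  assumes "a \<in> Jgen"
  shows "finite (supp a) \<and> EV a gs = 0"
proof -
  from assms obtain us vs i where *: "length vs = length us" "i < length us"
    "a = (\<lambda>z. bas ((map2 (@) us vs)[i := us ! i @ [False, True] @ vs ! i]) z
       - bas ((map2 (@) us vs)[i := us ! i @ [True, False] @ vs ! i]) z
       - 2 * bas ((map2 (@) us vs)[i := us ! i @ [False] @ vs ! i]) z)"
    by (rule JgenE)
  have fin: "finite (supp a)" unfolding *(3) by (intro fin_diff fin_smul) simp_all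
  show ?thesis
  proof (cases "length gs = length us")
    case True
    define P where "P = (\<Prod>j\<in>{..<length us} - {i}. e (map2 (@) us vs ! j) (gs ! j))"
    have "EV a gs = (e (us ! i @ [False, True] @ vs ! i) (gs ! i)
        - e (us ! i @ [True, False] @ vs ! i) (gs ! i) - 2 * e (us ! i @ [False] @ vs ! i) (gs ! i)) * P"
      unfolding *(3) using * True
      by (simp add: EV_diff EV_smul fin_diff fin_smul evb_update P_def left_diff_distrib mult.assoc)
    then show ?thesis using fin by (simp only: e_rel mult_zero_left simp_thms)
  next
    case False
    then show ?thesis using * fin by (simp add: EV_diff EV_smul fin_diff fin_smul evb_len)
  qed
qed

lemma EV_lspan:
  assumes "a \<in> lspan Jgen"
  shows "finite (supp a) \<and> EV a gs = 0"
  using assms by induction (simp_all add: EV_Jgen EV_add EV_smul fin_add fin_smul)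

lemma EV_Jeq:
  assumes "Jeq a b" "finite (supp a)" "finite (supp b)"
  shows "EV a gs = EV b gs"
  using EV_lspan[of "\<lambda>z. a z - b z" gs] assms by (simp add: Jeq_def EV_diff)

text \<open>Evaluation kills \<open>Jgen\<close>, so a - b may be replaced by its reduction to
  ordered words. That reduction evaluates to 0 everywhere, hence is 0 by independence.\<close>

lemma Jeq_if_EV:
  assumes indep: "\<And>\<Phi>. finite (supp \<Phi>) \<Longrightarrow> supp \<Phi> \<subseteq> range (map sw) \<Longrightarrow> (\<And>gs. EV \<Phi> gs = 0) \<Longrightarrow> \<Phi> = (\<lambda>_. 0)"
    and fin: "finite (supp a)" "finite (supp b)" and eq: "\<And>gs. EV a gs = EV b gs"
  shows "Jeq a b"
proof -
  obtain c where c: "finite (supp c)" "supp c \<subseteq> range (map sw)" "Jeq (\<lambda>z. a z - b z) c"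
    using reduce[OF fin_diff[OF fin]] .
  have "EV c gs = 0" for gs
    using EV_Jeq[OF c(3) fin_diff[OF fin] c(1), of gs] fin eq by (simp add: EV_diff)
  then have "c = (\<lambda>_. 0)" using indep c by blast
  with c(3) show ?thesis by (simp add: Jeq_def)
qed

end

section \<open>The two evaluations: coordinates in the basis y^a x^b, and values of y at
  scalars\<close>

fun nfop :: "bool \<Rightarrow> (nat \<times> nat \<Rightarrow> 'k::field_char_0) \<Rightarrow> nat \<times> nat \<Rightarrow> 'k" where
  "nfop b u (a, c) = (if b then of_nat a * u (a - 1, c) + 2 * of_nat c * u (a, c) else of_nat c * u (a, c - 1))"

text \<open>The value at (a, c) is a! c! times the coefficient of y^a x^c; the factorials remove the
  binomial coefficients from the coproduct. The summand with the factor 2 in \<open>nfop\<close>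
  comes from x^c y = (y + 2 c) x^c.\<close>

definition nf :: "bool list \<Rightarrow> nat \<times> nat \<Rightarrow> 'k::field_char_0" where
  "nf w = foldl (\<lambda>u b. nfop b u) eps w"

interpretation N: tens_eval nf nfop
proof
  fix g h :: "nat \<times> nat" and b :: bool and u v :: "nat \<times> nat \<Rightarrow> 'k::field_char_0" and x y :: 'k and w
  obtain g1 g2 h1 h2 where gh: "g = (g1, g2)" "h = (h1, h2)" by fastforce
  show "nf (w @ [b]) = nfop b (nf w :: nat \<times> nat \<Rightarrow> 'k)" by (simp add: nf_def)
  show "(nf [] (g + h) :: 'k) = nf [] g * nf [] h" by (simp add: nf_def eps_def gh zero_prod_def)
  show "(nf [] (0 :: nat \<times> nat) :: 'k) = 1" by (simp add: nf_def eps_def)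
  show "nfop b (\<lambda>g. x * u g + y * v g) g = x * nfop b u g + y * nfop b v g"
    by (simp add: gh algebra_simps)
  show "nfop b u 0 = 0" by (simp add: zero_prod_def)
  show "nfop b u (g + h) = nfop b (\<lambda>x. u (x + h)) g + nfop b (\<lambda>x. u (g + x)) h"
    unfolding gh by (cases g1; cases g2; cases h1; cases h2) (simp_all add: algebra_simps)
  show "nfop True (nfop False u) g - nfop False (nfop True u) g = 2 * nfop False u g"
    unfolding gh by (cases g2) (simp_all add: algebra_simps)
qed

fun evop :: "bool \<Rightarrow> ('k \<times> nat \<Rightarrow> 'k) \<Rightarrow> 'k \<times> nat \<Rightarrow> 'k::field_char_0" where
  "evop b u (s, n) = (if b then (s + 2 * of_nat n) * u (s, n) else of_nat n * u (s, n - 1))"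

definition ev0 :: "'k \<times> nat \<Rightarrow> 'k::field_char_0" where
  "ev0 g = (if snd g = 0 then 1 else 0)"

text \<open>If w is the sum of the P_n(y) x^n, the value at (s, n) is n! P_n(s). Evaluation of y at
  a scalar turns its coproduct into addition of scalars, so only the powers of x need
  factorials.\<close>

definition ev :: "bool list \<Rightarrow> 'k \<times> nat \<Rightarrow> 'k::field_char_0" where
  "ev w = foldl (\<lambda>u b. evop b u) ev0 w"

interpretation V: tens_eval ev evop
proof
  fix g h :: "'k::field_char_0 \<times> nat" and b :: bool and u v :: "'k \<times> nat \<Rightarrow> 'k" and x y :: 'k and w
  obtain g1 g2 h1 h2 where gh: "g = (g1, g2)" "h = (h1, h2)" by fastforce
  show "ev (w @ [b]) = evop b (ev w :: 'k \<times> nat \<Rightarrow> 'k)" by (simp add: ev_def)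
  show "ev [] (g + h) = ev [] g * ev [] h" by (simp add: ev_def ev0_def gh)
  show "ev [] (0 :: 'k \<times> nat) = 1" by (simp add: ev_def ev0_def)
  show "evop b (\<lambda>g. x * u g + y * v g) g = x * evop b u g + y * evop b v g"
    by (simp add: gh algebra_simps)
  show "evop b u 0 = 0" by (simp add: zero_prod_def)
  show "evop b u (g + h) = evop b (\<lambda>x. u (x + h)) g + evop b (\<lambda>x. u (g + x)) h"
    unfolding gh by (cases g2; cases h2) (simp_all add: algebra_simps)
  show "evop True (evop False u) g - evop False (evop True u) g = 2 * evop False u g"
    unfolding gh by (cases g2) (simp_all add: algebra_simps)
qed

lemma nf_sw: "nf (sw x) y = (if x = y then fact (fst x) * fact (snd x) else 0 :: 'k::field_char_0)"
proof -
  obtain a b where x: "x = (a, b)" by fastforce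
  have 1: "nf (replicate a True) (c, d) = (if c = a \<and> d = 0 then fact a else 0 :: 'k)" for c d
  proof (induction a arbitrary: c d)
    case 0
    then show ?case by (auto simp: nf_def eps_def zero_prod_def)
  next
    case (Suc a)
    then show ?case unfolding replicate_Suc replicate_append_same[symmetric] N.e_snoc
      by (cases c) (auto simp: algebra_simps)
  qed
  have "nf (replicate a True @ replicate b False) (c, d) = (if c = a \<and> d = b then fact a * fact b else 0 :: 'k)" for c d
  proof (induction b arbitrary: c d)
    case 0
    then show ?case by (simp add: 1)
  next
    case (Suc b)
    then show ?case unfolding replicate_Suc replicate_append_same[symmetric] append_assoc[symmetric] N.e_snoc
      by (cases d) (auto simp: algebra_simps)
  qed
  then show ?thesis by (cases y) (auto simp: x sw_def)
qed

lemma N_evb_sw: "length x = length y \<Longrightarrow> N.evb (map sw x) y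
    = (if x = y then (\<Prod>i<length x. fact (fst (x ! i)) * fact (snd (x ! i))) else 0 :: 'k::field_char_0)"
  by (induction x y rule: list_induct2) (auto simp: nf_sw prod.lessThan_Suc_shift simp del: prod.lessThan_Suc)

lemma inj_sw: "inj sw"
proof (rule injI)
  fix x y assume "sw x = sw y"
  then have "(nf (sw x) x :: rat) = nf (sw y) x" by simp
  then show "x = y" by (auto simp: nf_sw split: if_splits)
qed

text \<open>On ordered words of a given length the evaluations form a diagonal matrix whose entries
  are products of factorials, nonzero in characteristic zero.\<close>

lemma N_indep:
  assumes "finite (supp \<Phi>)" "supp \<Phi> \<subseteq> range (map sw)" "\<And>gs. N.EV \<Phi> gs = 0"
  shows "\<Phi> = (\<lambda>_. 0 :: 'k::field_char_0)"
proof
  fix ws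
  show "\<Phi> ws = 0"
  proof (rule ccontr)
    assume nz: "\<Phi> ws \<noteq> 0"
    then have "ws \<in> supp \<Phi>" by (simp add: supp_def)
    with assms(2) obtain x where x: "ws = map sw x" by auto
    have "\<Phi> ws' * N.evb ws' x = 0" if ws': "ws' \<in> supp \<Phi> - {ws}" for ws'
    proof -
      obtain x' where x': "ws' = map sw x'" using ws' assms(2) by auto
      then show ?thesis using ws' by (cases "length x' = length x") (auto simp: N_evb_sw x N.evb_len)
    qed
    then have "(\<Sum>a\<in>supp \<Phi> - {ws}. \<Phi> a * N.evb a x) = 0" by (rule sum.neutral[OF ballI])
    then have "N.EV \<Phi> x = \<Phi> ws * N.evb ws x"
      unfolding N.EV_def lext_def using assms(1) \<open>ws \<in> supp \<Phi>\<close>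
      by (subst sum.remove[of _ ws]) simp_all
    then show False using assms(3)[of x] nz by (simp add: x N_evb_sw)
  qed
qed

lemmas Jeq_N = N.Jeq_if_EV[OF N_indep]

section \<open>Cohomology of the bar complex of the monoid of pairs of naturals\<close>

text \<open>\<open>bard eps n u\<close> without its first term: the differential of an acyclic complex, in which
  the last argument of a cochain serves as a coefficient.\<close>
definition bar0 :: "nat \<Rightarrow> ('g::comm_monoid_add list \<Rightarrow> 'k::comm_ring_1) \<Rightarrow> 'g list \<Rightarrow> 'k" where
  "bar0 n u gs = sg (int n - 1) * (eps (hd gs) * u (tl gs)) - (\<Sum>l<n. sg (int n - 1 - int l) * u (merge l gs))"

text \<open>The action of the monoid on the last entry, when that entry is read as a
  coefficient.\<close>

definition shl :: "'g::comm_monoid_add \<Rightarrow> 'g list \<Rightarrow> 'g list" where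
  "shl h gs = butlast gs @ [last gs + h]"

lemma bard_eps: "bard eps n u gs = u (butlast gs) * eps (last gs) + bar0 n u gs"
  by (simp add: bard_def bar0_def)

lemma shl_snoc [simp]: "shl h (x @ [g]) = x @ [g + h]"
  by (simp add: shl_def)

lemma shl_0 [simp]: "gs \<noteq> [] \<Longrightarrow> shl 0 gs = gs"
  by (simp add: shl_def)

lemma length_shl [simp]: "gs \<noteq> [] \<Longrightarrow> length (shl h gs) = length gs"
  by (simp add: shl_def)

lemma shl_shl: "shl g (shl h gs) = shl h (shl g gs)"
  by (simp add: shl_def add_ac)

lemma length_merge [simp]: "Suc l < length gs \<Longrightarrow> length (merge l gs) = length gs - 1"
  by (simp add: merge_def)

lemma merge_snoc: "Suc l < length gs \<Longrightarrow> merge l (gs @ [g]) = merge l gs @ [g]"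
  by (simp add: merge_def nth_append)

lemma merge_last: "length gs = Suc n \<Longrightarrow> merge n (gs @ [g]) = shl g gs"
  by (cases gs rule: rev_cases) (auto simp: merge_def nth_append)

lemma merge_shl: "Suc l < length gs \<Longrightarrow> merge l (shl h gs) = shl h (merge l gs)"
proof (cases gs rule: rev_cases)
  case (snoc x g)
  assume l: "Suc l < length gs"
  show ?thesis
  proof (cases "Suc l < length x")
    case True
    then show ?thesis by (simp add: snoc merge_snoc)
  next
    case False
    then have "length x = Suc l" using l snoc by simp
    then obtain y k where x: "x = y @ [k]" "l = length y" by (cases x rule: rev_cases) auto
    show ?thesis by (simp add: snoc x merge_def shl_def nth_append butlast_append add_ac)
  qed
qed simp

lemma bar0_cong:
  assumes "\<And>x. length x = n \<Longrightarrow> u x = v x" "length gs = Suc n"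
  shows "bar0 n u gs = bar0 n v gs"
proof -
  have "u (merge l gs) = v (merge l gs)" if "l < n" for l
    using that assms by simp
  then show ?thesis using assms by (simp add: bar0_def)
qed

lemma bar0_add: "bar0 n (\<lambda>x. u x + v x) gs = bar0 n u gs + bar0 n v gs"
  by (simp add: bar0_def sum.distrib algebra_simps)

lemma bar0_uminus: "bar0 n (\<lambda>x. - u x) gs = - bar0 n u gs"
  by (simp add: bar0_def sum_negf algebra_simps)

lemma bar0_diff: "bar0 n (\<lambda>x. u x - v x) gs = bar0 n u gs - bar0 n v gs"
  using bar0_add[of n u "\<lambda>x. - v x" gs] by (simp add: bar0_uminus)

text \<open>The last face merges g into its neighbour, which is a shift; all other faces leave g
  alone. This recursion replaces the simplicial identities below.\<close>

lemma bar0_snoc: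
  assumes "length gs = Suc n"
  shows "bar0 (Suc n) u (gs @ [g]) = - u (shl g gs) - bar0 n (\<lambda>x. u (x @ [g])) gs"
proof -
  have ne: "gs \<noteq> []" using assms by auto
  have "(\<Sum>l<n. sg (int (Suc n) - 1 - int l) * u (merge l (gs @ [g])))
      = - (\<Sum>l<n. sg (int n - 1 - int l) * u (merge l gs @ [g]))"
    unfolding sum_negf[symmetric] using assms
    by (intro sum.cong refl) (auto simp: merge_snoc sg_def)
  then show ?thesis
    using ne assms by (simp add: bar0_def merge_last sg_diff)
qed

text \<open>For n = 0 the only entry is also the head, and a shift would change its value under
  \<open>eps\<close>.\<close>

lemma bar0_shl:
  assumes "length gs = Suc n" "n \<noteq> 0"
  shows "bar0 n (\<lambda>x. u (shl h x)) gs = bar0 n u (shl h gs)"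
proof -
  have 1: "hd (shl h gs) = hd gs" "tl (shl h gs) = shl h (tl gs)"
    using assms by (cases gs; auto simp: shl_def)+
  show ?thesis using assms by (simp add: bar0_def 1 merge_shl)
qed

lemma eps_add: "eps (g + h) = (eps g * eps (h :: nat \<times> nat) :: 'k::comm_ring_1)"
  by (cases g; cases h) (simp add: eps_def zero_prod_def)

text \<open>Peeling off the last entry of both differentials leaves two shift terms with opposite
  signs and, by induction, nothing else.\<close>

lemma bar0_bar0:
  fixes u :: "(nat \<times> nat) list \<Rightarrow> 'k::comm_ring_1"
  assumes "length gs = Suc (Suc n)"
  shows "bar0 (Suc n) (bar0 n u) gs = 0"
  using assms
proof (induction n arbitrary: u gs)
  case 0
  then obtain g h where "gs = [g, h]" by (auto simp: length_Suc_conv)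
  then show ?case by (simp add: bar0_def merge_def eps_add sg_def)
next
  case (Suc n)
  then obtain x g where gs: "gs = x @ [g]" "length x = Suc (Suc n)" by (auto simp: length_Suc_conv_rev)
  have "bar0 (Suc n) (\<lambda>y. bar0 (Suc n) u (y @ [g])) x = bar0 (Suc n) (\<lambda>y. - u (shl g y) - bar0 n (\<lambda>x. u (x @ [g])) y) x"
    by (intro bar0_cong bar0_snoc) (use gs in auto)
  also have "\<dots> = - bar0 (Suc n) u (shl g x)"
    using gs by (simp add: bar0_diff bar0_uminus Suc.IH bar0_shl)
  finally show ?case
    using gs by (simp add: bar0_snoc)
qed

lemma neg_eqD: "- a = b \<Longrightarrow> a = - (b :: 'a::ab_group_add)"
  by (metis minus_minus)

text \<open>The contracting homotopy puts 0 in the last place: the shift by 0 in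
  \<open>bar0_snoc\<close> returns the cochain itself.\<close>

lemma bar0_exact:
  assumes "\<And>gs. length gs = Suc (Suc n) \<Longrightarrow> bar0 (Suc n) w gs = 0" "length x = Suc n"
  shows "w x = - bar0 n (\<lambda>y. w (y @ [0])) x"
proof -
  have "bar0 (Suc n) w (x @ [0]) = 0" using assms by simp
  moreover have "x \<noteq> []" using assms by auto
  ultimately show ?thesis using assms by (auto simp: bar0_snoc dest: neg_eqD)
qed

section \<open>Weights, finite support and the vanishing of cohomology\<close>

definition wt :: "(nat \<times> nat) list \<Rightarrow> nat" where
  "wt x = (\<Sum>g\<leftarrow>x. fst g + snd g)"

text \<open>There are finitely many lists of given length and bounded weight, so this is finite
  support on n-cochains, in a form suited to merging, which preserves the weight.\<close>

definition bounded_wt :: "nat \<Rightarrow> ((nat \<times> nat) list \<Rightarrow> 'k::zero) \<Rightarrow> bool" where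
  "bounded_wt n u \<longleftrightarrow> (\<exists>N. \<forall>x. length x = n \<longrightarrow> u x \<noteq> 0 \<longrightarrow> wt x \<le> N)"

lemma wt_simps [simp]: "wt [] = 0" "wt (g # x) = fst g + snd g + wt x" "wt (x @ y) = wt x + wt y"
  by (simp_all add: wt_def)

lemma wt_merge:
  assumes "Suc l < length gs"
  shows "wt (merge l gs) = wt gs"
proof -
  have "gs = take l gs @ gs ! l # gs ! Suc l # drop (Suc (Suc l)) gs"
    using assms by (metis Cons_nth_drop_Suc Suc_lessD append_take_drop_id)
  then have "wt gs = wt (take l gs @ gs ! l # gs ! Suc l # drop (Suc (Suc l)) gs)" by simp
  then show ?thesis by (simp add: merge_def)
qed

lemma bounded_wtI: "(\<And>x. length x = n \<Longrightarrow> u x \<noteq> 0 \<Longrightarrow> wt x \<le> N) \<Longrightarrow> bounded_wt n u"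
  by (auto simp: bounded_wt_def)

lemma bounded_wt_add:
  assumes "bounded_wt n u" "bounded_wt n v"
  shows "bounded_wt n (\<lambda>x. u x + v x :: 'k::comm_ring_1)"
proof -
  obtain N M where *: "\<And>x. length x = n \<Longrightarrow> u x \<noteq> 0 \<Longrightarrow> wt x \<le> N" "\<And>x. length x = n \<Longrightarrow> v x \<noteq> 0 \<Longrightarrow> wt x \<le> M"
    using assms unfolding bounded_wt_def by blast
  have "wt x \<le> max N M" if "length x = n" "u x + v x \<noteq> 0" for x
    using *[OF that(1)] that(2) by (cases "u x = 0") (auto simp: max.coboundedI1 max.coboundedI2)
  then show ?thesis by (rule bounded_wtI)
qed

lemma bounded_wt_uminus: "bounded_wt n u \<Longrightarrow> bounded_wt n (\<lambda>x. - u x :: 'k::comm_ring_1)"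
  by (simp add: bounded_wt_def)

lemma bounded_wt_diff: "bounded_wt n u \<Longrightarrow> bounded_wt n v \<Longrightarrow> bounded_wt n (\<lambda>x. u x - v x :: 'k::comm_ring_1)"
  using bounded_wt_add[of n u "\<lambda>x. - v x"] by (simp add: bounded_wt_uminus)

lemma bounded_wt_snoc: "bounded_wt (Suc n) u \<Longrightarrow> bounded_wt n (\<lambda>x. u (x @ [g]))"
  unfolding bounded_wt_def by (metis add_leD1 length_append_singleton wt_simps(3))

lemma bounded_wt_bar0:
  assumes "bounded_wt n u"
  shows "bounded_wt (Suc n) (bar0 n u :: _ \<Rightarrow> 'k::comm_ring_1)"
proof -
  obtain N where N: "\<And>x. length x = n \<Longrightarrow> u x \<noteq> 0 \<Longrightarrow> wt x \<le> N"
    using assms unfolding bounded_wt_def by blast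
  show ?thesis
  proof (rule bounded_wtI)
    fix gs :: "(nat \<times> nat) list" assume len: "length gs = Suc n" and nz: "bar0 n u gs \<noteq> 0"
    show "wt gs \<le> N"
    proof (rule ccontr)
      assume "\<not> wt gs \<le> N"
      then have "u (merge l gs) = 0" if "l < n" for l
        using N[of "merge l gs"] that len by (auto simp: wt_merge)
      moreover have "eps (hd gs) * u (tl gs) = 0"
        using N[of "tl gs"] \<open>\<not> wt gs \<le> N\<close> len by (cases gs; cases "u (tl gs) = 0") (auto simp: eps_def zero_prod_def)
      ultimately show False using nz by (simp add: bar0_def)
    qed
  qed
qed

text \<open>For cochains obtained by dividing the last entry by a generator: the weight of the
  support grows by at most one.\<close>

lemma bounded_wt_unshift:
  assumes "\<And>x. length x = n \<Longrightarrow> w x \<noteq> 0 \<Longrightarrow>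
      (\<exists>y. length y = n \<and> wt x \<le> Suc (wt y) \<and> (u y \<noteq> 0 \<or> v y \<noteq> 0))"
    and "bounded_wt n (u :: _ \<Rightarrow> 'k::comm_ring_1)" "bounded_wt n (v :: _ \<Rightarrow> 'k)"
  shows "bounded_wt n w"
proof -
  obtain N M where *: "\<And>x. length x = n \<Longrightarrow> u x \<noteq> 0 \<Longrightarrow> wt x \<le> N" "\<And>x. length x = n \<Longrightarrow> v x \<noteq> 0 \<Longrightarrow> wt x \<le> M"
    using assms unfolding bounded_wt_def by blast
  show ?thesis
  proof (rule bounded_wtI)
    fix x :: "(nat \<times> nat) list" assume "length x = n" "w x \<noteq> 0"
    then obtain y where y: "length y = n" "wt x \<le> Suc (wt y)" "u y \<noteq> 0 \<or> v y \<noteq> 0" using assms(1) by blast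
    then have "wt y \<le> max N M" using *[OF y(1)] by (auto simp: max.coboundedI1 max.coboundedI2)
    then show "wt x \<le> Suc (max N M)" using y by simp
  qed
qed

text \<open>A Koszul argument. With the last entry as coefficient, closedness says that u shifted by
  the generator s or t is the \<open>bar0\<close>-coboundary of -us or -ut. One looks for a single
  cochain whose shifts by s and t are us and ut. This needs us shifted by t to equal ut shifted by
  s, which holds up to a coboundary that us can absorb. The absorption is obstructed only for n = 1,
  where \<open>sym\<close> comes in.\<close>

lemma bar_exact:
  fixes u :: "(nat \<times> nat) list \<Rightarrow> 'k::comm_ring_1"
  assumes closed: "\<And>gs. length gs = Suc (Suc n) \<Longrightarrow> bard eps (Suc n) u gs = 0"
    and n: "n \<noteq> 0"
    and bdd: "bounded_wt (Suc n) u"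
    and sym: "n = 1 \<Longrightarrow> u [(0, 1), (1, 0)] = u [(1, 0), (0, 1)]"
  obtains \<psi> where "bounded_wt n \<psi>" "\<And>gs. length gs = Suc n \<Longrightarrow> bard eps n \<psi> gs = u gs"
proof -
  define s t :: "nat \<times> nat" where "s = (1, 0)" and "t = (0, 1)"
  have st: "eps s = (0 :: 'k)" "eps t = (0 :: 'k)" "eps 0 = (1 :: 'k)"
    by (simp_all add: s_def t_def eps_def zero_prod_def)
  define us ut u0 where "us = (\<lambda>x. u (x @ [s]))" and "ut = (\<lambda>x. u (x @ [t]))" and "u0 = (\<lambda>x. u (x @ [0]))"
  have closed': "u gs * eps g - u (shl g gs) - bar0 n (\<lambda>x. u (x @ [g])) gs = 0" if "length gs = Suc n" for gs g
    using closed[of "gs @ [g]"] that by (simp add: bard_eps bar0_snoc add_diff_eq)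
  have u_s: "u (shl s gs) = - bar0 n us gs" and u_t: "u (shl t gs) = - bar0 n ut gs"
    and u_0: "bar0 n u0 gs = 0" if len: "length gs = Suc n" for gs
  proof -
    have "gs \<noteq> []" using len by auto
    then show "u (shl s gs) = - bar0 n us gs" "u (shl t gs) = - bar0 n ut gs" "bar0 n u0 gs = 0"
      using closed'[OF len, of s] closed'[OF len, of t] closed'[OF len, of 0]
      by (auto simp: st us_def ut_def u0_def dest: neg_eqD)
  qed
  obtain m where m: "n = Suc m" using n not0_implies_Suc by blast
  have ne: "x \<noteq> []" if "length x = n" for x :: "(nat \<times> nat) list" using that n by auto
  have ne': "x \<noteq> []" if "length x = Suc n" for x :: "(nat \<times> nat) list" using that by auto
  define \<chi> where "\<chi> = (\<lambda>x. us (x @ [t]) - ut (x @ [s]))"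
  have K: "us (shl t x) - ut (shl s x) = - bar0 m \<chi> x" if x: "length x = n" for x
  proof -
    \<comment> \<open>The mismatch of the two shifts is closed for \<open>bar0\<close>, since both
      sides compute u shifted by s and t; the homotopy then writes it as a coboundary.\<close>
    define w where "w = (\<lambda>x. us (shl t x) - ut (shl s x))"
    have "bar0 n w gs = 0" if "length gs = Suc n" for gs
      using that n ne'[OF that] u_s[of "shl t gs"] u_t[of "shl s gs"]
      by (simp add: w_def bar0_diff bar0_shl shl_shl[of s t])
    then have "w x = - bar0 m (\<lambda>y. w (y @ [0])) x"
      using x m by (intro bar0_exact) auto
    then show ?thesis by (simp add: w_def \<chi>_def)
  qed
  have bu: "bounded_wt n us" "bounded_wt n ut" "bounded_wt n u0"
    using bdd by (auto simp: us_def ut_def u0_def intro: bounded_wt_snoc)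
  have b\<chi>: "bounded_wt m \<chi>"
    unfolding \<chi>_def using bu m by (intro bounded_wt_diff bounded_wt_snoc) auto
  obtain \<sigma> where \<sigma>: "bounded_wt m \<sigma>" "\<And>x. length x = n \<Longrightarrow> bar0 m \<sigma> (shl t x) = bar0 m \<chi> x"
  proof (cases "m = 0")
    case True
    \<comment> \<open>Without arguments there is no entry to divide by t. Here the mismatch is the
      scalar u [t, s] - u [s, t], the antisymmetrization detecting the class of r.\<close>
    then have "\<chi> [] = 0" using sym m by (simp add: \<chi>_def us_def ut_def s_def t_def)
    then have "bar0 m (\<lambda>_. 0) (shl t x) = bar0 m \<chi> x" if "length x = n" for x
      using that True m by (cases x) (auto simp: bar0_def)
    moreover have "bounded_wt m (\<lambda>_. 0 :: 'k)" by (simp add: bounded_wt_def)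
    ultimately show ?thesis using that by blast
  next
    case False
    \<comment> \<open>Division of \<open>\<chi>\<close> by t in the last entry, with value 0 where t
      does not divide.\<close>
    define \<sigma> where "\<sigma> = (\<lambda>x. case last x of (a, b) \<Rightarrow>
        if b = 0 then 0 else \<chi> (butlast x @ [(a, b - 1)]))"
    have "\<sigma> (shl t x) = \<chi> x" if "length x = m" for x
      using that False by (cases x rule: rev_cases) (auto simp: \<sigma>_def t_def)
    then have "bar0 m \<sigma> (shl t x) = bar0 m \<chi> x" if "length x = n" for x
      using that m False by (subst bar0_shl[symmetric]) (auto intro: bar0_cong)
    moreover have "bounded_wt m \<sigma>"
    proof (rule bounded_wt_unshift[OF _ b\<chi> b\<chi>])
      fix x assume x: "length x = m" "\<sigma> x \<noteq> 0"
      then obtain y a b where y: "x = y @ [(a, b)]" using False by (cases x rule: rev_cases) auto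
      show "\<exists>y. length y = m \<and> wt x \<le> Suc (wt y) \<and> (\<chi> y \<noteq> 0 \<or> \<chi> y \<noteq> 0)"
        by (rule exI[of _ "y @ [(a, b - 1)]"]) (use x y in \<open>auto simp: \<sigma>_def split: if_splits\<close>)
    qed
    ultimately show ?thesis using that by blast
  qed
  \<comment> \<open>The correction is a coboundary, so \<open>bar0\<close> of us is unchanged while
    the two shifts now agree.\<close>
  define us' where "us' = (\<lambda>x. us x + bar0 m \<sigma> x)"
  have us't: "us' (shl t x) = ut (shl s x)" if "length x = n" for x
    using K[OF that] \<sigma>(2)[OF that] by (simp add: us'_def algebra_simps)
  have bus': "bounded_wt n us'"
    unfolding us'_def using bu \<sigma>(1) m by (auto intro: bounded_wt_add bounded_wt_bar0)
  have dus': "bar0 n us' gs = bar0 n us gs" if "length gs = Suc n" for gs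
    using that m by (simp add: us'_def bar0_add bar0_bar0)
  \<comment> \<open>Division by s where possible, otherwise by t. Agreement of the shifts
    (\<open>us't\<close>) makes the choice irrelevant, so that both \<open>\<tau>s\<close> and
    \<open>\<tau>t\<close> hold.\<close>
  define \<tau> where "\<tau> = (\<lambda>x. case last x of (a, b) \<Rightarrow>
      if a \<noteq> 0 then us' (butlast x @ [(a - 1, b)]) else if b \<noteq> 0 then ut (butlast x @ [(0, b - 1)]) else 0)"
  have \<tau>s: "\<tau> (shl s x) = us' x" if "length x = n" for x
    using that n by (cases x rule: rev_cases) (auto simp: \<tau>_def s_def)
  have \<tau>t: "\<tau> (shl t x) = ut x" if x: "length x = n" for x
  proof -
    obtain y a b where y: "x = y @ [(a, b)]" using x n by (cases x rule: rev_cases) auto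
    show ?thesis
    proof (cases a)
      case 0
      then show ?thesis by (simp add: y \<tau>_def t_def)
    next
      case (Suc a')
      then show ?thesis using us't[of "y @ [(a', b)]"] x by (simp add: y \<tau>_def t_def s_def)
    qed
  qed
  have b\<tau>: "bounded_wt n \<tau>"
  proof (rule bounded_wt_unshift[OF _ bus' bu(2)])
    fix x assume x: "length x = n" "\<tau> x \<noteq> 0"
    then obtain y a b where y: "x = y @ [(a, b)]" using n by (cases x rule: rev_cases) auto
    show "\<exists>y. length y = n \<and> wt x \<le> Suc (wt y) \<and> (us' y \<noteq> 0 \<or> ut y \<noteq> 0)"
    proof (cases "a = 0")
      case True
      then show ?thesis using x y
        by (intro exI[of _ "y @ [(0, b - 1)]"]) (auto simp: \<tau>_def split: if_splits)
    next
      case False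
      then show ?thesis using x y
        by (intro exI[of _ "y @ [(a - 1, b)]"]) (auto simp: \<tau>_def split: if_splits)
    qed
  qed
  have vs: "u (shl s gs) + bar0 n \<tau> (shl s gs) = 0" if len: "length gs = Suc n" for gs
  proof -
    have "bar0 n \<tau> (shl s gs) = bar0 n us' gs"
      using len n \<tau>s by (subst bar0_shl[symmetric]) (auto intro: bar0_cong)
    then show ?thesis using len by (simp add: u_s dus')
  qed
  have vt: "u (shl t gs) + bar0 n \<tau> (shl t gs) = 0" if len: "length gs = Suc n" for gs
  proof -
    have "bar0 n \<tau> (shl t gs) = bar0 n ut gs"
      using len n \<tau>t by (subst bar0_shl[symmetric]) (auto intro: bar0_cong)
    then show ?thesis using len by (simp add: u_t)
  qed
  \<comment> \<open>So far u is corrected only where the last entry is nonzero. As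
    \<open>\<rho>\<close> is closed for \<open>bar0\<close>, it enters the differential only through
    \<open>eps\<close> of the last entry, and it repairs the value at 0.\<close>
  define \<rho> where "\<rho> = (\<lambda>x. u0 x - bar0 m (\<lambda>y. \<tau> (y @ [0])) x)"
  have d\<rho>: "bar0 n \<rho> gs = 0" if "length gs = Suc n" for gs
    using that m u_0[OF that] by (simp add: \<rho>_def bar0_diff bar0_bar0)
  show ?thesis
  proof (rule that)
    show "bounded_wt n (\<lambda>x. \<rho> x - \<tau> x)"
      unfolding \<rho>_def using bu b\<tau> m by (intro bounded_wt_diff) (auto intro: bounded_wt_bar0 bounded_wt_snoc)
    fix gs :: "(nat \<times> nat) list" assume len: "length gs = Suc n"
    then obtain y a b where y: "gs = y @ [(a, b)]" "length y = n"
      by (cases gs rule: rev_cases) auto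
    have *: "bard eps n (\<lambda>x. \<rho> x - \<tau> x) gs = (\<rho> y - \<tau> y) * eps (a, b) - bar0 n \<tau> gs"
      using len by (simp add: bard_eps bar0_diff d\<rho> y)
    consider "a = 0" "b = 0" | "a \<noteq> 0" | "a = 0" "b \<noteq> 0" by blast
    then show "bard eps n (\<lambda>x. \<rho> x - \<tau> x) gs = u gs"
    proof cases
      case 1
      then have "gs = y @ [0]" using y by (simp add: zero_prod_def)
      then show ?thesis unfolding * using 1 y m shl_0[OF ne[OF y(2)]]
        by (simp add: bar0_snoc \<rho>_def eps_def u0_def zero_prod_def)
    next
      case 2
      then have "gs = shl s (y @ [(a - 1, b)])" by (simp add: y s_def)
      then have "u gs = - bar0 n \<tau> gs"
        using vs[of "y @ [(a - 1, b)]"] y by (simp add: eq_neg_iff_add_eq_0 del: shl_snoc)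
      then show ?thesis unfolding * using 2 by (simp add: eps_def zero_prod_def)
    next
      case 3
      then have "gs = shl t (y @ [(0, b - 1)])" by (simp add: y t_def)
      then have "u gs = - bar0 n \<tau> gs"
        using vt[of "y @ [(0, b - 1)]"] y by (simp add: eq_neg_iff_add_eq_0 del: shl_snoc)
      then show ?thesis unfolding * using 3 by (simp add: eps_def zero_prod_def)
    qed
  qed
qed

section \<open>Quasi-isomorphism\<close>

lemma nf_Nil: "nf [] = eps"
  by (simp add: nf_def)

lemma nf_letters: "nf [False] g = (if g = (0, 1) then 1 else 0)" "nf [True] g = (if g = (1, 0) then 1 else 0)"
  using nf_sw[of "(0, 1)" g] nf_sw[of "(1, 0)" g] by (auto simp: sw_def)

lemma nf_primitive: "nf [b] (g + h) = nf [b] g * eps h + eps g * (nf [b] h :: 'k::field_char_0)"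
proof -
  have 1: "nf [b] = (nfop b eps :: _ \<Rightarrow> 'k)" using N.e_snoc[of "[]" b] by (simp add: nf_Nil)
  show ?thesis
    using N.rop_add[of b "eps :: _ \<Rightarrow> 'k" g h] N.rop_smul[of b "eps h :: 'k" eps g] N.rop_smul[of b "eps g :: 'k" eps h]
    by (simp add: 1 eps_add mult.commute)
qed

lemma finite_wt: "finite {x. length x = n \<and> wt x \<le> N}"
proof (rule finite_subset)
  show "finite {x. set x \<subseteq> {..N} \<times> {..N} \<and> length x = n}"
    by (intro finite_lists_length_eq) simp
  have "set x \<subseteq> {..N} \<times> {..N}" if "wt x \<le> N" for x
    using that by (induction x) auto
  then show "{x. length x = n \<and> wt x \<le> N} \<subseteq> {x. set x \<subseteq> {..N} \<times> {..N} \<and> length x = n}" by blast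
qed

lemma N_EV_surj:
  fixes \<psi> :: "(nat \<times> nat) list \<Rightarrow> 'k::field_char_0"
  assumes "bounded_wt n \<psi>"
  obtains \<Psi> where "finite (supp \<Psi>)" "\<And>ws. ws \<in> supp \<Psi> \<Longrightarrow> length ws = n"
    "\<And>gs. length gs = n \<Longrightarrow> N.EV \<Psi> gs = \<psi> gs"
proof -
  obtain N where N: "\<And>x. length x = n \<Longrightarrow> \<psi> x \<noteq> 0 \<Longrightarrow> wt x \<le> N"
    using assms unfolding bounded_wt_def by blast
  define A where "A = {x. length x = n \<and> wt x \<le> N}"
  define c :: "(nat \<times> nat) list \<Rightarrow> 'k" where "c x = (\<Prod>i<length x. fact (fst (x ! i)) * fact (snd (x ! i)))" for x
  have c: "c x \<noteq> 0" for x by (simp add: c_def)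
  define \<Psi> where "\<Psi> = (\<lambda>z. \<Sum>x\<in>A. (\<psi> x / c x) * bas (map sw x) z)"
  have fin: "finite (supp \<Psi>)" unfolding \<Psi>_def by (intro fin_sum fin_smul) simp
  show ?thesis
  proof (rule that)
    show "finite (supp \<Psi>)" by (rule fin)
    show "length ws = n" if "ws \<in> supp \<Psi>" for ws
    proof (rule ccontr)
      assume "length ws \<noteq> n"
      then have "\<Psi> ws = 0" unfolding \<Psi>_def A_def by (intro sum.neutral) (auto simp: bas_def)
      with that show False by (simp add: supp_def)
    qed
    fix gs :: "(nat \<times> nat) list" assume len: "length gs = n"
    have "N.EV \<Psi> gs = (\<Sum>x\<in>A. \<psi> x / c x * N.evb (map sw x) gs)"
      unfolding \<Psi>_def by (subst N.EV_sum) (auto intro!: fin_smul simp: N.EV_smul simp del: times_divide_eq_left)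
    also have "\<dots> = (\<Sum>x\<in>A. if x = gs then \<psi> gs else 0)"
      using len c by (intro sum.cong refl) (auto simp: A_def N_evb_sw c_def[symmetric])
    also have "\<dots> = \<psi> gs"
      using len N[OF len] finite_wt[of n N] by (auto simp: A_def)
    finally show "N.EV \<Psi> gs = \<psi> gs" .
  qed
qed

text \<open>Once reduced to ordered words, the tensor is seen only at the finitely many exponent
  lists occurring in it.\<close>

lemma bounded_wt_EV:
  fixes \<Theta> :: "'k::field_char_0 tens"
  assumes "finite (supp \<Theta>)"
  shows "bounded_wt n (N.EV \<Theta>)"
proof -
  obtain \<Theta>' where \<Theta>': "finite (supp \<Theta>')" "supp \<Theta>' \<subseteq> range (map sw)" "Jeq \<Theta> \<Theta>'"
    using reduce[OF assms] .
  define X where "X = {x. map sw x \<in> supp \<Theta>'}"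
  have "finite X" unfolding X_def vimage_def[symmetric]
    by (rule finite_vimageI[OF \<Theta>'(1)]) (simp add: inj_sw)
  show ?thesis
  proof (rule bounded_wtI)
    fix x assume "length x = n" "N.EV \<Theta> x \<noteq> 0"
    then have "N.EV \<Theta>' x \<noteq> 0" using N.EV_Jeq[OF \<Theta>'(3) assms \<Theta>'(1)] by simp
    then have "x \<in> supp (lext N.evb \<Theta>')" by (simp add: supp_def N.EV_def)
    then obtain ws where "ws \<in> supp \<Theta>'" "x \<in> supp (N.evb ws :: _ \<Rightarrow> 'k)" by (rule supp_lextE)
    then have "ws \<in> supp \<Theta>'" "(N.evb ws x :: 'k) \<noteq> 0" by (simp_all add: supp_def)
    then obtain y where y: "ws = map sw y" "y \<in> X" "(N.evb (map sw y) x :: 'k) \<noteq> 0" using \<Theta>'(2) by (auto simp: X_def)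
    then have "length y = length x" using N.evb_len[of "map sw y" x] by auto
    then have "x = y" using y(3) by (simp add: N_evb_sw split: if_splits)
    then show "wt x \<le> Max (wt ` X)" using \<open>finite X\<close> y by simp
  qed
qed

lemma EmonD: "Emon m \<Longrightarrow> m = [] \<or> m = [False] \<or> m = [True] \<or> m = [False, True]"
  unfolding Emon_def by (cases m rule: list.exhaust; cases "tl m"; cases "tl (tl m)") (auto simp: less_bool_def)

lemma N_bard_closed:
  assumes "Jeq (hdiff \<Phi>) (\<lambda>_. 0 :: 'k::field_char_0)" "finite (supp \<Phi>)"
    "\<And>ws. ws \<in> supp \<Phi> \<Longrightarrow> length ws = n" "length gs = Suc n"
  shows "bard eps n (N.EV \<Phi>) gs = 0"
  using N.EV_Jeq[OF assms(1) N.fin_hdiff[OF assms(2)], of gs] N.EV_hdiff[OF assms(2,3,4)]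
  by (simp add: nf_Nil)

text \<open>The relevant coboundaries vanish in tensor length at most 1 and are symmetric functions
  in length 2, whereas y \<otimes> x is not symmetric; this gives injectivity. For surjectivity,
  length 1 is computed directly and from length 2 on \<open>bar_exact\<close> applies after
  subtracting a multiple of the image of r.\<close>

lemma quasi_isoI:
  fixes f :: "bool list list \<Rightarrow> 'k::field_char_0 tens"
  assumes f: "f [[]] = bas []" "f [[False]] = bas [[False]]" "f [[True]] = bas [[True]]"
    "f [[False, True]] = (\<lambda>z. (- 1 / 2) * bas [[True], [False]] z)"
  shows "quasi_iso f"
proof -
  define r where "r = (\<lambda>z. (- 1 / 2) * bas [[True], [False]] z :: 'k)"
  note f = f(1-3) f(4)[folded r_def]
  have fin_r: "finite (supp r)" unfolding r_def by (intro fin_smul) simp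
  have N2: "N.EV r gs = (- 1 / 2) * N.evb [[True], [False]] gs" for gs
    unfolding r_def by (subst N.EV_smul) simp_all
  have fin_f: "finite (supp (f [m]))" if "Emon m" for m
    using EmonD[OF that] fin_r by (auto simp: f)
  have fin_F1: "finite (supp (F1 f c))" if "Ehom k c" for k c
    using that unfolding F1_def Ehom_def by (intro fin_lext fin_f) auto
  have EV_F1: "N.EV (F1 f c) gs = (\<Sum>m\<in>S. c m * N.EV (f [m]) gs)"
    if "Ehom k c" "finite S" "supp c \<subseteq> S" for k c gs S
  proof -
    have "N.EV (F1 f c) gs = lext (\<lambda>m. N.EV (f [m])) c gs"
      unfolding N.EV_def F1_def using that(1) by (intro lext_lext fin_f) (auto simp: Ehom_def)
    then show ?thesis using that by (simp add: lext_on)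
  qed
  define s t :: "nat \<times> nat" where "s = (1, 0)" and "t = (0, 1)"
  have inj: "c m = 0"
    if c: "Ehom k c" and \<Psi>: "Dhom (k - 1) \<Psi>" "Jeq (F1 f c) (hdiff \<Psi>)" for k c \<Psi> m
  proof (rule ccontr)
    assume nz: "c m \<noteq> 0"
    then have m: "Emon m" "int (length m) = k + 1" using c by (auto simp: Ehom_def supp_def)
    have supp_c: "m' \<in> {[], [False], [True], [False, True]} \<and> length m' = length m" if "m' \<in> supp c" for m'
      using c m that EmonD[of m'] by (auto simp: Ehom_def)
    have fin\<Psi>: "finite (supp \<Psi>)" and len\<Psi>: "\<And>ws. ws \<in> supp \<Psi> \<Longrightarrow> Suc (length ws) = length m"
      using \<Psi>(1) m by (auto simp: Dhom_def)
    have eq: "N.EV (F1 f c) gs = N.EV (hdiff \<Psi>) gs" for gs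
      using N.EV_Jeq[OF \<Psi>(2) fin_F1[OF c] N.fin_hdiff[OF fin\<Psi>]] .
    have bard: "N.EV (F1 f c) gs = bard eps n (N.EV \<Psi>) gs" if "length gs = Suc n" "length m = Suc n" for gs n
      unfolding eq nf_Nil[symmetric] using that len\<Psi> by (intro N.EV_hdiff fin\<Psi>) auto
    consider "m = []" | "length m = 1" | "m = [False, True]" using EmonD[OF m(1)] by auto
    then show False
    proof cases
      case 1
      then have "supp c \<subseteq> {[]}" "supp \<Psi> = {}" using supp_c len\<Psi> by auto
      then have "c [] = 0"
        using eq[of "[]"] EV_F1[OF c, of "{[]}" "[]"]
        by (simp add: f N.EV_def hdiff_def) (simp add: lext_def)
      then show False using nz 1 by simp
    next
      case 2
      have S: "supp c \<subseteq> {[False], [True]}" using supp_c 2 by fastforce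
      have "N.EV (F1 f c) [g] = 0" for g
        using bard[of "[g]" 0] 2 by (simp add: bard_def sg_def)
      then have "c [False] * nf [False] g + c [True] * nf [True] g = 0" for g
        using EV_F1[OF c _ S, of "[g]"] by (simp add: f)
      from this[of "(0, 1)"] this[of "(1, 0)"] have "c [False] = 0" "c [True] = 0"
        by (simp_all add: nf_letters)
      then show False using EmonD[OF m(1)] 2 nz by auto
    next
      case 3
      have S: "supp c \<subseteq> {[False, True]}" using supp_c 3 by fastforce
      \<comment> \<open>The coboundary of a function of one argument is symmetric because the monoid
        is commutative.\<close>
      have "N.EV (F1 f c) [g, h] = N.EV (F1 f c) [h, g]" for g h
        using bard[of "[g, h]" 1] bard[of "[h, g]" 1] 3
        by (simp add: bard_def merge_def add.commute mult.commute algebra_simps) (metis add_left_cancel)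
      moreover have "N.EV (F1 f c) gs = c [False, True] * ((- 1 / 2) * N.evb [[True], [False]] gs)" for gs
        using EV_F1[OF c _ S, of gs] by (simp add: f N2)
      ultimately have "c [False, True] * ((- 1 / 2) * N.evb [[True], [False]] [g, h])
        = c [False, True] * ((- 1 / 2) * N.evb [[True], [False]] [h, g])" for g h by metis
      from this[of "(1, 0)" "(0, 1)"] have "c [False, True] = 0"
        by (simp add: nf_letters)
      then show False using 3 nz by auto
    qed
  qed
  have surj: "\<exists>c \<Psi>. Ehom k c \<and> Dhom (k - 1) \<Psi> \<and> Jeq \<Phi> (\<lambda>z. F1 f c z + hdiff \<Psi> z)"
    if \<Phi>: "Dhom k \<Phi>" "Jeq (hdiff \<Phi>) (\<lambda>_. 0)" for k \<Phi>
  proof (cases "supp \<Phi> = {}")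
    case True
    then have "\<Phi> = (\<lambda>_. 0)" by (auto simp: supp_def)
    moreover have "Ehom k (\<lambda>_. 0 :: 'k)" "Dhom (k - 1) (\<lambda>_. 0 :: 'k)" by (simp_all add: Ehom_def Dhom_def)
    moreover have "F1 f (\<lambda>_. 0) z = 0" "hdiff (\<lambda>_. 0 :: 'k) z = 0" for z by (simp_all add: F1_def hdiff_def)
    ultimately show ?thesis using Jeq_refl[of "\<lambda>_. 0 :: 'k"]
      by (intro exI[of _ "\<lambda>_. 0"] conjI) simp_all
  next
    case False
    then have "k + 1 \<ge> 0" using \<Phi>(1) by (fastforce simp: Dhom_def)
    then obtain n where n: "k + 1 = int n" using nonneg_int_cases by blast
    have fin\<Phi>: "finite (supp \<Phi>)" and len\<Phi>: "\<And>ws. ws \<in> supp \<Phi> \<Longrightarrow> length ws = n"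
      using \<Phi>(1) n by (auto simp: Dhom_def)
    define u where "u = N.EV \<Phi>"
    have closed: "bard eps n u gs = 0" if "length gs = Suc n" for gs
      unfolding u_def by (rule N_bard_closed[OF \<Phi>(2) fin\<Phi> len\<Phi> that])
    have fin: ?thesis if c: "Ehom k c" and \<Psi>: "Dhom (k - 1) \<Psi>"
      and eq: "\<And>gs. length gs = n \<Longrightarrow> u gs = N.EV (F1 f c) gs + N.EV (hdiff \<Psi>) gs" for c \<Psi>
    proof -
      have fin\<Psi>: "finite (supp \<Psi>)" and len\<Psi>: "\<And>ws. ws \<in> supp \<Psi> \<Longrightarrow> Suc (length ws) = n"
        using \<Psi> n by (auto simp: Dhom_def)
      have "N.EV (F1 f c) gs = 0" if "length gs \<noteq> n" for gs
      proof -
        have "N.EV (f [m]) gs = 0" if m: "m \<in> supp c" for m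
        proof -
          have "Emon m" "length m = n" using m c n by (auto simp: Ehom_def)
          then show ?thesis using EmonD[of m] \<open>length gs \<noteq> n\<close> by (auto simp: f N2 N.evb_len)
        qed
        then show ?thesis using EV_F1[OF c, of "supp c"] c by (simp add: Ehom_def)
      qed
      moreover have "N.EV (hdiff \<Psi>) gs = 0" if "length gs \<noteq> n" for gs
      proof (rule N.EV_hom[OF _ that])
        fix ws assume "ws \<in> supp (hdiff \<Psi>)"
        then show "length ws = n" unfolding hdiff_def
          by (auto elim!: supp_lextE dest!: N.supp_delta len\<Psi>)
      qed
      moreover have "u gs = 0" if "length gs \<noteq> n" for gs
        unfolding u_def using len\<Phi> that by (rule N.EV_hom)
      ultimately have "N.EV \<Phi> gs = N.EV (\<lambda>z. F1 f c z + hdiff \<Psi> z) gs" for gs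
        using eq[of gs] fin_F1[OF c] N.fin_hdiff[OF fin\<Psi>] by (cases "length gs = n") (auto simp: u_def N.EV_add)
      then have "Jeq \<Phi> (\<lambda>z. F1 f c z + hdiff \<Psi> z)"
        by (intro Jeq_N fin\<Phi> fin_add fin_F1[OF c] N.fin_hdiff[OF fin\<Psi>])
      then show ?thesis using c \<Psi> by blast
    qed
    have D0: "Dhom (k - 1) (\<lambda>_. 0 :: 'k)" "hdiff (\<lambda>_. 0 :: 'k) = (\<lambda>_. 0)"
      by (simp_all add: Dhom_def hdiff_def fun_eq_iff)
    consider "n = 0" | "n = 1" | n' where "n = Suc n'" "n' \<noteq> 0"
      by (metis One_nat_def not0_implies_Suc)
    then show ?thesis
    proof cases
      case 1
      define c :: "bool list \<Rightarrow> 'k" where "c = (\<lambda>m. if m = [] then u [] else 0)"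
      have S: "supp c \<subseteq> {[]}" by (auto simp: c_def supp_def)
      then have c: "Ehom k c" using n 1 finite_subset[OF S] by (auto simp: Ehom_def Emon_def)
      show ?thesis
        by (rule fin[OF c D0(1)]) (use 1 EV_F1[OF c _ S] in \<open>simp add: D0(2) f c_def\<close>)
    next
      case 2
      define c :: "bool list \<Rightarrow> 'k" where "c = (\<lambda>m. if m = [False] then u [t] else if m = [True] then u [s] else 0)"
      have S: "supp c \<subseteq> {[False], [True]}" by (auto simp: c_def supp_def)
      then have c: "Ehom k c" using n 2 finite_subset[OF S] by (auto simp: Ehom_def Emon_def)
      have *: "u [g] * eps h - u [g + h] + eps g * u [h] = 0" for g h
        using closed[of "[g, h]"] 2 by (simp add: bard_def merge_def)
      \<comment> \<open>By \<open>*\<close> a cocycle vanishes at 0 and at any sum of two nonzero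
        elements; only the generators remain.\<close>
      have u0: "u [g] = 0" if "g \<noteq> s" "g \<noteq> t" for g
      proof -
        obtain a b where g: "g = (a, b)" by fastforce
        consider "g = 0" | "a \<ge> 1" "g \<noteq> 0" | "b \<ge> 1" "a = 0" using g by (cases a; cases b) (auto simp: zero_prod_def)
        then show ?thesis
        proof cases
          case 1
          then show ?thesis using *[of 0 0] by (simp add: eps_def)
        next
          case 2
          then have "g = s + (a - 1, b)" "(a - 1, b) \<noteq> 0" "s \<noteq> 0" using that g by (auto simp: s_def zero_prod_def)
          then show ?thesis using *[of s "(a - 1, b)"] by (simp add: eps_def)
        next
          case 3
          then have "g = t + (a, b - 1)" "(a, b - 1) \<noteq> 0" "t \<noteq> 0" using that g by (auto simp: t_def zero_prod_def)
          then show ?thesis using *[of t "(a, b - 1)"] by (simp add: eps_def)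
        qed
      qed
      have "u [g] = N.EV (F1 f c) [g]" for g
        using EV_F1[OF c _ S] u0[of g] by (auto simp: f c_def nf_letters s_def t_def)
      then show ?thesis
        using 2 by (intro fin[OF c D0(1)]) (auto simp: D0(2) length_Suc_conv)
    next
      case 3
      \<comment> \<open>The image of r takes the values -1/2 at [s, t] and 0 at [t, s]. The factor
        -2 thus makes u - v symmetric at the generators, as \<open>bar_exact\<close> demands; in
        length above 2 nothing is subtracted.\<close>
      define c :: "bool list \<Rightarrow> 'k" where "c = (\<lambda>m. if n = 2 \<and> m = [False, True] then -2 * (u [s, t] - u [t, s]) else 0)"
      have S: "supp c \<subseteq> {[False, True]}" by (auto simp: c_def supp_def)
      have c: "Ehom k c" unfolding Ehom_def
      proof
        show "finite (supp c)" using S by (rule finite_subset) simp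
        show "\<forall>m\<in>supp c. Emon m \<and> int (length m) = k + 1"
          using n by (auto simp: c_def supp_def Emon_def split: if_splits)
      qed
      define v where "v = N.EV (F1 f c)"
      define q where "q = c [False, True] * (- 1 / 2)"
      have v: "v gs = q * N.evb [[True], [False]] gs" for gs
        unfolding v_def q_def using EV_F1[OF c _ S] by (simp add: f N2)
      \<comment> \<open>Since y and x are primitive, y \<otimes> x is a cocycle.\<close>
      have v_closed: "bard eps n v gs = 0" if len: "length gs = Suc n" for gs
      proof (cases "n = 2")
        case True
        then obtain g1 g2 g3 where gs: "gs = [g1, g2, g3]" using len by (auto simp: length_Suc_conv numeral_2_eq_2)
        show ?thesis unfolding gs True
          by (simp add: bard_def v merge_def nf_primitive numeral_2_eq_2 algebra_simps sg_def)
      qed (simp add: v q_def c_def bard_def)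
      have bdd: "bounded_wt n (\<lambda>x. u x - v x)"
        unfolding u_def v_def by (intro bounded_wt_diff bounded_wt_EV fin\<Phi> fin_F1[OF c])
      obtain \<psi> where \<psi>: "bounded_wt n' \<psi>" "\<And>gs. length gs = Suc n' \<Longrightarrow> bard eps n' \<psi> gs = u gs - v gs"
      proof (rule bar_exact[of n' "\<lambda>x. u x - v x"])
        show "bard eps (Suc n') (\<lambda>x. u x - v x) gs = 0" if "length gs = Suc (Suc n')" for gs
        proof -
          have "bard eps n (\<lambda>x. u x - v x) gs = bard eps n u gs - bard eps n v gs"
            by (simp add: bard_def sum_subtractf algebra_simps)
          then show ?thesis using closed[of gs] v_closed[of gs] that 3 by simp
        qed
        show "u [(0, 1), (1, 0)] - v [(0, 1), (1, 0)] = u [(1, 0), (0, 1)] - v [(1, 0), (0, 1)]" if "n' = 1"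
          using 3 that by (simp add: v q_def c_def nf_letters s_def t_def diff_divide_distrib)
      qed (use 3 bdd in auto)
      obtain \<Psi> where \<Psi>: "finite (supp \<Psi>)" "\<And>ws. ws \<in> supp \<Psi> \<Longrightarrow> length ws = n'"
        "\<And>gs. length gs = n' \<Longrightarrow> N.EV \<Psi> gs = \<psi> gs" by (rule N_EV_surj[OF \<psi>(1)]) blast
      have D: "Dhom (k - 1) \<Psi>" using \<Psi> n 3 by (auto simp: Dhom_def)
      have "N.EV (hdiff \<Psi>) gs = u gs - v gs" if len: "length gs = n" for gs
      proof -
        have "N.EV (hdiff \<Psi>) gs = bard eps n' (N.EV \<Psi>) gs"
          unfolding nf_Nil[symmetric] using len 3 \<Psi>(2) by (intro N.EV_hdiff[OF \<Psi>(1)]) auto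
        also have "\<dots> = bard eps n' \<psi> gs"
        proof -
          have "N.EV \<Psi> (merge l gs) = \<psi> (merge l gs)" if "l < n'" for l
            using that len 3 by (intro \<Psi>(3)) simp
          then show ?thesis using len 3 by (simp add: bard_def \<Psi>(3))
        qed
        finally show ?thesis using \<psi>(2) len 3 by simp
      qed
      then show ?thesis by (intro fin[OF c D]) (simp add: v_def[symmetric])
    qed
  qed
  show ?thesis unfolding quasi_iso_def using inj surj by blast
qed

section \<open>The bracket under the evaluation \<open>ev\<close>\<close>

text \<open>Right multiplication by the word \<open>w\<close> acts on evaluations as the substitution \<open>rsh w\<close>
  followed by multiplication by \<open>rmul w\<close>.\<close>
definition rmul :: "bool list \<Rightarrow> 'k \<times> nat \<Rightarrow> 'k::field_char_0" where
  "rmul w = foldl (\<lambda>u b. evop b u) (\<lambda>_. 1) w"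

definition rsh :: "bool list \<Rightarrow> 'k \<times> nat \<Rightarrow> 'k \<times> nat" where
  "rsh w g = (fst g, snd g - length (filter Not w))"

lemma rmul_Nil [simp]: "rmul [] g = 1"
  by (simp add: rmul_def)

lemma rsh_Nil [simp]: "rsh [] g = g"
  by (simp add: rsh_def)

lemma rmul_snoc: "rmul (w @ [b]) = evop b (rmul w)"
  by (simp add: rmul_def)

lemma ev_append: "ev (v @ w) g = rmul w g * ev v (rsh w g)"
proof (induction w arbitrary: g rule: rev_induct)
  case (snoc b w)
  obtain s n where g: "g = (s, n)" by fastforce
  show ?case
    unfolding append_assoc[symmetric] V.e_snoc rmul_snoc g
    by (simp add: snoc rsh_def)
qed simp

lemma rmul_replicate_True: "rmul (replicate a True) g = (fst g + 2 * of_nat (snd g)) ^ a"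
proof (induction a)
  case (Suc a)
  then show ?case unfolding replicate_Suc replicate_append_same[symmetric] rmul_snoc
    by (cases g) simp
qed simp

lemma rmul_replicate_False: "rmul (replicate b False) g = of_nat (snd g choose b) * fact b"
proof (induction b arbitrary: g)
  case (Suc b)
  obtain s n where g: "g = (s, n)" by fastforce
  have "of_nat n * of_nat (n - 1 choose b) = (of_nat (Suc b) * of_nat (n choose Suc b) :: 'a)"
    unfolding of_nat_mult[symmetric] by (cases n) (simp_all only: Suc_times_binomial_eq mult_0 diff_Suc_1 binomial_0_Suc mult_0_right mult.commute)
  then have "of_nat n * (of_nat (n - 1 choose b) * fact b) = (of_nat (n choose Suc b) * fact (Suc b) :: 'a)"
    by (simp add: algebra_simps)
  then show ?case unfolding replicate_Suc replicate_append_same[symmetric] rmul_snoc g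
    by (simp add: Suc)
qed simp

lemma rsh_replicate [simp]:
  "rsh (replicate a True) g = g" "rsh (replicate b False) g = (fst g, snd g - b)"
  by (simp_all add: rsh_def)

lemma ev_Nil: "ev [] g = (if snd g = 0 then 1 else 0)"
  by (simp add: ev_def ev0_def)

lemma ev_sw: "ev (sw (a, b)) (s, n) = (if n = b then fact b * s ^ a else 0)"
proof -
  have "ev (replicate a True) h = rmul (replicate a True) h * ev [] h" for h :: "'a \<times> nat"
    using ev_append[of "[]" "replicate a True" h] by simp
  then show ?thesis
    by (auto simp: sw_def ev_append ev_Nil rmul_replicate_True rmul_replicate_False binomial_eq_0)
qed

lemma V_evb_sw:
  assumes "length x = length b" "length s = length b"
  shows "V.evb (map sw x) (zip s b) = (if map snd x = b
    then prod_list (map fact b) * prod_list (map2 (^) s (map fst x)) else 0)"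
  using assms
proof (induction b arbitrary: x s)
  case (Cons n b)
  then obtain y x' r s' where "x = y # x'" "s = r # s'" "length x' = length b" "length s' = length b"
    by (auto simp: length_Suc_conv)
  then show ?case using Cons.IH[of x' s'] by (cases y) (auto simp: ev_sw)
qed simp

text \<open>Induction on the number of variables: with the others fixed, the sum is a polynomial in
  the first variable that vanishes on an infinite field, so each of its coefficients
  vanishes.\<close>

lemma monomials_independent:
  fixes c :: "nat list \<Rightarrow> 'k::field_char_0"
  assumes "finite A" "\<And>a. a \<in> A \<Longrightarrow> length a = m"
    and "\<And>s. length s = m \<Longrightarrow> (\<Sum>a\<in>A. c a * prod_list (map2 (^) s a)) = 0"
  shows "\<forall>a\<in>A. c a = 0"
  using assms
proof (induction m arbitrary: A c)
  case 0
  then have "A \<subseteq> {[]}" by auto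
  then show ?case using 0(3)[of "[]"] by (cases "A = {}") (auto simp: subset_singleton_iff)
next
  case (Suc m)
  have A: "a \<noteq> []" if "a \<in> A" for a using Suc.prems(2)[OF that] by auto
  have "c (k # a) = 0" if ka: "k # a \<in> A" for k a
  proof -
    define Ak where "Ak = {a. k # a \<in> A}"
    have Ak: "(#) k ` Ak = {a \<in> A. hd a = k}"
      using A by (force simp: Ak_def image_iff neq_Nil_conv)
    then have "finite ((#) k ` Ak)" using Suc.prems(1) by simp
    then have fin: "finite Ak" by (rule finite_imageD) (simp add: inj_on_def)
    have "(\<Sum>a\<in>Ak. c (k # a) * prod_list (map2 (^) s a)) = 0" if s: "length s = m" for s :: "'k list"
    proof -
      define P :: "'k poly" where "P = (\<Sum>a\<in>A. monom (c a * prod_list (map2 (^) s (tl a))) (hd a))"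
      have "poly P r = 0" for r :: 'k
      proof -
        have "prod_list (map2 (^) (r # s) a) = r ^ hd a * prod_list (map2 (^) s (tl a))" if "a \<in> A" for a
          using A[OF that] by (cases a) auto
        then have "poly P r = (\<Sum>a\<in>A. c a * prod_list (map2 (^) (r # s) a))"
          unfolding P_def poly_sum by (intro sum.cong refl) (simp add: poly_monom)
        then show ?thesis using Suc.prems(3)[of "r # s"] s by simp
      qed
      then have "P = 0" using poly_all_0_iff_0 by blast
      then have "0 = coeff P k" by simp
      also have "\<dots> = (\<Sum>a\<in>A. if hd a = k then c a * prod_list (map2 (^) s (tl a)) else 0)"
        unfolding P_def coeff_sum by (intro sum.cong refl) auto
      also have "\<dots> = (\<Sum>a\<in>(#) k ` Ak. c a * prod_list (map2 (^) s (tl a)))"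
        unfolding Ak using Suc.prems(1) by (simp add: sum.inter_filter)
      also have "\<dots> = (\<Sum>a\<in>Ak. c (k # a) * prod_list (map2 (^) s a))"
        by (subst sum.reindex) (auto simp: inj_on_def)
      finally show ?thesis by simp
    qed
    moreover have "length a = m" if "a \<in> Ak" for a
      using Suc.prems(2)[of "k # a"] that by (simp add: Ak_def)
    ultimately have "\<forall>a\<in>Ak. c (k # a) = 0"
      by (intro Suc.IH fin)
    then show ?thesis using ka by (simp add: Ak_def)
  qed
  then show ?case using A by (metis neq_Nil_conv)
qed

text \<open>The integer parts of the arguments select the words with a given list b of x-exponents;
  what remains is a polynomial in the scalars, with the y-exponents as exponents.\<close>

lemma V_indep:
  assumes fin: "finite (supp \<Phi>)" and sub: "supp \<Phi> \<subseteq> range (map sw)" and EV: "\<And>gs. V.EV \<Phi> gs = 0"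
  shows "\<Phi> = (\<lambda>_. 0 :: 'k::field_char_0)"
proof
  fix ws
  show "\<Phi> ws = 0"
  proof (rule ccontr)
    assume nz: "\<Phi> ws \<noteq> 0"
    then have "ws \<in> supp \<Phi>" by (simp add: supp_def)
    with sub obtain x where x: "ws = map sw x" by auto
    define b where "b = map snd x"
    define W where "W = (\<lambda>a. map sw (zip a b))"
    define A where "A = {a. length a = length b \<and> W a \<in> supp \<Phi>}"
    have injW: "inj_on W A"
    proof (rule inj_onI)
      fix a a' assume "a \<in> A" "a' \<in> A" "W a = W a'"
      then have "zip a b = zip a' b" unfolding W_def by (metis inj_sw inj_map_eq_map)
      then show "a = a'" using \<open>a \<in> A\<close> \<open>a' \<in> A\<close> by (metis (mono_tags, lifting) A_def map_fst_zip mem_Collect_eq)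
    qed
    have finA: "finite A"
      by (rule finite_imageD[OF finite_subset[OF _ fin] injW]) (auto simp: A_def)
    have "(\<Sum>a\<in>A. \<Phi> (W a) * prod_list (map2 (^) s a)) = 0" if s: "length s = length b" for s
    proof -
      have zero: "V.evb ws' (zip s b) = (0 :: 'k)" if ws': "ws' \<in> supp \<Phi> - W ` A" for ws'
      proof (rule ccontr)
        assume nz: "V.evb ws' (zip s b) \<noteq> 0"
        obtain y where y: "ws' = map sw y" using ws' sub by auto
        have len: "length y = length b" using nz s V.evb_len[of "map sw y" "zip s b"] by (auto simp: y)
        then have "map snd y = b" using nz s by (auto simp: y V_evb_sw split: if_splits)
        then have "ws' = W (map fst y)" by (simp add: y W_def zip_map_fst_snd flip: \<open>map snd y = b\<close>)
        then have "map fst y \<in> A" using ws' len by (simp add: A_def)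
        then show False using ws' \<open>ws' = W (map fst y)\<close> by blast
      qed
      have "0 = V.EV \<Phi> (zip s b)" using EV by simp
      also have "\<dots> = (\<Sum>ws'\<in>W ` A. \<Phi> ws' * V.evb ws' (zip s b))"
        unfolding V.EV_def lext_def using zero fin by (intro sum.mono_neutral_right) (auto simp: A_def)
      also have "\<dots> = (\<Sum>a\<in>A. \<Phi> (W a) * V.evb (W a) (zip s b))"
        using injW by (simp add: sum.reindex)
      also have "\<dots> = (\<Sum>a\<in>A. prod_list (map fact b) * (\<Phi> (W a) * prod_list (map2 (^) s a)))"
        using s by (intro sum.cong refl) (auto simp: A_def W_def V_evb_sw)
      also have "\<dots> = prod_list (map fact b) * (\<Sum>a\<in>A. \<Phi> (W a) * prod_list (map2 (^) s a))"
        by (simp add: sum_distrib_left)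
      finally show ?thesis by (auto simp: prod_list_zero_iff)
    qed
    then have "\<forall>a\<in>A. \<Phi> (W a) = 0"
      by (intro monomials_independent[OF finA]) (auto simp: A_def)
    moreover have W: "W (map fst x) = ws" by (simp add: W_def x b_def zip_map_fst_snd)
    moreover have "map fst x \<in> A" using \<open>ws \<in> supp \<Phi>\<close> W by (simp add: A_def b_def)
    ultimately show False using nz by metis
  qed
qed

lemmas Jeq_V = V.Jeq_if_EV[OF V_indep]

lemma V_evb_map2:
  assumes "length xs = length ys" "length gs = length ys"
  shows "V.evb (map2 (@) xs ys) gs = prod_list (map2 rmul ys gs) * V.evb xs (map2 rsh ys gs)"
  using assms
proof (induction ys arbitrary: xs gs)
  case (Cons y ys)
  then obtain x xs' g gs' where "xs = x # xs'" "gs = g # gs'" "length xs' = length ys" "length gs' = length ys"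
    by (auto simp: length_Suc_conv)
  then show ?case using Cons.IH[of xs' gs'] by (simp add: ev_append)
qed simp

text \<open>Insertion of the pure tensor ys into a cochain u. At place i a block of entries is
  consumed: right multiplication by ys shifts them and yields the factor \<open>rmul\<close>, and
  the coproduct adds up the shifted entries.\<close>

definition rcirc :: "nat \<Rightarrow> (('k \<times> nat) list \<Rightarrow> 'k) \<Rightarrow> bool list list \<Rightarrow> ('k \<times> nat) list \<Rightarrow> 'k::field_char_0" where
  "rcirc n u ys gs = (if Suc (length gs) = n + length ys then
     \<Sum>i<n. let hs = take (length ys) (drop i gs) in sg (int i * (int (length ys) - 1)) *
       (prod_list (map2 rmul ys hs) * u (take i gs @ [sum_list (map2 rsh ys hs)] @ drop (i + length ys) gs))
   else 0)"

lemma tmul_bas_right: "tmul f (bas ys) = lext (\<lambda>xs. bas (map2 (@) xs ys)) f"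
  by (simp add: tmul_def lext2_eq)

lemma fin_tmul_bas: "finite (supp f) \<Longrightarrow> finite (supp (tmul f (bas ys)))"
  unfolding tmul_bas_right by (intro fin_lext) simp_all

lemma map2_replicate_Nil: "length gs = n \<Longrightarrow> map2 rsh (replicate n []) gs = gs"
  "length gs = n \<Longrightarrow> prod_list (map2 rmul (replicate n []) gs) = 1"
  by (induction gs arbitrary: n) auto

lemma circ_term:
  fixes ys :: "bool list list"
  defines "full i n \<equiv> replicate i [] @ ys @ replicate (n - 1 - i) []"
  shows "ttens (ttens (tone i) (bas ys)) (tone (n - 1 - i)) = bas (full i n)"
  by (simp add: tone_def full_def)

lemma fin_circ: "finite (supp (circ_b xs ys :: 'k::field_char_0 tens))"
  unfolding circ_b_def Let_def circ_term
  by (intro fin_sum fin_smul fin_tmul_bas V.fin_expand)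

lemma EV_circ: "V.EV (circ_b xs ys) gs = rcirc (length xs) (V.evb xs) ys gs"
proof -
  define n where "n = length xs"
  define full where "full = (\<lambda>i. replicate i [] @ ys @ replicate (n - 1 - i) [])"
  have term_eq: "V.EV (tmul (expand_b i (length ys) xs) (bas (full i))) gs =
     (if Suc (length gs) = n + length ys then let hs = take (length ys) (drop i gs) in
       prod_list (map2 rmul ys hs) * V.evb xs (take i gs @ [sum_list (map2 rsh ys hs)] @ drop (i + length ys) gs)
      else 0)" if i: "i < n" for i
  proof -
    have len_full: "length (full i) = n - 1 + length ys" using i by (simp add: full_def)
    have sup: "length zs = n - 1 + length ys" if "zs \<in> supp (expand_b i (length ys) xs :: 'a tens)" for zs
      using V.supp_expand[OF that] i by (simp add: n_def)
    have 1: "V.EV (tmul (expand_b i (length ys) xs) (bas (full i))) gs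
      = lext (\<lambda>zs. V.evb (map2 (@) zs (full i))) (expand_b i (length ys) xs) gs"
      unfolding tmul_bas_right V.EV_def by (subst lext_lext) (simp_all add: V.fin_expand)
    show ?thesis
    proof (cases "Suc (length gs) = n + length ys")
      case False
      have "lext (\<lambda>zs. V.evb (map2 (@) zs (full i))) (expand_b i (length ys) xs) gs = lext (\<lambda>zs _. 0) (expand_b i (length ys) xs) gs"
        by (rule lext_cong, rule V.evb_len) (use False sup len_full i in auto)
      then show ?thesis using False 1 by (simp add: lext_def)
    next
      case True
      define G1 G2 G3 where "G1 = take i gs" and "G2 = take (length ys) (drop i gs)" and "G3 = drop (i + length ys) gs"
      have gs: "gs = G1 @ G2 @ G3"
        by (simp add: G1_def G2_def G3_def) (metis add.commute append_take_drop_id drop_drop)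
      have len: "length G1 = i" "length G2 = length ys" "length G3 = n - 1 - i"
        using True i by (auto simp: G1_def G2_def G3_def)
      have sh: "map2 rsh (full i) gs = G1 @ map2 rsh ys G2 @ G3"
        unfolding gs full_def using len by (simp add: map2_replicate_Nil)
      have ml: "prod_list (map2 rmul (full i) gs) = prod_list (map2 rmul ys G2)"
        unfolding gs full_def using len by (simp add: map2_replicate_Nil)
      have "lext (\<lambda>zs. V.evb (map2 (@) zs (full i))) (expand_b i (length ys) xs) gs
        = lext (\<lambda>zs _. prod_list (map2 rmul (full i) gs) * V.evb zs (map2 rsh (full i) gs)) (expand_b i (length ys) xs) gs"
        using True sup len_full i by (intro lext_cong V_evb_map2) auto
      also have "\<dots> = prod_list (map2 rmul ys G2) * V.EV (expand_b i (length ys) xs) (G1 @ map2 rsh ys G2 @ G3)"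
        unfolding ml sh by (simp add: lext_def V.EV_def sum_distrib_left algebra_simps)
      also have "V.EV (expand_b i (length ys) xs) (G1 @ map2 rsh ys G2 @ G3)
        = V.evb xs (G1 @ [\<Sum>j<length ys. (G1 @ map2 rsh ys G2 @ G3) ! (i + j)] @ G3)"
        using len i by (subst V.EV_expand) (auto simp: n_def)
      also have "(\<Sum>j<length ys. (G1 @ map2 rsh ys G2 @ G3) ! (i + j)) = sum_list (map2 rsh ys G2)"
        using len by (simp add: sum_list_sum_nth atLeast0LessThan nth_append)
      finally show ?thesis using True 1 by (simp add: G1_def G2_def G3_def Let_def)
    qed
  qed
  have "V.EV (circ_b xs ys) gs = (\<Sum>i<n. sg (int i * (int (length ys) - 1)) * V.EV (tmul (expand_b i (length ys) xs) (bas (full i))) gs)"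
    unfolding circ_b_def Let_def circ_term n_def[symmetric] full_def
    by (subst V.EV_sum) (simp_all add: V.EV_smul fin_smul fin_tmul_bas V.fin_expand)
  then show ?thesis
    by (simp add: term_eq rcirc_def n_def[symmetric] Let_def)
qed

text \<open>The left argument matters only through its values, but the right one multiplies and is
  kept as a combination of words.\<close>

definition ecirc :: "nat \<Rightarrow> 'k tens \<Rightarrow> 'k tens \<Rightarrow> ('k \<times> nat) list \<Rightarrow> 'k::field_char_0" where
  "ecirc n \<Phi> \<Psi> = lext (rcirc n (V.EV \<Phi>)) \<Psi>"

definition hom_len :: "nat \<Rightarrow> 'k::zero tens \<Rightarrow> bool" where
  "hom_len n \<Phi> \<longleftrightarrow> finite (supp \<Phi>) \<and> (\<forall>ws\<in>supp \<Phi>. length ws = n)"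

lemma rcirc_lext: "(\<Sum>xs\<in>supp \<Phi>. \<Phi> xs * rcirc n (V.evb xs) ys gs) = rcirc n (V.EV \<Phi>) ys gs"
proof (cases "Suc (length gs) = n + length ys")
  case True
  then show ?thesis
    unfolding rcirc_def V.EV_def lext_def Let_def
    by (simp add: sum_distrib_left sum.swap[of _ _ "supp \<Phi>"] algebra_simps)
qed (simp add: rcirc_def)

lemma fin_gbr: "finite (supp (gbr_b xs ys :: 'k::field_char_0 tens))"
  unfolding gbr_b_def by (intro fin_diff fin_smul fin_circ)

lemma fin_r2D: "finite (supp \<Phi>) \<Longrightarrow> finite (supp \<Psi>) \<Longrightarrow> finite (supp (r2D \<Phi> (\<Psi> :: 'k::field_char_0 tens)))"
  unfolding r2D_def by (intro fin_lext2 fin_smul fin_gbr)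

lemma EV_r2D:
  assumes "hom_len n \<Phi>" "hom_len m \<Psi>"
  shows "V.EV (r2D \<Phi> \<Psi>) gs = sg (int n - 1) *
    (ecirc n \<Phi> \<Psi> gs - sg ((int n - 1) * (int m - 1)) * ecirc m \<Psi> \<Phi> gs)"
proof -
  have fin: "finite (supp \<Phi>)" "finite (supp \<Psi>)" using assms by (simp_all add: hom_len_def)
  have 1: "V.EV (\<lambda>z. sg (int (length xs) - 1) * gbr_b xs ys z) gs = sg (int n - 1) *
      (rcirc n (V.evb xs) ys gs - sg ((int n - 1) * (int m - 1)) * rcirc m (V.evb ys) xs gs)"
    if "xs \<in> supp \<Phi>" "ys \<in> supp \<Psi>" for xs ys
  proof -
    have "length xs = n" "length ys = m" using that assms by (auto simp: hom_len_def)
    then show ?thesis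
      by (simp add: V.EV_smul fin_gbr) (simp add: gbr_b_def V.EV_diff V.EV_smul fin_smul fin_circ EV_circ)
  qed
  have "V.EV (r2D \<Phi> \<Psi>) gs = (\<Sum>xs\<in>supp \<Phi>. \<Sum>ys\<in>supp \<Psi>. \<Phi> xs * \<Psi> ys *
      V.EV (\<lambda>z. sg (int (length xs) - 1) * gbr_b xs ys z) gs)"
    unfolding r2D_def V.EV_def using fin by (subst lext_lext2) (auto intro: fin_smul fin_gbr simp: lext2_def)
  also have "\<dots> = (\<Sum>xs\<in>supp \<Phi>. \<Sum>ys\<in>supp \<Psi>. \<Phi> xs * \<Psi> ys * (sg (int n - 1) *
      (rcirc n (V.evb xs) ys gs - sg ((int n - 1) * (int m - 1)) * rcirc m (V.evb ys) xs gs)))"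
    by (intro sum.cong refl) (simp only: 1)
  also have "\<dots> = sg (int n - 1) * ((\<Sum>xs\<in>supp \<Phi>. \<Sum>ys\<in>supp \<Psi>. \<Psi> ys * (\<Phi> xs * rcirc n (V.evb xs) ys gs))
      - sg ((int n - 1) * (int m - 1)) * (\<Sum>xs\<in>supp \<Phi>. \<Phi> xs * (\<Sum>ys\<in>supp \<Psi>. \<Psi> ys * rcirc m (V.evb ys) xs gs)))"
    by (simp add: sum_distrib_left sum_subtractf algebra_simps)
  also have "(\<Sum>xs\<in>supp \<Phi>. \<Sum>ys\<in>supp \<Psi>. \<Psi> ys * (\<Phi> xs * rcirc n (V.evb xs) ys gs)) = ecirc n \<Phi> \<Psi> gs"
    by (subst sum.swap) (simp add: sum_distrib_left[symmetric] rcirc_lext ecirc_def lext_def)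
  also have "(\<Sum>xs\<in>supp \<Phi>. \<Phi> xs * (\<Sum>ys\<in>supp \<Psi>. \<Psi> ys * rcirc m (V.evb ys) xs gs)) = ecirc m \<Psi> \<Phi> gs"
    by (simp add: rcirc_lext ecirc_def lext_def)
  finally show ?thesis .
qed

section \<open>Binomial identities for the Jordanian twist\<close>

text \<open>The value of the coefficient of h^n in the Jordanian twist, binom(y / 2, n) \<otimes>
  x^n.\<close>

definition jt :: "nat \<Rightarrow> 'k \<times> nat \<Rightarrow> 'k \<times> nat \<Rightarrow> 'k::field_char_0" where
  "jt n g h = (if snd g = 0 \<and> snd h = n then fact n * (fst g / 2 gchoose n) else 0)"

text \<open>The factor produced by right multiplication with binom(y / 2, j): moving y across x^n
  replaces y by y + 2 n.\<close>

definition yt :: "nat \<Rightarrow> 'k \<times> nat \<Rightarrow> 'k::field_char_0" where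
  "yt j g = (fst g + 2 * of_nat (snd g)) / 2 gchoose j"

definition xt :: "nat \<Rightarrow> 'k \<times> nat \<Rightarrow> 'k::field_char_0" where
  "xt j g = of_nat (snd g choose j) * fact j"

text \<open>The shift belonging to right multiplication by x^j, whose factor is \<open>xt\<close>.
  Truncated subtraction does no harm, since \<open>xt\<close> is 0 when j exceeds the
  exponent.\<close>

definition dn :: "nat \<Rightarrow> 'k \<times> nat \<Rightarrow> 'k \<times> nat" where
  "dn j g = (fst g, snd g - j)"

text \<open>The coefficient of h^m in ln (1 + h x) / h is (-1)^m x^(m+1) / (m+1), and x^(m+1) has
  the value (m+1)! at its own exponent.\<close>

definition lt :: "nat \<Rightarrow> 'k \<times> nat \<Rightarrow> 'k::field_char_0" where
  "lt m g = (if snd g = Suc m then (- 1) ^ m * fact m else 0)"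

text \<open>A falling factorial of z of length q + m splits into the first q factors and a falling
  factorial starting at z - q.\<close>

lemma gbinomial_shift:
  "fact (q + m) * (z gchoose (q + m)) = fact q * (z gchoose q) * (fact m * ((z :: 'k::field_char_0) - of_nat q gchoose m))"
proof -
  have "(z gchoose (q + m)) * of_nat ((q + m) choose q) = (z gchoose q) * (z - of_nat q gchoose m)"
    using gbinomial_trinomial_revision[of q "q + m" z] by (simp add: binomial_gbinomial)
  then show ?thesis by (simp add: binomial_fact divide_simps) (simp add: algebra_simps)
qed

lemma fact_choose: "j \<le> p \<Longrightarrow> of_nat (p choose j) * fact j * fact (p - j) = (fact p :: 'k::field_char_0)"
  by (simp add: binomial_fact)

lemma Vandermonde_atMost:
  "(\<Sum>k\<le>n. (a gchoose k) * (b gchoose (n - k))) = ((a :: 'k::field_char_0) + b gchoose n)"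
  using gbinomial_Vandermonde[of a b n] by (simp add: atMost_atLeast0)

lemma xt_zero: "snd g < j \<Longrightarrow> xt j g = 0"
  by (simp add: xt_def binomial_eq_0)

text \<open>The coefficient of \<open>h^n\<close> in \<open>(\<Delta> \<otimes> 1)(J) (J \<otimes> 1) = (1 \<otimes> \<Delta>)(J) (1 \<otimes> J)\<close>
  for \<open>J = (1 + h x_2) powr (y_1 / 2)\<close>.\<close>
lemma twist_identity:
  fixes g1 g2 g3 :: "'k::field_char_0 \<times> nat"
  shows "(\<Sum>j\<le>n. yt j g1 * xt j g2 * jt (n - j) (g1 + dn j g2) g3)
       = (\<Sum>j\<le>n. yt j g2 * xt j g3 * jt (n - j) g1 (g2 + dn j g3))" (is "?L = ?R")
proof -
  obtain s1 n1 s2 q s3 p where g: "g1 = (s1, n1)" "g2 = (s2, q)" "g3 = (s3, p)" by (metis surj_pair)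
  \<comment> \<open>Both sides vanish unless the first argument has no x and the other two together
    have n.\<close>
  consider "n1 \<noteq> 0" | "n1 = 0" "q + p \<noteq> n" | "n1 = 0" "q + p = n" by blast
  then show ?thesis
  proof cases
    case 1
    then show ?thesis by (simp add: jt_def g)
  next
    case 2
    have "yt j g1 * xt j g2 * jt (n - j) (g1 + dn j g2) g3 = 0" if "j \<le> n" for j
      using 2 that by (cases "q < j") (auto simp: g xt_zero jt_def dn_def)
    moreover have "yt j g2 * xt j g3 * jt (n - j) g1 (g2 + dn j g3) = 0" if "j \<le> n" for j
      using 2 that by (cases "p < j") (auto simp: g xt_zero jt_def dn_def)
    ultimately have "?L = 0" "?R = 0" by (auto intro!: sum.neutral simp del: mult_eq_0_iff)
    then show ?thesis by simp
  next
    case 3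
    define z w where "z = s1 / 2" and "w = s2 / 2"
    \<comment> \<open>On this side \<open>jt\<close> wants no x left in its first slot, so all q
      copies are removed: only j = q survives.\<close>
    have "(\<Sum>j\<le>n. yt j g1 * xt j g2 * jt (n - j) (g1 + dn j g2) g3)
       = (\<Sum>j\<le>n. if j = q then fact q * (z gchoose q) * (fact p * (z + w gchoose p)) else 0)"
    proof (intro sum.cong refl)
      fix j assume "j \<in> {..n}"
      show "yt j g1 * xt j g2 * jt (n - j) (g1 + dn j g2) g3
        = (if j = q then fact q * (z gchoose q) * (fact p * (z + w gchoose p)) else 0)"
        using 3 by (cases j q rule: linorder_cases)
          (auto simp: g xt_zero jt_def dn_def yt_def xt_def z_def w_def add_divide_distrib)
    qed
    also have "\<dots> = fact q * (z gchoose q) * (fact p * (z + w gchoose p))" using 3 by simp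
    \<comment> \<open>Vandermonde for z + w = (w + q) + (z - q); the shift by q is the one in
      \<open>yt\<close> for the second argument.\<close>
    also have "\<dots> = (\<Sum>j\<le>p. fact q * (z gchoose q) * fact p * ((w + of_nat q gchoose j) * (z - of_nat q gchoose (p - j))))"
      by (simp add: sum_distrib_left[symmetric] Vandermonde_atMost add.commute)
    also have "\<dots> = (\<Sum>j\<le>p. yt j g2 * xt j g3 * jt (n - j) g1 (g2 + dn j g3))"
    proof (intro sum.cong refl)
      fix j assume "j \<in> {..p}"
      then have j: "n - j = q + (p - j)" "j \<le> p" using 3 by auto
      have "yt j g2 * xt j g3 * jt (n - j) g1 (g2 + dn j g3)
        = (w + of_nat q gchoose j) * (of_nat (p choose j) * fact j) * (fact (q + (p - j)) * (z gchoose (q + (p - j))))"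
        using 3 j by (simp add: g yt_def xt_def jt_def dn_def z_def w_def add_divide_distrib)
      also have "\<dots> = (w + of_nat q gchoose j) * (of_nat (p choose j) * fact j * fact (p - j)) * (fact q * (z gchoose q) * (z - of_nat q gchoose (p - j)))"
        unfolding gbinomial_shift by (simp only: mult_ac)
      finally show "fact q * (z gchoose q) * fact p * ((w + of_nat q gchoose j) * (z - of_nat q gchoose (p - j)))
         = yt j g2 * xt j g3 * jt (n - j) g1 (g2 + dn j g3)"
        unfolding fact_choose[OF j(2)] by (simp only: mult_ac)
    qed
    also have "\<dots> = (\<Sum>j\<le>n. yt j g2 * xt j g3 * jt (n - j) g1 (g2 + dn j g3))"
      using 3 by (intro sum.mono_neutral_left) (auto simp: g xt_zero)
    finally show ?thesis .
  qed
qed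

text \<open>Upper negation of a binomial coefficient; it brings the factorials of the logarithm into
  a form to which Vandermonde applies.\<close>

lemma fact_add_gbinomial:
  "fact (p + k) = fact k * fact p * (- 1) ^ k * (- of_nat (Suc p) gchoose k :: 'k::field_char_0)"
proof -
  have "(- of_nat (Suc p) gchoose k) = (- 1) ^ k * (of_nat (p + k) gchoose k :: 'k)"
    by (subst gbinomial_minus) (simp add: add_ac)
  also have "\<dots> = (- 1) ^ k * of_nat ((p + k) choose k)"
    by (simp add: binomial_gbinomial)
  finally show ?thesis
    by (simp add: binomial_fact power_mult_distrib[symmetric])
qed

text \<open>The coefficient of \<open>h^m\<close> in \<open>\<Delta>(\<phi>) J = J (\<phi> \<otimes> 1 + 1 \<otimes> \<phi>)\<close> for \<open>\<phi> = ln (1 + h x) / h\<close>.\<close>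
lemma log_identity:
  fixes g h :: "'k::field_char_0 \<times> nat"
  shows "(\<Sum>j\<le>m. yt j g * xt j h * lt (m - j) (g + dn j h))
       = (\<Sum>j\<le>m. (- 1) ^ (m - j) / of_nat (Suc (m - j)) *
           (xt (Suc (m - j)) g * jt j (dn (Suc (m - j)) g) h + xt (Suc (m - j)) h * jt j g (dn (Suc (m - j)) h)))" (is "?L = ?R")
proof -
  obtain s p r q where g: "g = (s, p)" "h = (r, q)" by (metis surj_pair)
  define z where "z = s / 2"
  \<comment> \<open>Off total exponent m + 1 all terms vanish. For p = 0 the sides agree term by
    term. For p > 0 the second summand on the right vanishes and the first survives only at j =
    q.\<close>
  consider "p + q \<noteq> Suc m" | "p = 0" "q = Suc m" | p' where "p = Suc p'" "p' + q = m"
    by (cases p) auto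
  then show ?thesis
  proof cases
    case 1
    have "yt j g * xt j h * lt (m - j) (g + dn j h) = 0" if "j \<le> m" for j
      using 1 that by (cases "q < j") (auto simp: g xt_zero lt_def dn_def)
    moreover have "xt (Suc (m - j)) g * jt j (dn (Suc (m - j)) g) h = 0" if "j \<le> m" for j
      using 1 that by (cases "p < Suc (m - j)") (auto simp: g xt_zero jt_def dn_def)
    moreover have "xt (Suc (m - j)) h * jt j g (dn (Suc (m - j)) h) = 0" if "j \<le> m" for j
      using 1 that by (cases "q < Suc (m - j)") (auto simp: g xt_zero jt_def dn_def)
    ultimately have "?L = 0" "?R = 0" by (auto intro!: sum.neutral simp del: mult_eq_0_iff)
    then show ?thesis by simp
  next
    case 2
    show ?thesis
    proof (intro sum.cong refl)
      fix j assume "j \<in> {..m}"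
      then have j: "j \<le> m" by simp
      have sym: "Suc m choose Suc (m - j) = Suc m choose j"
        using j by (metis Suc_diff_le binomial_symmetric le_SucI)
      have "yt j g * xt j h * lt (m - j) (g + dn j h)
        = (z gchoose j) * (of_nat (Suc m choose j) * fact j) * ((- 1) ^ (m - j) * fact (m - j))"
        using j 2 by (simp add: g yt_def xt_def lt_def dn_def z_def Suc_diff_le)
      moreover have "xt (Suc (m - j)) g = 0"
        using 2 by (simp add: g xt_zero)
      moreover have "xt (Suc (m - j)) h * jt j g (dn (Suc (m - j)) h)
        = of_nat (Suc m choose j) * (of_nat (Suc (m - j)) * fact (m - j)) * (fact j * (z gchoose j))"
        using j 2 by (simp add: g xt_def jt_def dn_def z_def sym del: binomial_Suc_Suc of_nat_Suc)
      ultimately show "yt j g * xt j h * lt (m - j) (g + dn j h)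
        = (- 1) ^ (m - j) / of_nat (Suc (m - j)) *
           (xt (Suc (m - j)) g * jt j (dn (Suc (m - j)) g) h + xt (Suc (m - j)) h * jt j g (dn (Suc (m - j)) h))"
        by (simp del: of_nat_Suc binomial_Suc_Suc)
    qed
  next
    case 3
    have "(\<Sum>j\<le>m. yt j g * xt j h * lt (m - j) (g + dn j h)) = (\<Sum>j\<le>q. yt j g * xt j h * lt (m - j) (g + dn j h))"
      using 3 by (intro sum.mono_neutral_right) (auto simp: g xt_zero)
    \<comment> \<open>Prepared for Vandermonde with (z + p) + (- p) = z.\<close>
    also have "\<dots> = (\<Sum>j\<le>q. (- 1) ^ p' * fact p' * fact q *
        ((z + of_nat p gchoose j) * (- of_nat p gchoose (q - j))))"
    proof (intro sum.cong refl)
      fix j assume "j \<in> {..q}"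
      then have j: "m - j = p' + (q - j)" "j \<le> q" using 3 by auto
      have "yt j g * xt j h * lt (m - j) (g + dn j h)
        = (z + of_nat p gchoose j) * (of_nat (q choose j) * fact j) * ((- 1) ^ (m - j) * fact (p' + (q - j)))"
        using 3 j by (simp add: g yt_def xt_def lt_def dn_def z_def add_divide_distrib)
      also have "\<dots> = (z + of_nat p gchoose j) * (of_nat (q choose j) * fact j * fact (q - j)) *
          ((- 1) ^ p' * ((- 1) ^ (q - j) * (- 1) ^ (q - j)) * fact p' * (- of_nat p gchoose (q - j)))"
        unfolding fact_add_gbinomial 3(1)[symmetric] j(1) power_add by (simp only: mult_ac)
      also have "(- 1) ^ (q - j) * (- 1) ^ (q - j) = (1 :: 'k)"
        by (simp flip: power_mult_distrib)
      finally show "yt j g * xt j h * lt (m - j) (g + dn j h) = (- 1) ^ p' * fact p' * fact q *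
        ((z + of_nat p gchoose j) * (- of_nat p gchoose (q - j)))"
        unfolding fact_choose[OF j(2)] by (simp only: mult_ac mult_1)
    qed
    also have "\<dots> = (- 1) ^ p' * fact p' * fact q * (z gchoose q)"
      by (simp add: sum_distrib_left[symmetric] Vandermonde_atMost)
    also have "\<dots> = (\<Sum>j\<le>m. if j = q then (- 1) ^ p' * fact p' * fact q * (z gchoose q) else 0)"
      using 3 by simp
    also have "\<dots> = (\<Sum>j\<le>m. (- 1) ^ (m - j) / of_nat (Suc (m - j)) *
           (xt (Suc (m - j)) g * jt j (dn (Suc (m - j)) g) h + xt (Suc (m - j)) h * jt j g (dn (Suc (m - j)) h)))"
    proof (intro sum.cong refl)
      fix j assume "j \<in> {..m}"
      then have j: "j \<le> m" by simp
      have 0: "jt j g (dn (Suc (m - j)) h) = 0" using 3 by (simp add: jt_def g)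
      show "(if j = q then (- 1) ^ p' * fact p' * fact q * (z gchoose q) else 0) = (- 1) ^ (m - j) / of_nat (Suc (m - j)) *
           (xt (Suc (m - j)) g * jt j (dn (Suc (m - j)) g) h + xt (Suc (m - j)) h * jt j g (dn (Suc (m - j)) h))"
      proof (cases "j = q")
        case True
        then have "m - j = p'" using 3 by simp
        then show ?thesis unfolding 0 using True 3
          by (simp add: g xt_def jt_def dn_def z_def del: of_nat_Suc)
      next
        case False
        then show ?thesis unfolding 0 by (simp add: jt_def g)
      qed
    qed
    finally show ?thesis .
  qed
qed

section \<open>Components of the morphism\<close>

text \<open>The polynomial binom(s / 2, n). Its coefficients are what writes the twist in terms of
  the words y^a.\<close>

definition binom_poly :: "nat \<Rightarrow> 'k::field_char_0 poly" where
  "binom_poly n = smult (inverse (fact n)) (\<Prod>i<n. [:- of_nat i, 1 / 2:])"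

lemma poly_binom_poly: "poly (binom_poly n) s = (s / 2 gchoose n)"
  by (simp add: binom_poly_def poly_prod gbinomial_prod_rev atLeast0LessThan field_simps)

text \<open>\<open>fr n\<close> is the value on \<open>n\<close> copies of \<open>e1 \<and> e2\<close>, and \<open>fx x m\<close> the value on the
  monomial \<open>x\<close> and \<open>m\<close> copies of \<open>e1 \<and> e2\<close>.\<close>
definition fr :: "nat \<Rightarrow> 'k::field_char_0 tens" where
  "fr n = (if n = 0 then (\<lambda>_. 0) else
     (\<lambda>z. \<Sum>a\<le>degree (binom_poly n :: 'k poly). (- fact n * coeff (binom_poly n) a) * bas [replicate a True, replicate n False] z))"

definition fx :: "bool list \<Rightarrow> nat \<Rightarrow> 'k::field_char_0 tens" where
  "fx x m = (if x = [False] then (\<lambda>z. (fact m * (- 1) ^ m / of_nat (Suc m)) * bas [replicate (Suc m) False] z)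
     else if m = 0 then bas (map (\<lambda>b. [b]) x) else (\<lambda>_. 0))"

lemma fr_0 [simp]: "fr 0 = (\<lambda>_. 0)"
  by (simp add: fr_def)

lemma hom_len_zero [simp]: "hom_len n (\<lambda>_. 0)"
  by (simp add: hom_len_def)

lemma hom_len_bas [simp]: "hom_len n (bas ws :: 'k::field_char_0 tens) \<longleftrightarrow> length ws = n"
  by (simp add: hom_len_def)

lemma hom_len_smul: "hom_len n f \<Longrightarrow> hom_len n (\<lambda>z. c * f z :: 'k::field_char_0)"
  by (auto simp: hom_len_def fin_smul) (auto simp: supp_def)

lemma hom_len_sum: "(\<And>i. i \<in> I \<Longrightarrow> hom_len n (F i)) \<Longrightarrow> hom_len n (\<lambda>z. \<Sum>i\<in>I. F i z :: 'k::field_char_0)"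
proof -
  assume *: "\<And>i. i \<in> I \<Longrightarrow> hom_len n (F i)"
  have "length ws = n" if "(\<Sum>i\<in>I. F i ws) \<noteq> 0" for ws
  proof -
    from that obtain i where "i \<in> I" "F i ws \<noteq> 0" by (meson sum.neutral)
    then show ?thesis using *[of i] by (auto simp: hom_len_def supp_def)
  qed
  then show ?thesis using * fin_sum[of I F] by (auto simp: hom_len_def) (simp add: supp_def)
qed

lemma hom_len_fr: "hom_len 2 (fr n :: 'k::field_char_0 tens)"
  unfolding fr_def by (auto intro!: hom_len_sum hom_len_smul simp del: mult_minus_left)

lemma hom_len_fx: "hom_len (length x) (fx x m :: 'k::field_char_0 tens)"
  unfolding fx_def by (auto intro!: hom_len_smul simp del: mult_minus_left times_divide_eq_left)

lemma hom_len_fin: "hom_len n f \<Longrightarrow> finite (supp f)"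
  by (simp add: hom_len_def)

lemma fin_fr [simp]: "finite (supp (fr n :: 'k::field_char_0 tens))"
  using hom_len_fr by (rule hom_len_fin)

lemma fin_fx [simp]: "finite (supp (fx x m :: 'k::field_char_0 tens))"
  using hom_len_fx by (rule hom_len_fin)

text \<open>Two scalars x and y, because a tensor of length 2 offers two places for an insertion; a
  single place is the case y = 0, C = 0.\<close>

lemma lext_fr:
  assumes "n \<noteq> 0" "\<And>a. F [replicate a True, replicate n False] gs = x ^ a * B + y ^ a * C"
  shows "lext F (fr n) gs = - fact n * ((x / 2 gchoose n) * B + (y / 2 gchoose n) * (C :: 'k::field_char_0))"
proof -
  have "lext F (fr n) gs = (\<Sum>a\<le>degree (binom_poly n :: 'k poly). (- fact n * coeff (binom_poly n) a) * (x ^ a * B + y ^ a * C))"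
    unfolding fr_def using assms
    by (simp only: if_False) (subst lext_sum, intro fin_smul, simp, subst lext_smul, simp_all)
  also have "\<dots> = - fact n * (poly (binom_poly n) x * B + poly (binom_poly n) y * C)"
    unfolding poly_altdef by (simp add: sum_distrib_left sum_distrib_right sum.distrib sum_subtractf algebra_simps sum_negf)
  finally show ?thesis by (simp only: poly_binom_poly)
qed

lemma fr_1: "fr 1 = (\<lambda>z. (- 1 / 2) * bas [[True], [False]] z :: 'k::field_char_0)"
proof -
  have b: "binom_poly 1 = [:0, 1 / 2 :: 'k:]" by (simp add: binom_poly_def)
  show ?thesis by (simp add: fr_def b[simplified])
qed

lemma EV_fr: "n \<noteq> 0 \<Longrightarrow> V.EV (fr n) [g, h] = - fact n * jt n g h"
proof -
  assume n: "n \<noteq> 0"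
  have "V.evb [replicate a True, replicate n False] [g, h]
      = fst g ^ a * (if snd g = 0 \<and> snd h = n then fact n else 0) + 0 ^ a * 0" for a
    using ev_sw[of a 0 "fst g" "snd g"] ev_sw[of 0 n "fst h" "snd h"] by (auto simp: sw_def)
  from lext_fr[where F = V.evb and gs = "[g, h]", OF n this] show ?thesis
    unfolding V.EV_def by (simp add: jt_def)
qed

lemma EV_fx_F: "V.EV (fx [False] m) [g] = fact m * lt m g"
proof -
  have "V.EV (fx [False] m) [g] = fact m * (- 1) ^ m / of_nat (Suc m) * ev (replicate (Suc m) False) g"
    unfolding fx_def by (subst if_P[OF refl], subst V.EV_smul) simp_all
  then show ?thesis
    using ev_sw[of 0 "Suc m" "fst g" "snd g"] by (simp add: sw_def lt_def del: of_nat_Suc replicate_Suc)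
qed

lemma ecirc_bas: "ecirc n \<Phi> (bas ys) = rcirc n (V.EV \<Phi>) ys"
  by (simp add: ecirc_def)

lemma ecirc_smul_bas: "ecirc n \<Phi> (\<lambda>z. c * bas ys z) gs = c * rcirc n (V.EV \<Phi>) ys gs"
  unfolding ecirc_def by (subst lext_smul) simp_all

lemma ecirc_zero [simp]: "ecirc n \<Phi> (\<lambda>_. 0) gs = 0" "ecirc n (\<lambda>_. 0) \<Psi> gs = 0" "ecirc 0 \<Phi> \<Psi> gs = 0"
proof -
  show "ecirc n \<Phi> (\<lambda>_. 0) gs = 0" by (simp add: ecirc_def)
  have "rcirc n (V.EV (\<lambda>_. 0)) ys gs = 0" for ys
    by (simp add: rcirc_def Let_def)
  then show "ecirc n (\<lambda>_. 0) \<Psi> gs = 0" by (simp add: ecirc_def lext_def)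
  have "rcirc 0 (V.EV \<Phi>) ys gs = 0" for ys
    by (auto simp: rcirc_def)
  then show "ecirc 0 \<Phi> \<Psi> gs = 0" by (simp add: ecirc_def lext_def)
qed

lemma ecirc_len: "hom_len m \<Psi> \<Longrightarrow> Suc (length gs) \<noteq> n + m \<Longrightarrow> ecirc n \<Phi> \<Psi> gs = 0"
  unfolding ecirc_def lext_def by (intro sum.neutral) (auto simp: hom_len_def rcirc_def)

lemma EV_r2D_len:
  "hom_len n \<Phi> \<Longrightarrow> hom_len m \<Psi> \<Longrightarrow> Suc (length gs) \<noteq> n + m \<Longrightarrow> V.EV (r2D \<Phi> \<Psi>) gs = 0"
  by (simp add: EV_r2D ecirc_len)

lemma hdiff_zero [simp]: "hdiff (\<lambda>_. 0) = (\<lambda>_. 0 :: 'k::comm_ring_1)"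
  by (simp add: hdiff_def fun_eq_iff)

lemma r2D_zero [simp]: "r2D \<Phi> (\<lambda>_. 0) = (\<lambda>_. 0 :: 'k::comm_ring_1)" "r2D (\<lambda>_. 0) \<Psi> = (\<lambda>_. 0 :: 'k)"
  by (simp_all add: r2D_def fun_eq_iff)

lemma EV_hdiff_len: "hom_len n \<Phi> \<Longrightarrow> length gs \<noteq> Suc n \<Longrightarrow> V.EV (hdiff \<Phi>) gs = 0"
  by (rule V.EV_hom[of _ "Suc n"]) (auto simp: hom_len_def dest!: V.supp_hdiff[rotated])

lemma EV_hdiff_hom: "hom_len n \<Phi> \<Longrightarrow> length gs = Suc n \<Longrightarrow> V.EV (hdiff \<Phi>) gs = bard (ev []) n (V.EV \<Phi>) gs"
  by (rule V.EV_hdiff) (auto simp: hom_len_def)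

lemma rmul_words: "rmul (replicate a True) g = (fst g + 2 * of_nat (snd g)) ^ a" "rmul (replicate b False) g = xt b g"
  by (simp_all add: rmul_replicate_True rmul_replicate_False xt_def)

lemma rsh_words: "rsh (replicate a True) g = g" "rsh (replicate b False) g = dn b g"
  by (simp_all add: dn_def)

lemma ecirc_fr1:
  assumes "n \<noteq> 0"
  shows "ecirc 1 \<Phi> (fr n) [g, h] = - fact n * (yt n g * xt n h * V.EV \<Phi> [g + dn n h])"
proof -
  have "rcirc 1 (V.EV \<Phi>) [replicate a True, replicate n False] [g, h]
    = (fst g + 2 * of_nat (snd g)) ^ a * (xt n h * V.EV \<Phi> [g + dn n h]) + 0 ^ a * 0" for a
    by (simp add: rcirc_def Let_def rmul_words rsh_words del: rsh_replicate(2))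
  from lext_fr[where F = "rcirc 1 (V.EV \<Phi>)" and gs = "[g, h]", OF assms this] show ?thesis
    by (simp add: ecirc_def yt_def)
qed

lemma ecirc_fr2:
  assumes "n \<noteq> 0"
  shows "ecirc 2 \<Phi> (fr n) [g1, g2, g3] = - fact n *
    (yt n g1 * xt n g2 * V.EV \<Phi> [g1 + dn n g2, g3] - yt n g2 * xt n g3 * V.EV \<Phi> [g1, g2 + dn n g3])"
proof -
  have "rcirc 2 (V.EV \<Phi>) [replicate a True, replicate n False] [g1, g2, g3]
    = (fst g1 + 2 * of_nat (snd g1)) ^ a * (xt n g2 * V.EV \<Phi> [g1 + dn n g2, g3])
      + (fst g2 + 2 * of_nat (snd g2)) ^ a * (- xt n g3 * V.EV \<Phi> [g1, g2 + dn n g3])" for a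
    by (simp add: rcirc_def Let_def rmul_words rsh_words numeral_2_eq_2 sg_def del: rsh_replicate(2))
  from lext_fr[where F = "rcirc 2 (V.EV \<Phi>)" and gs = "[g1, g2, g3]", OF assms this] show ?thesis
    by (simp add: ecirc_def yt_def algebra_simps)
qed

lemma rcirc_letters:
  "rcirc 1 u [w] [g] = rmul w g * u [rsh w g]"
  "rcirc 2 u [w] [g, h] = rmul w g * u [rsh w g, h] + rmul w h * u [g, rsh w h]"
  "rcirc 1 u [] [] = u [0]"
  "rcirc 2 u [] [g] = u [0, g] - u [g, 0]"
  by (simp_all add: rcirc_def Let_def numeral_2_eq_2 sg_def)

section \<open>The relations for copies of r with zero, one or two further arguments\<close>

lemma sum_atMost_rev: "(\<Sum>j\<le>n. F (n - j)) = (\<Sum>j\<le>(n::nat). F j :: 'a::comm_monoid_add)"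
  by (rule sum.reindex_bij_witness[of _ "\<lambda>j. n - j" "\<lambda>j. n - j"]) auto

lemma sum_atMost_inner:
  fixes n :: nat
  assumes "n \<noteq> 0"
  shows "(\<Sum>j\<le>n. if j = 0 \<or> j = n then 0 else F j) = (\<Sum>j\<le>n. F j) - F 0 - (F n :: 'a::ab_group_add)"
proof -
  have "(\<Sum>j\<le>n. F j) = (\<Sum>j\<le>n. (if j = 0 \<or> j = n then 0 else F j) + (if j = 0 then F 0 else 0) + (if j = n then F n else 0))"
    using assms by (intro sum.cong) auto
  also have "\<dots> = (\<Sum>j\<le>n. if j = 0 \<or> j = n then 0 else F j) + F 0 + F n"
    by (simp add: sum.distrib)
  finally show ?thesis by simp
qed

text \<open>The Maurer-Cartan equation. The twist has constant term 1 while \<open>fr 0\<close> is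
  0: the terms j = 0 and j = n of \<open>twist_identity\<close> are absent from the bracket sum, and
  they are exactly what the differential contributes.\<close>

lemma rel_r:
  assumes n: "n \<noteq> 0"
  shows "V.EV (hdiff (fr n)) gs + 1 / 2 * (\<Sum>j\<le>n. of_nat (n choose j) * V.EV (r2D (fr j) (fr (n - j))) gs)
    = (0 :: 'k::field_char_0)"
proof (cases "length gs = 3")
  case False
  then show ?thesis
    by (simp add: EV_hdiff_len[OF hom_len_fr] EV_r2D_len[OF hom_len_fr hom_len_fr])
next
  case True
  then obtain g1 g2 g3 where gs: "gs = [g1, g2, g3]" by (auto simp: length_Suc_conv numeral_3_eq_3)
  define K :: "nat \<Rightarrow> nat \<Rightarrow> 'k" where "K i j = yt j g1 * xt j g2 * jt i (g1 + dn j g2) g3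
      - yt j g2 * xt j g3 * jt i g1 (g2 + dn j g3)" for i j
  have K_sum: "(\<Sum>j\<le>n. K (n - j) j) = 0"
    by (simp add: K_def sum_subtractf twist_identity)
  define c where "c i j = ecirc 2 (fr i) (fr j) gs" for i j
  \<comment> \<open>The binomial coefficient and the factorials in \<open>fr j\<close> and
    \<open>fr (n - j)\<close> combine to n!, independent of j.\<close>
  have c: "of_nat (n choose j) * c (n - j) j = (if j = 0 \<or> j = n then 0 else fact n * K (n - j) j)" if "j \<le> n" for j
  proof (cases "j = 0 \<or> j = n")
    case False
    then have "c (n - j) j = fact j * fact (n - j) * K (n - j) j"
      using that by (simp add: c_def gs ecirc_fr2 EV_fr K_def algebra_simps)
    then show ?thesis using False fact_choose[OF that, where 'k = 'k]
      by (simp flip: mult.assoc)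
  qed (auto simp: c_def)
  have r: "V.EV (r2D (fr j) (fr (n - j))) gs = - (c j (n - j) + c (n - j) j)" for j
    by (simp add: EV_r2D[OF hom_len_fr hom_len_fr] c_def)
  have "(\<Sum>j\<le>n. of_nat (n choose j) * c j (n - j)) = (\<Sum>j\<le>n. of_nat (n choose (n - j)) * c (n - j) j)"
    by (subst sum_atMost_rev[symmetric], rule sum.cong) auto
  also have "\<dots> = (\<Sum>j\<le>n. of_nat (n choose j) * c (n - j) j)"
    by (intro sum.cong refl) (simp add: binomial_symmetric[symmetric])
  finally have "(\<Sum>j\<le>n. of_nat (n choose j) * V.EV (r2D (fr j) (fr (n - j))) gs) = - 2 * (\<Sum>j\<le>n. of_nat (n choose j) * c (n - j) j)"
    unfolding r by (simp add: sum_negf right_diff_distrib sum_subtractf)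
  also have "(\<Sum>j\<le>n. of_nat (n choose j) * c (n - j) j) = (\<Sum>j\<le>n. if j = 0 \<or> j = n then 0 else fact n * K (n - j) j)"
    using c by (intro sum.cong) auto
  also have "\<dots> = - fact n * (K n 0 + K 0 n)"
    using n by (simp add: sum_atMost_inner sum_distrib_left[symmetric] K_sum algebra_simps)
  finally have S: "(\<Sum>j\<le>n. of_nat (n choose j) * V.EV (r2D (fr j) (fr (n - j))) gs) = 2 * (fact n * (K n 0 + K 0 n))"
    by simp
  have Kn0: "K n 0 = jt n (g1 + g2) g3 - jt n g1 (g2 + g3)"
    by (simp add: K_def yt_def xt_def dn_def)
  have K0n: "K 0 n = jt n g1 g2 * ev [] g3 - ev [] g1 * jt n g2 g3"
    using n by (cases "snd g2 = n"; cases "snd g3 = n"; cases "snd g2 < n"; cases "snd g3 < n")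
       (auto simp: K_def yt_def xt_def dn_def jt_def ev_Nil binomial_eq_0)
  have "V.EV (hdiff (fr n)) gs = - fact n * (jt n g1 g2 * ev [] g3 - ev [] g1 * jt n g2 g3 + (jt n (g1 + g2) g3 - jt n g1 (g2 + g3)))"
    using n by (subst EV_hdiff_hom[OF hom_len_fr])
      (simp_all add: gs bard_def merge_def numeral_2_eq_2 EV_fr sg_def algebra_simps)
  then show ?thesis unfolding S Kn0 K0n by (simp add: algebra_simps)
qed

lemma ev_letter_True: "ev [True] g = fst g * ev [] g"
  using ev_sw[of 1 0 "fst g" "snd g"] by (simp add: sw_def ev_Nil)

lemma rmul_letter_True: "rmul [True] g = fst g + 2 * of_nat (snd g)" "rsh [True] g = g"
  using rmul_replicate_True[of 1 g] rsh_replicate(1)[of 1 g] by simp_all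

lemma ecirc_fx_F: "ecirc 2 \<Phi> (fx [False] m) [g, h] = (fact m * (- 1) ^ m / of_nat (Suc m)) *
   (xt (Suc m) g * V.EV \<Phi> [dn (Suc m) g, h] + xt (Suc m) h * V.EV \<Phi> [g, dn (Suc m) h])"
  unfolding fx_def by (subst if_P[OF refl], subst ecirc_smul_bas)
    (simp only: rcirc_letters rmul_words rsh_words)

text \<open>In degrees 1 and 0 the decalage sign makes \<open>r2D\<close> symmetric, so the factor
  1/2 in the relations counts each pair once.\<close>

lemma EV_r2D_mixed:
  assumes "hom_len (Suc 0) \<Psi>"
  shows "V.EV (r2D (fr j) \<Psi>) gs = ecirc 1 \<Psi> (fr j) gs - ecirc 2 (fr j) \<Psi> gs"
    "V.EV (r2D \<Psi> (fr j)) gs = ecirc 1 \<Psi> (fr j) gs - ecirc 2 (fr j) \<Psi> gs"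
  by (simp_all add: EV_r2D[OF hom_len_fr assms] EV_r2D[OF assms hom_len_fr])

text \<open>This is \<open>log_identity\<close> with its term j = 0, which belongs to the constant
  term 1 of the twist, accounted for by the differential.\<close>

lemma rel_xr_F:
  "V.EV (hdiff (fx [False] m)) [g, h] + (\<Sum>j\<le>m. of_nat (m choose j) *
      (ecirc 1 (fx [False] (m - j)) (fr j) [g, h] - ecirc 2 (fr j) (fx [False] (m - j)) [g, h])) = (0 :: 'k::field_char_0)"
proof -
  define L :: "nat \<Rightarrow> 'k" where "L j = yt j g * xt j h * lt (m - j) (g + dn j h)
      - (- 1) ^ (m - j) / of_nat (Suc (m - j)) *
           (xt (Suc (m - j)) g * jt j (dn (Suc (m - j)) g) h + xt (Suc (m - j)) h * jt j g (dn (Suc (m - j)) h))" for j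
  have L_sum: "(\<Sum>j\<le>m. L j) = 0"
    unfolding L_def sum_subtractf log_identity by simp
  have "of_nat (m choose j) * (ecirc 1 (fx [False] (m - j)) (fr j) [g, h] - ecirc 2 (fr j) (fx [False] (m - j)) [g, h])
      = (if j = 0 then fact m * L 0 else 0) - fact m * L j" if j: "j \<le> m" for j
  proof (cases "j = 0")
    case False
    have "ecirc 1 (fx [False] (m - j)) (fr j) [g, h] - ecirc 2 (fr j) (fx [False] (m - j)) [g, h]
       = - (fact j * fact (m - j)) * L j"
      unfolding ecirc_fx_F ecirc_fr1[OF False] EV_fr[OF False] EV_fx_F L_def
      by (simp add: algebra_simps del: of_nat_Suc)
    then show ?thesis using False fact_choose[OF j, where 'k = 'k] by (simp flip: mult.assoc)
  qed simp
  then have "(\<Sum>j\<le>m. of_nat (m choose j) *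
      (ecirc 1 (fx [False] (m - j)) (fr j) [g, h] - ecirc 2 (fr j) (fx [False] (m - j)) [g, h]))
     = (\<Sum>j\<le>m. (if j = 0 then fact m * L 0 else 0) - fact m * L j)"
    by (intro sum.cong) auto
  also have "\<dots> = fact m * L 0"
    by (simp add: sum_subtractf sum_distrib_left[symmetric] L_sum)
  finally have S: "(\<Sum>j\<le>m. of_nat (m choose j) *
      (ecirc 1 (fx [False] (m - j)) (fr j) [g, h] - ecirc 2 (fr j) (fx [False] (m - j)) [g, h])) = fact m * L 0" .
  have J: "(- 1) ^ m / of_nat (Suc m) * (xt (Suc m) a * jt 0 (dn (Suc m) a) b) = lt m a * ev [] b"
     "(- 1) ^ m / of_nat (Suc m) * (xt (Suc m) a * jt 0 b (dn (Suc m) a)) = ev [] b * lt m a" for a b :: "'k \<times> nat"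
    by (cases "snd a" "Suc m" rule: linorder_cases;
        simp add: xt_def jt_def dn_def lt_def ev_Nil binomial_eq_0 del: of_nat_Suc binomial_Suc_Suc)+
  have L0: "L 0 = lt m (g + h) - (lt m g * ev [] h + ev [] g * lt m h)"
    unfolding L_def diff_zero distrib_left J by (simp add: yt_def xt_def dn_def)
  have "V.EV (hdiff (fx [False] m)) [g, h] = fact m * (lt m g * ev [] h + ev [] g * lt m h - lt m (g + h))"
    by (subst EV_hdiff_hom[OF hom_len_fx])
      (simp_all add: bard_def merge_def EV_fx_F sg_def algebra_simps)
  then show ?thesis unfolding S L0 by (simp add: algebra_simps)
qed

text \<open>Since y has no higher orders, only j = m remains: the commutator of the coproduct of y
  with the m-th coefficient of the twist. It has weight -2 m because [y, x^m] = -2 m x^m.\<close>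

lemma rel_xr_T:
  "V.EV (hdiff (fx [True] m)) [g, h] + (\<Sum>j\<le>m. of_nat (m choose j) *
      (ecirc 1 (fx [True] (m - j)) (fr j) [g, h] - ecirc 2 (fr j) (fx [True] (m - j)) [g, h]))
    = - 2 * of_nat m * (V.EV (fr m) [g, h] :: 'k::field_char_0)"
proof -
  have fx0: "fx [True] k = (if k = 0 then bas [[True]] else (\<lambda>_. 0 :: 'k))" for k
    by (simp add: fx_def)
  have "of_nat (m choose j) * (ecirc 1 (fx [True] (m - j)) (fr j) [g, h] - ecirc 2 (fr j) (fx [True] (m - j)) [g, h])
     = (if j = m then ecirc 1 (bas [[True]]) (fr m) [g, h] - ecirc 2 (fr m) (bas [[True]]) [g, h] else 0 :: 'k)"
    if "j \<le> m" for j using that by (auto simp: fx0)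
  then have "(\<Sum>j\<le>m. of_nat (m choose j) * (ecirc 1 (fx [True] (m - j)) (fr j) [g, h] - ecirc 2 (fr j) (fx [True] (m - j)) [g, h]))
     = (\<Sum>j\<le>m. if j = m then ecirc 1 (bas [[True]]) (fr m) [g, h] - ecirc 2 (fr m) (bas [[True]]) [g, h] else 0 :: 'k)"
    by (intro sum.cong) auto
  then have S: "(\<Sum>j\<le>m. of_nat (m choose j) * (ecirc 1 (fx [True] (m - j)) (fr j) [g, h] - ecirc 2 (fr j) (fx [True] (m - j)) [g, h]))
     = ecirc 1 (bas [[True]]) (fr m) [g, h] - (ecirc 2 (fr m) (bas [[True]]) [g, h] :: 'k)" by simp
  show ?thesis
  proof (cases "m = 0")
    case True
    have "V.EV (hdiff (bas [[True]] :: 'k tens)) [g, h] = 0"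
      by (subst EV_hdiff_hom[of 1])
        (simp_all add: bard_def merge_def sg_def ev_letter_True V.e_Nil_add algebra_simps)
    then show ?thesis unfolding S using True by (simp add: fx0)
  next
    case False
    have "ecirc 1 (bas [[True]]) (fr m) [g, h] - ecirc 2 (fr m) (bas [[True]]) [g, h] = - 2 * of_nat m * (V.EV (fr m) [g, h] :: 'k)"
      unfolding ecirc_fr1[OF False] ecirc_bas rcirc_letters rmul_letter_True EV_fr[OF False] V.EV_bas
      by (cases "snd h" m rule: linorder_cases)
        (auto simp: ev_letter_True ev_Nil jt_def xt_def yt_def dn_def binomial_eq_0 algebra_simps)
    then show ?thesis unfolding S using False by (simp add: fx0)
  qed
qed

lemma rel_xr:
  assumes x: "x \<in> {[], [False], [True]}"
  shows "V.EV (hdiff (fx x m)) gs + 1 / 2 * (\<Sum>j\<le>m. of_nat (m choose j) *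
      (V.EV (r2D (fr j) (fx x (m - j))) gs + V.EV (r2D (fx x (m - j)) (fr j)) gs))
    = (if x = [True] then - 2 * of_nat m * V.EV (fr m) gs else (0 :: 'k::field_char_0))"
proof (cases "x = []")
  case True
  have "V.EV (hdiff (fx x m)) gs = 0"
  proof (cases "length gs = 1")
    case True
    then obtain g where "gs = [g]" by (auto simp: length_Suc_conv)
    then show ?thesis using \<open>x = []\<close>
      by (subst EV_hdiff_hom[OF hom_len_fx]) (simp_all add: fx_def bard_def sg_def)
  qed (simp add: EV_hdiff_len[OF hom_len_fx] \<open>x = []\<close>)
  moreover have "V.EV (r2D (fr j) (fx x k)) gs = 0 \<and> V.EV (r2D (fx x k) (fr j)) gs = 0" for j k
  proof -
    have *: "hom_len 0 (fx x k :: 'k tens)" using hom_len_fx[of x k] True by simp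
    show ?thesis
    proof (cases "length gs = 1 \<and> k = 0 \<and> j \<noteq> 0")
      case True
      then obtain g where g: "gs = [g]" by (auto simp: length_Suc_conv)
      \<comment> \<open>Inserting a scalar from degree -1 applies the counit to one leg of the
        twist. Both results vanish: binom(0, j) = 0 on one leg, and x^j has counit 0 on the
        other.\<close>
      have "(0 :: 'k) gchoose j = 0"
        using True binomial_gbinomial[of 0 j, where 'a = 'k] by (simp add: binomial_eq_0)
      then have "rcirc 2 (V.EV (fr j :: 'k tens)) [] [g] = 0"
        using True by (simp add: rcirc_letters EV_fr jt_def)
      then have "ecirc 2 (fr j) (fx x k) gs = 0" using True \<open>x = []\<close> by (simp add: fx_def ecirc_bas g)
      then show ?thesis by (simp add: EV_r2D[OF hom_len_fr *] EV_r2D[OF * hom_len_fr])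
    next
      case False
      then consider "Suc (length gs) \<noteq> 2" | "k \<noteq> 0" | "j = 0" by auto
      then show ?thesis
      proof cases
        case 1
        then show ?thesis by (simp add: EV_r2D_len[OF hom_len_fr *] EV_r2D_len[OF * hom_len_fr])
      next
        case 2
        then have "fx x k = (\<lambda>_. 0 :: 'k)" using \<open>x = []\<close> by (simp add: fx_def)
        then show ?thesis by (simp add: EV_r2D[OF hom_len_fr *] EV_r2D[OF * hom_len_fr])
      next
        case 3
        then show ?thesis by (simp add: EV_r2D[OF hom_len_fr *] EV_r2D[OF * hom_len_fr])
      qed
    qed
  qed
  ultimately show ?thesis using True by simp
next
  case False
  then have len: "length x = Suc 0" using x by auto
  then have hom: "hom_len (Suc 0) (fx x k :: 'k tens)" for k using hom_len_fx[of x k] by simp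
  show ?thesis
  proof (cases "length gs = 2")
    case True
    then obtain g h where gs: "gs = [g, h]" by (auto simp: length_Suc_conv numeral_2_eq_2)
    have "1 / 2 * (\<Sum>j\<le>m. of_nat (m choose j) * (V.EV (r2D (fr j) (fx x (m - j))) gs + V.EV (r2D (fx x (m - j)) (fr j)) gs))
       = (\<Sum>j\<le>m. of_nat (m choose j) * (ecirc 1 (fx x (m - j)) (fr j) gs - (ecirc 2 (fr j) (fx x (m - j)) gs :: 'k)))"
      unfolding sum_distrib_left by (intro sum.cong refl) (simp add: EV_r2D_mixed[OF hom] algebra_simps)
    then show ?thesis unfolding gs using False x rel_xr_F[of m g h] rel_xr_T[of m g h] by auto
  next
    case False
    then have "V.EV (fr m) gs = (0 :: 'k)"
      using hom_len_fr[of m] by (intro V.EV_hom[of _ 2]) (auto simp: hom_len_def)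
    then show ?thesis using False
      by (simp add: EV_r2D_len[OF hom_len_fr hom] EV_r2D_len[OF hom hom_len_fr] EV_hdiff_len[OF hom])
  qed
qed

text \<open>Evaluation at 0 is the counit, and these values lie in the augmentation ideal.\<close>

lemma EV_fx_0: "y \<noteq> [] \<Longrightarrow> y \<in> {[], [False], [True]} \<Longrightarrow> V.EV (fx y j) [0] = (0 :: 'k::field_char_0)"
proof -
  assume "y \<noteq> []" "y \<in> {[], [False], [True]}"
  then consider "y = [False]" | "y = [True]" by auto
  then show ?thesis
  proof cases
    case 1
    then show ?thesis by (simp add: EV_fx_F lt_def)
  next
    case 2
    then show ?thesis by (simp add: fx_def ev_letter_True)
  qed
qed

lemma EV_r2D_Nil:
  assumes y: "y \<in> {[], [False], [True]}"
  shows "V.EV (r2D (fx [] i) (fx y j)) gs = (0 :: 'k::field_char_0)" "V.EV (r2D (fx y j) (fx [] i)) gs = (0 :: 'k)"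
proof -
  have h: "hom_len 0 (fx [] i :: 'k tens)" "hom_len (length y) (fx y j :: 'k tens)"
    using hom_len_fx[of "[]" i] hom_len_fx[of y j] by simp_all
  have "ecirc (length y) (fx y j) (fx [] i) gs = (0 :: 'k)"
  proof (cases "y = [] \<or> gs \<noteq> [] \<or> i \<noteq> 0")
    case True
    then consider "y = []" | "Suc (length gs) \<noteq> length y + 0" | "i \<noteq> 0" using y by auto
    then show ?thesis
    proof cases
      case 2
      then show ?thesis by (rule ecirc_len[OF h(1)])
    next
      case 3
      then have "fx [] i = (\<lambda>_. 0 :: 'k)" by (simp add: fx_def)
      then show ?thesis by simp
    qed simp
  next
    case False
    then have "length y = 1" using y by auto
    then show ?thesis using False EV_fx_0[of y j, where 'k = 'k] y
      by (simp add: fx_def[of "[]"] ecirc_bas rcirc_letters[simplified])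
  qed
  then show "V.EV (r2D (fx [] i) (fx y j)) gs = (0 :: 'k)" "V.EV (r2D (fx y j) (fx [] i)) gs = (0 :: 'k)"
    by (simp_all add: EV_r2D[OF h] EV_r2D[OF h(2) h(1)])
qed

lemma ecirc_x_F: "ecirc 1 \<Phi> (fx [False] m) [g] = (fact m * (- 1) ^ m / of_nat (Suc m)) *
   (xt (Suc m) g * V.EV \<Phi> [dn (Suc m) g])"
  unfolding fx_def by (subst if_P[OF refl], subst ecirc_smul_bas)
    (simp only: rcirc_letters rmul_words rsh_words)

text \<open>Powers of x commute.\<close>

lemma ecirc_F_F:
  fixes g :: "'k::field_char_0 \<times> nat"
  shows "ecirc 1 (fx [False] i) (fx [False] j) [g] = ecirc 1 (fx [False] j) (fx [False] i) [g]"
proof -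
  have "ecirc 1 (fx [False] i) (fx [False] j) [g] = (fact j * (- 1) ^ j / of_nat (Suc j)) *
      (fact i * (- 1) ^ i / of_nat (Suc i)) * ev (replicate (Suc i + Suc j) False) g" for i j
  proof -
    have "V.EV (fx [False] i) [h] = (fact i * (- 1) ^ i / of_nat (Suc i)) * ev (replicate (Suc i) False) h" for h :: "'k \<times> nat"
      unfolding fx_def by (subst if_P[OF refl], subst V.EV_smul) simp_all
    then show ?thesis
      unfolding ecirc_x_F replicate_add ev_append rmul_words rsh_words by (simp only: mult_ac)
  qed
  then show ?thesis by (simp only: mult_ac add_ac)
qed

text \<open>This is [y, x^(m+1)] = -2 (m+1) x^(m+1).\<close>

lemma ecirc_commutator_T_F:
  "ecirc 1 (bas [[True]]) (fx [False] m) [g] - ecirc 1 (fx [False] m) (bas [[True]]) [g]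
     = - 2 * of_nat (Suc m) * V.EV (fx [False] m) [g]"
proof -
  have "ecirc 1 (bas [[True]]) (fx [False] m) [g] = fst g * V.EV (fx [False] m) [g]"
    unfolding ecirc_x_F EV_fx_F
    by (cases "snd g" "Suc m" rule: linorder_cases)
      (simp_all add: ev_letter_True ev_Nil lt_def xt_def dn_def binomial_eq_0 del: of_nat_Suc binomial_Suc_Suc)
  moreover have "ecirc 1 (fx [False] m) (bas [[True]]) [g] = (fst g + 2 * of_nat (snd g)) * V.EV (fx [False] m) [g]"
    unfolding ecirc_bas rcirc_letters rmul_letter_True ..
  moreover have "of_nat (snd g) * V.EV (fx [False] m) [g] = of_nat (Suc m) * V.EV (fx [False] m) [g]"
    by (simp add: EV_fx_F lt_def del: of_nat_Suc)
  ultimately show ?thesis by (simp add: algebra_simps del: of_nat_Suc)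
qed

text \<open>The structure constants of \<open>q2E\<close>: on basis monomials the shifted bracket is
  a multiple of one monomial, namely \<open>qm x y\<close>.\<close>

definition qk :: "bool list \<Rightarrow> bool list \<Rightarrow> 'k::comm_ring_1" where
  "qk x y = (if x = [False] \<and> y = [True] then 2 else if x = [True] \<and> y = [False] then - 2
     else if (x = [True] \<and> y = [False, True]) \<or> (x = [False, True] \<and> y = [True]) then - 2 else 0)"

text \<open>The morphism vanishes on two further arguments, so no differential occurs. For e1, e2
  the left side is a commutator of x^(m+1) with y, of weight 2 (m+1). On the right [e1, e2] gives 2,
  and each of the m brackets of e2 with r gives another 2.\<close>

lemma rel_xy:
  assumes x: "x \<in> {[], [False], [True]}" and y: "y \<in> {[], [False], [True]}"
  defines "\<epsilon> \<equiv> sg (sdeg x * sdeg y) :: 'k::field_char_0"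
  shows "1 / 2 * (\<Sum>j\<le>m. of_nat (m choose j) * (V.EV (r2D (fx x j) (fx y (m - j))) gs
       + \<epsilon> * V.EV (r2D (fx y (m - j)) (fx x j)) gs))
    = qk x y * V.EV (fx [False] m) gs + of_nat m * (qk x [False, True] * V.EV (fx y m) gs
       + \<epsilon> * qk y [False, True] * V.EV (fx x m) gs)"
proof -
  have T0: "fx [True] k = (if k = 0 then bas [[True]] else (\<lambda>_. 0 :: 'k))" and N0: "of_nat m * V.EV (fx [] m) gs = (0 :: 'k)" for k
    by (auto simp: fx_def)
  show ?thesis
  proof (cases "x = [] \<or> y = []")
    case True
    then have "V.EV (r2D (fx x j) (fx y (m - j))) gs = (0 :: 'k)" "V.EV (r2D (fx y (m - j)) (fx x j)) gs = (0 :: 'k)" for j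
      using EV_r2D_Nil x y by blast+
    moreover have "qk x y = (0 :: 'k)" "of_nat m * (qk x [False, True] * V.EV (fx y m) gs) = (0 :: 'k)"
      "of_nat m * (\<epsilon> * qk y [False, True] * V.EV (fx x m) gs) = 0"
      using True x y N0 by (auto simp: qk_def)
    ultimately show ?thesis by (simp add: distrib_left del: mult_eq_0_iff)
  next
    case False
    have \<epsilon>: "\<epsilon> = - 1" using False x y by (auto simp: \<epsilon>_def sdeg_def sg_def)
    have hx: "hom_len 1 (fx x k :: 'k tens)" and hy: "hom_len 1 (fx y k :: 'k tens)" for k
      using hom_len_fx[of x k] hom_len_fx[of y k] False x y by auto
    show ?thesis
    proof (cases "length gs = 1")
      case len: False
      have "V.EV (fx z m) gs = (0 :: 'k)" if "hom_len 1 (fx z m :: 'k tens)" for z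
        using that len by (intro V.EV_hom[of _ 1]) (auto simp: hom_len_def)
      moreover have "hom_len 1 (fx [False] m :: 'k tens)" using hom_len_fx[of "[False]" m] by simp
      ultimately show ?thesis
        using hx hy len by (simp add: EV_r2D_len[OF hx hy] EV_r2D_len[OF hy hx])
    next
      case True
      then obtain g where gs: "gs = [g]" by (auto simp: length_Suc_conv)
      define B where "B j = ecirc 1 (fx x j) (fx y (m - j)) gs - ecirc 1 (fx y (m - j)) (fx x j) gs" for j
      have "of_nat (m choose j) * (V.EV (r2D (fx x j) (fx y (m - j))) gs + \<epsilon> * V.EV (r2D (fx y (m - j)) (fx x j)) gs)
          = 2 * (of_nat (m choose j) * B j)" for j
        by (simp add: EV_r2D[OF hx hy] EV_r2D[OF hy hx] B_def \<epsilon> algebra_simps)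
      then have S: "1 / 2 * (\<Sum>j\<le>m. of_nat (m choose j) * (V.EV (r2D (fx x j) (fx y (m - j))) gs
           + \<epsilon> * V.EV (r2D (fx y (m - j)) (fx x j)) gs)) = (\<Sum>j\<le>m. of_nat (m choose j) * B j)"
        by (simp only: sum_distrib_left[symmetric]) simp
      consider "x = [False]" "y = [False]" | "x = [True]" "y = [True]" | "x = [False]" "y = [True]" | "x = [True]" "y = [False]"
        using False x y by auto
      then show ?thesis
      proof cases
        case 1
        then have "B j = 0" for j by (simp only: B_def gs ecirc_F_F) simp
        then show ?thesis unfolding S using 1 by (simp add: qk_def)
      next
        case 2
        then have "B j = 0" for j unfolding B_def 2 T0 by auto
        then have "(\<Sum>j\<le>m. of_nat (m choose j) * B j) = 0" by simp
        then show ?thesis unfolding S unfolding 2 \<epsilon> by (simp add: qk_def)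
      next
        case 3
        have "of_nat (m choose j) * B j = (if j = m then 2 * of_nat (Suc m) * V.EV (fx [False] m) gs else 0)" if "j \<le> m" for j
          using that ecirc_commutator_T_F[of m g] unfolding B_def 3 gs T0
          by (auto simp: algebra_simps)
        then have "(\<Sum>j\<le>m. of_nat (m choose j) * B j) = (\<Sum>j\<le>m. if j = m then 2 * of_nat (Suc m) * V.EV (fx [False] m) gs else 0)"
          by (intro sum.cong) auto
        then show ?thesis unfolding S using 3 by (simp add: qk_def \<epsilon> algebra_simps)
      next
        case 4
        have "of_nat (m choose j) * B j = (if j = 0 then - 2 * of_nat (Suc m) * V.EV (fx [False] m) gs else 0)" if "j \<le> m" for j
          using that ecirc_commutator_T_F[of m g] unfolding B_def 4 gs T0
          by (auto simp: algebra_simps)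
        then have "(\<Sum>j\<le>m. of_nat (m choose j) * B j) = (\<Sum>j\<le>m. if j = 0 then - 2 * of_nat (Suc m) * V.EV (fx [False] m) gs else 0)"
          by (intro sum.cong) auto
        then show ?thesis unfolding S using 4 by (simp add: qk_def \<epsilon> algebra_simps)
      qed
    qed
  qed
qed

section \<open>The structure maps of the exterior algebra\<close>

lemma ninv_sorted: "sorted zs \<Longrightarrow> ninv zs = 0"
proof -
  assume "sorted zs"
  then have "\<not> zs ! j < zs ! i" if "i < j" "j < length zs" for i j
    using sorted_nth_mono[of zs i j] that by (simp only: not_less less_imp_le)
  then have "{(i, j). i < j \<and> j < length zs \<and> zs ! j < zs ! i} = {}" by blast
  then show ?thesis by (simp only: ninv_def card.empty)
qed

lemma wedge_smul_bas: "wedge (\<lambda>z. c * bas a z) (bas b) = (\<lambda>z. c * wedge_b a b z)"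
  unfolding wedge_def lext2_eq by (rule ext, subst lext_smul) simp_all

lemma wedge_uminus_bas: "wedge (\<lambda>z. - (c * bas a z)) (bas b) = (\<lambda>z. - (c * wedge_b a b z))"
  using wedge_smul_bas[of "- c" a b] by simp

lemma wedge_zero: "wedge (\<lambda>_. 0) b = (\<lambda>_. 0)"
  by (simp add: wedge_def fun_eq_iff)

lemma wedge_b_F: "wedge_b [False] [] = bas [False]" "wedge_b [False] [True] = bas [False, True]"
  "wedge_b [False, True] [] = bas [False, True]"
  "wedge_b [False] [False] = (\<lambda>_. 0)" "wedge_b [False, True] [False] = (\<lambda>_. 0)" "wedge_b [False, True] [True] = (\<lambda>_. 0)"
  by (simp_all add: wedge_b_def ninv_sorted fun_eq_iff)

text \<open>Where \<open>qk\<close> is 0, the monomial is only a placeholder.\<close>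

definition qm :: "bool list \<Rightarrow> bool list \<Rightarrow> bool list" where
  "qm x y = (if x = [False, True] \<or> y = [False, True] then [False, True] else [False])"

lemma wedge_lbr:
  "wedge (lbr a c) (bas b) = (\<lambda>z. (if \<not> a \<and> c then 2 else if a \<and> \<not> c then - 2 else 0) * wedge_b [False] b z :: 'k::comm_ring_1)"
proof -
  have "lbr a c = (\<lambda>z. (if \<not> a \<and> c then 2 else if a \<and> \<not> c then - 2 else 0) * bas [False] z :: 'k)" for a c
    by (auto simp: lbr_def fun_eq_iff)
  then show ?thesis by (simp only: wedge_smul_bas)
qed

lemma q2E_eq:
  assumes "x \<in> {[], [False], [True], [False, True]}" "y \<in> {[], [False], [True], [False, True]}"
  shows "q2E x y = (\<lambda>z. qk x y * bas (qm x y) z :: 'k::comm_ring_1)"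
  using assms
  by (auto simp: q2E_def sch_b_def remove_nth_def wedge_lbr wedge_b_F wedge_smul_bas wedge_uminus_bas wedge_zero
      qk_def qm_def fun_eq_iff numeral_2_eq_2 sg_def lessThan_Suc)

section \<open>Sums over subsets\<close>

lemma sum_Pow_card:
  assumes "finite S"
  shows "(\<Sum>A\<in>Pow S. F (card A)) = (\<Sum>j\<le>card S. of_nat (card S choose j) * (F j :: 'a::comm_semiring_1))"
proof -
  have "(\<Sum>A\<in>Pow S. F (card A)) = (\<Sum>j\<le>card S. \<Sum>A | A \<in> Pow S \<and> card A = j. F (card A))"
    using assms by (intro sum.group[symmetric]) (auto intro: card_mono)
  also have "\<dots> = (\<Sum>j\<le>card S. of_nat (card S choose j) * F j)"
  proof (intro sum.cong refl)
    fix j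
    have "(\<Sum>A | A \<in> Pow S \<and> card A = j. F (card A)) = (\<Sum>A | A \<subseteq> S \<and> card A = j. F j)"
      by (intro sum.cong) auto
    then show "(\<Sum>A | A \<in> Pow S \<and> card A = j. F (card A)) = of_nat (card S choose j) * F j"
      using assms by (simp add: n_subsets)
  qed
  finally show ?thesis .
qed

lemma sum_Pow_insert:
  assumes "finite S" "p \<notin> S"
  shows "(\<Sum>A\<in>Pow (insert p S). T A) = (\<Sum>A\<in>Pow S. T A) + (\<Sum>A\<in>Pow S. T (insert p A) :: 'a::comm_monoid_add)"
proof -
  have "inj_on (insert p) (Pow S)" using assms(2) by (auto simp: inj_on_def)
  moreover have "Pow S \<inter> insert p ` Pow S = {}" using assms(2) by auto
  ultimately show ?thesis
    unfolding Pow_insert using assms(1) by (simp add: sum.union_disjoint sum.reindex)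
qed

lemma sum_pairs_insert:
  assumes "finite S" "p \<notin> S"
  shows "(\<Sum>A | A \<subseteq> insert p S \<and> card A = 2. W A) = (\<Sum>A | A \<subseteq> S \<and> card A = 2. W A) + (\<Sum>i\<in>S. W {p, i} :: 'a::comm_monoid_add)"
proof -
  have "{A. A \<subseteq> insert p S \<and> card A = 2} = {A. A \<subseteq> S \<and> card A = 2} \<union> (\<lambda>i. {p, i}) ` S" (is "?L = ?R")
  proof
    show "?L \<subseteq> ?R"
    proof
      fix A assume A: "A \<in> ?L"
      show "A \<in> ?R"
      proof (cases "p \<in> A")
        case True
        then obtain i where "A = {p, i}" "i \<noteq> p" using A by (auto simp: card_2_iff)
        then show ?thesis using A by auto
      qed (use A in auto)
    qed
    show "?R \<subseteq> ?L" using assms(2) by (auto simp: card_insert_if)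
  qed
  moreover have "inj_on (\<lambda>i. {p, i}) S" using assms(2) by (auto simp: inj_on_def doubleton_eq_iff)
  moreover have "{A. A \<subseteq> S \<and> card A = 2} \<inter> (\<lambda>i. {p, i}) ` S = {}" using assms(2) by auto
  moreover have "finite {A. A \<subseteq> S \<and> card A = 2}" by (rule finite_subset[of _ "Pow S"]) (use assms(1) in auto)
  ultimately show ?thesis
    using assms(1) by (simp add: sum.union_disjoint sum.reindex)
qed

section \<open>The morphism\<close>

abbreviation nonr :: "bool list \<Rightarrow> bool" where
  "nonr m \<equiv> m \<noteq> [False, True]"

text \<open>Here xs holds the arguments other than r, and n counts all arguments; one further
  argument therefore leaves n - 1 copies of r.\<close>

definition Fval :: "bool list list \<Rightarrow> nat \<Rightarrow> 'k::field_char_0 tens" where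
  "Fval xs n = (case xs of [] \<Rightarrow> fr n | [x] \<Rightarrow> fx x (n - 1) | _ \<Rightarrow> (\<lambda>_. 0))"

definition Fmor :: "bool list list \<Rightarrow> 'k::field_char_0 tens" where
  "Fmor ms = Fval (filter nonr ms) (length ms)"

lemma Fval_simps [simp]: "Fval [] n = fr n" "Fval [x] n = fx x (n - 1)" "Fval (x # y # xs) n = (\<lambda>_. 0)"
  by (simp_all add: Fval_def)

lemma Fval_zero: "2 \<le> length xs \<Longrightarrow> Fval xs n = (\<lambda>_. 0)"
  by (cases xs; cases "tl xs") auto

lemma fin_Fmor [simp]: "finite (supp (Fmor ms :: 'k::field_char_0 tens))"
  unfolding Fmor_def Fval_def by (auto split: list.splits)

lemma filter_nths: "filter P (nths xs A) = nths xs {i \<in> A. P (xs ! i)}"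
  by (induction xs arbitrary: A) (auto simp: nths_Cons)

lemma nths_sing: "p < length xs \<Longrightarrow> nths xs {p} = [xs ! p]"
proof (induction xs arbitrary: p)
  case (Cons x xs)
  show ?case
  proof (cases p)
    case 0
    then show ?thesis by (simp add: nths_Cons)
  next
    case (Suc q)
    then have "{j. Suc j \<in> {p}} = {q}" by auto
    then show ?thesis using Cons Suc by (simp add: nths_Cons)
  qed
qed simp

lemma nths_pair: "i < j \<Longrightarrow> j < length xs \<Longrightarrow> nths xs {i, j} = [xs ! i, xs ! j]"
proof (induction xs arbitrary: i j)
  case (Cons x xs)
  obtain j' where j: "j = Suc j'" using Cons.prems by (cases j) auto
  show ?case
  proof (cases i)
    case 0
    then have "{k. Suc k \<in> {i, j}} = {j'}" using j by auto
    then show ?thesis using 0 j Cons.prems by (simp add: nths_Cons nths_sing)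
  next
    case (Suc i')
    then have "{k. Suc k \<in> {i, j}} = {i', j'}" using j by auto
    then show ?thesis using Suc j Cons by (simp add: nths_Cons)
  qed
qed simp

lemma length_nths_subset: "A \<subseteq> {..<length xs} \<Longrightarrow> length (nths xs A) = card A"
  unfolding length_nths by (rule arg_cong[of _ _ card]) auto

text \<open>Each r adds 1 to the degree and 1 to the number of arguments, so copies of r leave the
  degree of the value unchanged.\<close>

lemma sum_list_degrees:
  "(\<forall>m\<in>set ms. Emon m) \<Longrightarrow> (\<Sum>m\<leftarrow>ms. int (length m) - 1)
     = (\<Sum>m\<leftarrow>filter nonr ms. int (length m) - 1) + int (length ms) - int (length (filter nonr ms))"
  by (induction ms) auto

lemma Dhom_hom_len: "hom_len n \<Phi> \<Longrightarrow> k + 1 = int n \<Longrightarrow> Dhom k \<Phi>"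
  by (auto simp: Dhom_def hom_len_def)

lemma Dhom_Fmor:
  assumes "\<forall>m\<in>set ms. Emon m" "ms \<noteq> []"
  shows "Dhom ((\<Sum>m\<leftarrow>ms. int (length m) - 1) + 1 - int (length ms)) (Fmor ms :: 'k::field_char_0 tens)"
proof -
  consider "filter nonr ms = []" | x where "filter nonr ms = [x]" | "2 \<le> length (filter nonr ms)"
    by (cases "filter nonr ms"; cases "tl (filter nonr ms)") auto
  then show ?thesis
  proof cases
    case 1
    then show ?thesis using sum_list_degrees[OF assms(1)]
      by (intro Dhom_hom_len[of 2]) (simp_all add: Fmor_def hom_len_fr)
  next
    case 2
    then show ?thesis using sum_list_degrees[OF assms(1)]
      by (intro Dhom_hom_len[of "length x"]) (simp_all add: Fmor_def hom_len_fx)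
  next
    case 3
    then show ?thesis by (simp add: Fmor_def Fval_zero Dhom_def)
  qed
qed

lemma Fmor_mset:
  assumes "mset ms = mset ms'"
  shows "Fmor ms = Fmor ms'"
proof -
  have m: "mset (filter nonr ms) = mset (filter nonr ms')" using assms by (simp add: mset_filter)
  have len: "length ms = length ms'" using assms by (rule mset_eq_length)
  have len': "length (filter nonr ms) = length (filter nonr ms')" using m by (rule mset_eq_length)
  consider "filter nonr ms = []" | x where "filter nonr ms = [x]" | "2 \<le> length (filter nonr ms)"
    by (cases "filter nonr ms"; cases "tl (filter nonr ms)") auto
  then show ?thesis
  proof cases
    case 1
    then have "filter nonr ms' = []" using len' by simp
    then show ?thesis using 1 len unfolding Fmor_def by simp
  next
    case 2
    then have "mset (filter nonr ms') = {#x#}" using m by simp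
    then have "filter nonr ms' = [x]" by (simp only: mset_single_iff)
    then show ?thesis using 2 len unfolding Fmor_def by simp
  next
    case 3
    then show ?thesis using len' by (simp add: Fmor_def Fval_zero)
  qed
qed

lemma sdeg_r [simp]: "sdeg [False, True] = 0"
  by (simp add: sdeg_def)

text \<open>If one neighbour is r, its shifted degree 0 makes the sign trivial. If neither is r,
  there are two further arguments and both sides are 0.\<close>

lemma Fmor_swap:
  assumes "Suc i < length ms"
  shows "Fmor ms = (\<lambda>z. sg (sdeg (ms ! i) * sdeg (ms ! Suc i)) * Fmor (ms[i := ms ! Suc i, Suc i := ms ! i]) z :: 'k::field_char_0)"
proof -
  have "Fmor (ms[i := ms ! Suc i, Suc i := ms ! i]) = (Fmor ms :: 'k tens)"
    using assms by (intro Fmor_mset mset_swap) auto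
  moreover have "Fmor ms = (\<lambda>_. 0 :: 'k)" if "nonr (ms ! i)" "nonr (ms ! Suc i)"
  proof -
    have "card {i, Suc i} \<le> card {j. j < length ms \<and> nonr (ms ! j)}"
      using assms that by (intro card_mono) auto
    then have "2 \<le> length (filter nonr ms)" by (simp add: length_filter_conv_card)
    then show ?thesis by (simp add: Fmor_def Fval_zero)
  qed
  ultimately show ?thesis
    by (cases "nonr (ms ! i) \<and> nonr (ms ! Suc i)") (auto simp: fun_eq_iff)
qed

section \<open>The L-infinity relations, by the number of arguments other than r\<close>

locale monomials =
  fixes ms :: "bool list list" and n X
  assumes Emon: "\<forall>m\<in>set ms. Emon m" and n: "n = length ms" and X: "X = {i. i < n \<and> nonr (ms ! i)}"
begin

lemma finX: "finite X" "X \<subseteq> {..<n}"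
  by (auto simp: X)

lemma mon: "i < n \<Longrightarrow> ms ! i \<in> {[], [False], [True], [False, True]}"
  using Emon EmonD[of "ms ! i"] n by auto

lemma monX: "p \<in> X \<Longrightarrow> ms ! p \<in> {[], [False], [True]}"
  using mon[of p] by (auto simp: X)

lemma filter_part: "A \<subseteq> {..<n} \<Longrightarrow> filter nonr (nths ms A) = nths ms (A \<inter> X)"
  unfolding filter_nths by (rule arg_cong[of _ _ "nths ms"]) (auto simp: X)

lemma Fmor_part: "A \<subseteq> {..<n} \<Longrightarrow> Fmor (nths ms A) = Fval (nths ms (A \<inter> X)) (card A)"
  by (simp add: Fmor_def filter_part length_nths_subset n)

lemma Fmor_r_part: "A \<subseteq> {..<n} \<Longrightarrow> Fmor ([False, True] # nths ms A) = Fval (nths ms (A \<inter> X)) (Suc (card A))"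
  by (simp add: Fmor_def filter_part length_nths_subset n)

lemma Fmor_e_part: "A \<subseteq> {..<n} \<Longrightarrow> Fmor ([False] # nths ms A) = Fval ([False] # nths ms (A \<inter> X)) (Suc (card A))"
  by (simp add: Fmor_def filter_part length_nths_subset n)

lemma nths_X_len: "length (nths ms (A \<inter> X)) = card (A \<inter> X)"
  using finX(2) by (intro length_nths_subset) (auto simp: n)

text \<open>Moving an r costs no sign, its shifted degree being 0, so only the positions in X enter
  the Koszul sign.\<close>

lemma koz_X:
  assumes "A \<subseteq> {..<n}"
  shows "koz ms A = sg (\<Sum>a\<in>A \<inter> X. \<Sum>b\<in>X - A. if b < a then sdeg (ms ! a) * sdeg (ms ! b) else 0)"
proof -
  have fin: "finite A" using assms finite_subset by blast
  have r: "sdeg (ms ! i) = 0" if "i < n" "i \<notin> X" for i using that by (auto simp: X)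
  have "(\<Sum>a\<in>A. \<Sum>b\<in>{..<length ms} - A. if b < a then sdeg (ms ! a) * sdeg (ms ! b) else 0)
      = (\<Sum>a\<in>A \<inter> X. \<Sum>b\<in>{..<length ms} - A. if b < a then sdeg (ms ! a) * sdeg (ms ! b) else 0)"
  proof (intro sum.mono_neutral_right fin ballI)
    fix i assume "i \<in> A - A \<inter> X"
    then have "sdeg (ms ! i) = 0" using r[of i] assms by auto
    then show "(\<Sum>b\<in>{..<length ms} - A. if b < i then sdeg (ms ! i) * sdeg (ms ! b) else 0) = 0"
      by (simp cong: if_cong)
  qed auto
  also have "\<dots> = (\<Sum>a\<in>A \<inter> X. \<Sum>b\<in>X - A. if b < a then sdeg (ms ! a) * sdeg (ms ! b) else 0)"
    using finX r n by (intro sum.cong refl sum.mono_neutral_right) auto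
  finally show ?thesis by (simp add: koz_def)
qed

lemma koz_1: "A \<subseteq> {..<n} \<Longrightarrow> A \<inter> X = {} \<or> X \<subseteq> A \<Longrightarrow> koz ms A = 1"
  unfolding koz_X by (elim disjE) (simp_all add: Diff_eq_empty_iff[THEN iffD2])

definition Tval :: "('k \<times> nat) list \<Rightarrow> nat set \<Rightarrow> 'k::field_char_0" where
  "Tval gs A = koz ms A * V.EV (r2D (Fmor (nths ms A)) (Fmor (nths ms ({..<n} - A)))) gs"

definition Wval :: "('k \<times> nat) list \<Rightarrow> nat set \<Rightarrow> 'k::field_char_0" where
  "Wval gs A = koz ms A * (qk (nths ms A ! 0) (nths ms A ! 1) *
     V.EV (Fmor (qm (nths ms A ! 0) (nths ms A ! 1) # nths ms ({..<n} - A))) gs)"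

lemma pair_cases:
  assumes "i < n" "j < n" "i \<noteq> j"
  obtains "nths ms {i, j} ! 0 = ms ! i" "nths ms {i, j} ! 1 = ms ! j" "i < j"
  | "nths ms {i, j} ! 0 = ms ! j" "nths ms {i, j} ! 1 = ms ! i" "j < i"
  using assms nths_pair[of i j ms] nths_pair[of j i ms] that
  by (cases i j rule: linorder_cases) (auto simp: n insert_commute)

lemma Wval_rr:
  assumes "i < n" "j < n" "i \<noteq> j" "i \<notin> X" "j \<notin> X"
  shows "Wval gs {i, j} = 0"
  by (rule pair_cases[OF assms(1-3)]) (use assms in \<open>auto simp: Wval_def X qk_def\<close>)

text \<open>The bracket of a monomial with r is a multiple of r: the further argument p disappears
  and the number of copies of r stays the same.\<close>

lemma Wval_xr:
  fixes gs :: "('k::field_char_0 \<times> nat) list"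
  assumes "p \<in> X" "j < n" "j \<notin> X"
  shows "Wval gs {p, j} = koz ms {p, j} * (qk (ms ! p) [False, True] *
    V.EV (Fval (nths ms (X - {p})) (n - 1)) gs)"
proof -
  have p: "p < n" "p \<noteq> j" using assms by (auto simp: X)
  have j: "ms ! j = [False, True]" using assms by (auto simp: X)
  have sym: "qk [False, True] x = qk x [False, True]" for x by (auto simp: qk_def)
  have "({..<n} - {p, j}) \<inter> X = X - {p}" using assms by (auto simp: X)
  moreover have "Suc (card ({..<n} - {p, j})) = n - 1" using p assms by (simp add: card_Diff_subset)
  ultimately have F: "Fmor ([False, True] # nths ms ({..<n} - {p, j})) = (Fval (nths ms (X - {p})) (n - 1) :: 'k tens)"
    by (subst Fmor_r_part) auto
  show ?thesis
    by (rule pair_cases[OF p(1) assms(2) p(2)]) (simp_all add: Wval_def j sym qm_def F)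
qed

lemma Wval_xx:
  fixes gs :: "('k::field_char_0 \<times> nat) list"
  assumes "p \<in> X" "q \<in> X" "p < q"
  shows "Wval gs {p, q} = koz ms {p, q} * (qk (ms ! p) (ms ! q) *
    V.EV (Fval ([False] # nths ms (X - {p, q})) (n - 1)) gs)"
proof -
  have p: "p < n" "q < n" "nonr (ms ! p)" "nonr (ms ! q)" using assms by (auto simp: X)
  have "({..<n} - {p, q}) \<inter> X = X - {p, q}" by (auto simp: X)
  moreover have "Suc (card ({..<n} - {p, q})) = n - 1" using p assms by (simp add: card_Diff_subset)
  ultimately have "Fmor ([False] # nths ms ({..<n} - {p, q})) = (Fval ([False] # nths ms (X - {p, q})) (n - 1) :: 'k tens)"
    by (subst Fmor_e_part) auto
  moreover have "nths ms {p, q} = [ms ! p, ms ! q]" using p assms by (intro nths_pair) (simp_all add: n)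
  ultimately show ?thesis using p by (simp add: Wval_def qm_def)
qed

text \<open>Without arguments \<open>Fmor\<close> is \<open>fr 0\<close>, which is 0. The sum over
  proper nonempty subsets may thus be taken over all subsets, where it becomes a binomial
  sum.\<close>

lemma Tval_empty: "Tval gs {} = 0" "Tval gs {..<n} = 0"
  by (simp_all add: Tval_def Fmor_def)

lemma rel_X0:
  assumes "X = {}" "n \<noteq> 0"
  shows "V.EV (hdiff (Fmor ms)) gs + 1 / 2 * (\<Sum>A\<in>Pow {..<n}. Tval gs A) = (0 :: 'k::field_char_0)"
    "(\<Sum>A | A \<subseteq> {..<n} \<and> card A = 2. Wval gs A) = (0 :: 'k)"
proof -
  have "Fmor (nths ms A) = (fr (card A) :: 'k tens)" if "A \<subseteq> {..<n}" for A
    using Fmor_part[OF that] assms by simp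
  then have "Tval gs A = (V.EV (r2D (fr (card A)) (fr (n - card A))) gs :: 'k)" if "A \<subseteq> {..<n}" for A
    using that assms koz_1[OF that, where 'a = 'k] finite_subset[OF that] by (simp add: Tval_def card_Diff_subset)
  then have "(\<Sum>A\<in>Pow {..<n}. Tval gs A) = (\<Sum>A\<in>Pow {..<n}. V.EV (r2D (fr (card A)) (fr (n - card A))) gs :: 'k)"
    by (intro sum.cong) auto
  also have "\<dots> = (\<Sum>j\<le>n. of_nat (n choose j) * V.EV (r2D (fr j) (fr (n - j))) gs)"
    using sum_Pow_card[of "{..<n}" "\<lambda>k. V.EV (r2D (fr k) (fr (n - k))) gs"] by simp
  moreover have "Fmor ms = (fr n :: 'k tens)"
    using Fmor_part[of "{..<n}"] assms nths_all[of ms "{..<n}"] by (simp add: n)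
  ultimately show "V.EV (hdiff (Fmor ms)) gs + 1 / 2 * (\<Sum>A\<in>Pow {..<n}. Tval gs A) = (0 :: 'k)"
    using rel_r[OF assms(2)] by simp
  show "(\<Sum>A | A \<subseteq> {..<n} \<and> card A = 2. Wval gs A) = (0 :: 'k)"
    using assms Wval_rr by (intro sum.neutral) (auto simp: card_2_iff)
qed

lemma rel_X1:
  assumes "X = {p}"
  shows "V.EV (hdiff (Fmor ms)) gs + 1 / 2 * (\<Sum>A\<in>Pow {..<n}. Tval gs A)
    = (\<Sum>A | A \<subseteq> {..<n} \<and> card A = 2. Wval gs A :: 'k::field_char_0)"
proof -
  define S where "S = {..<n} - {p}"
  define m where "m = n - 1"
  define x where "x = ms ! p"
  have p: "p < n" using assms by (auto simp: X)
  have x: "x \<in> {[], [False], [True]}" using monX[of p] assms by (simp add: x_def)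
  have S: "finite S" "p \<notin> S" "{..<n} = insert p S" "card S = m" "n = Suc m"
    using p by (auto simp: S_def m_def)
  have card_m: "card (S - A) = m - card A" if "A \<subseteq> S" for A
    using S finite_subset[OF that S(1)] that by (simp add: card_Diff_subset)
  have F0: "Fmor (nths ms A) = (fr (card A) :: 'k tens)" if "A \<subseteq> S" for A
  proof -
    have "A \<inter> X = {}" "A \<subseteq> {..<n}" using that S assms by auto
    then show ?thesis by (simp add: Fmor_part)
  qed
  have F1: "Fmor (nths ms (insert p A)) = (fx x (card A) :: 'k tens)" if "A \<subseteq> S" for A
  proof -
    have "insert p A \<inter> X = {p}" "insert p A \<subseteq> {..<n}" "p \<notin> A" "finite A"
      using that S assms finite_subset by auto
    then show ?thesis using p by (simp add: Fmor_part nths_sing n x_def)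
  qed
  have T0: "Tval gs A = (V.EV (r2D (fr (card A)) (fx x (m - card A))) gs :: 'k)" if A: "A \<subseteq> S" for A
  proof -
    have c: "{..<n} - A = insert p (S - A)" "A \<subseteq> {..<n}" "A \<inter> X = {}" using A S assms by auto
    then have "koz ms A = (1 :: 'k)" by (intro koz_1) auto
    then show ?thesis unfolding Tval_def c(1) F0[OF A] F1[OF Diff_subset] card_m[OF A] by simp
  qed
  have T1: "Tval gs (insert p A) = (V.EV (r2D (fx x (card A)) (fr (m - card A))) gs :: 'k)" if A: "A \<subseteq> S" for A
  proof -
    have c: "{..<n} - insert p A = S - A" "insert p A \<subseteq> {..<n}" "X \<subseteq> insert p A" using A S assms by auto
    then have "koz ms (insert p A) = (1 :: 'k)" by (intro koz_1) auto
    then show ?thesis unfolding Tval_def c(1) F1[OF A] F0[OF Diff_subset] card_m[OF A] by simp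
  qed
  \<comment> \<open>Split by which of the two bracket factors receives the further argument p;
    within each half only the size of A matters.\<close>
  have "(\<Sum>A\<in>Pow {..<n}. Tval gs A) = (\<Sum>A\<in>Pow S. Tval gs A) + (\<Sum>A\<in>Pow S. Tval gs (insert p A) :: 'k)"
    unfolding S(3) by (rule sum_Pow_insert[OF S(1,2)])
  also have "(\<Sum>A\<in>Pow S. Tval gs A) = (\<Sum>A\<in>Pow S. V.EV (r2D (fr (card A)) (fx x (m - card A))) gs :: 'k)"
    using T0 by (intro sum.cong) auto
  also have "\<dots> = (\<Sum>j\<le>m. of_nat (m choose j) * V.EV (r2D (fr j) (fx x (m - j))) gs)"
    using sum_Pow_card[OF S(1), of "\<lambda>k. V.EV (r2D (fr k) (fx x (m - k))) gs"] S by simp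
  also have "(\<Sum>A\<in>Pow S. Tval gs (insert p A)) = (\<Sum>A\<in>Pow S. V.EV (r2D (fx x (card A)) (fr (m - card A))) gs :: 'k)"
    using T1 by (intro sum.cong) auto
  also have "\<dots> = (\<Sum>j\<le>m. of_nat (m choose j) * V.EV (r2D (fx x j) (fr (m - j))) gs)"
    using sum_Pow_card[OF S(1), of "\<lambda>k. V.EV (r2D (fx x k) (fr (m - k))) gs"] S by simp
  also have "\<dots> = (\<Sum>j\<le>m. of_nat (m choose j) * V.EV (r2D (fx x (m - j)) (fr j)) gs)"
    by (subst sum_atMost_rev[symmetric], intro sum.cong refl) (simp add: binomial_symmetric[symmetric])
  finally have T: "(\<Sum>A\<in>Pow {..<n}. Tval gs A) = (\<Sum>j\<le>m. of_nat (m choose j) *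
      (V.EV (r2D (fr j) (fx x (m - j))) gs + V.EV (r2D (fx x (m - j)) (fr j)) gs) :: 'k)"
    by (simp add: sum.distrib distrib_left)
  have "Fmor ms = (Fmor (nths ms {..<n}) :: 'k tens)" by (simp add: n)
  then have F: "Fmor ms = (fx x m :: 'k tens)"
    unfolding S(3) F1[OF subset_refl] S(4) .
  \<comment> \<open>Pairs avoiding p bracket r with r, which gives 0; each of the m pairs containing
    p contributes the same.\<close>
  have "(\<Sum>A | A \<subseteq> {..<n} \<and> card A = 2. Wval gs A) = (\<Sum>A | A \<subseteq> S \<and> card A = 2. Wval gs A) + (\<Sum>i\<in>S. Wval gs {p, i} :: 'k)"
    unfolding S(3) by (rule sum_pairs_insert[OF S(1,2)])
  also have "(\<Sum>A | A \<subseteq> S \<and> card A = 2. Wval gs A) = (0 :: 'k)"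
    using assms Wval_rr by (intro sum.neutral) (auto simp: card_2_iff S_def)
  also have "(\<Sum>i\<in>S. Wval gs {p, i}) = (\<Sum>i\<in>S. qk x [False, True] * V.EV (fr m) gs :: 'k)"
  proof (intro sum.cong refl)
    fix i assume i: "i \<in> S"
    then have "koz ms {p, i} = (1 :: 'k)" using assms S by (intro koz_1) auto
    moreover have "nths ms (X - {p}) = []" "i < n" "i \<notin> X" "p \<in> X" using assms i by (auto simp: S_def)
    ultimately show "Wval gs {p, i} = qk x [False, True] * (V.EV (fr m) gs :: 'k)"
      by (simp add: Wval_xr x_def m_def)
  qed
  finally have W: "(\<Sum>A | A \<subseteq> {..<n} \<and> card A = 2. Wval gs A) = (of_nat m * (qk x [False, True] * V.EV (fr m) gs) :: 'k)"
    using S by simp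
  show ?thesis unfolding T F W rel_xr[OF x] using x by (auto simp: qk_def)
qed

lemma rel_X2:
  assumes "X = {p, q}" "p < q"
  shows "V.EV (hdiff (Fmor ms)) gs + 1 / 2 * (\<Sum>A\<in>Pow {..<n}. Tval gs A)
    = (\<Sum>A | A \<subseteq> {..<n} \<and> card A = 2. Wval gs A :: 'k::field_char_0)"
proof -
  define S where "S = {..<n} - {p, q}"
  define m where "m = n - 2"
  define x y where "x = ms ! p" and "y = ms ! q"
  define \<epsilon> where "\<epsilon> = (sg (sdeg x * sdeg y) :: 'k)"
  have pq: "p < n" "q < n" using assms by (auto simp: X)
  have x: "x \<in> {[], [False], [True]}" and y: "y \<in> {[], [False], [True]}"
    using monX[of p] monX[of q] assms by (simp_all add: x_def y_def)
  have S: "finite S" "p \<notin> S" "q \<notin> S" "p \<notin> insert q S" "{..<n} = insert p (insert q S)" "card S = m" "n = Suc (Suc m)"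
    using pq assms by (auto simp: S_def m_def card_Diff_subset)
  have card_m: "card (S - A) = m - card A" if "A \<subseteq> S" for A
    using S finite_subset[OF that S(1)] that by (simp add: card_Diff_subset)
  have Fp: "Fmor (nths ms (insert p A)) = (fx x (card A) :: 'k tens)" if "A \<subseteq> S" for A
  proof -
    have "insert p A \<inter> X = {p}" "insert p A \<subseteq> {..<n}" "p \<notin> A" "finite A"
      using that S assms finite_subset by auto
    then show ?thesis using pq by (simp add: Fmor_part nths_sing n x_def)
  qed
  have Fq: "Fmor (nths ms (insert q A)) = (fx y (card A) :: 'k tens)" if "A \<subseteq> S" for A
  proof -
    have "insert q A \<inter> X = {q}" "insert q A \<subseteq> {..<n}" "q \<notin> A" "finite A"
      using that S assms finite_subset by auto
    then show ?thesis using pq by (simp add: Fmor_part nths_sing n y_def)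
  qed
  have Fpq: "Fmor (nths ms (insert p (insert q A))) = (\<lambda>_. 0 :: 'k)" if "A \<subseteq> S" for A
  proof -
    have *: "insert p (insert q A) \<inter> X = {p, q}" "insert p (insert q A) \<subseteq> {..<n}"
      using that S assms by auto
    have "nths ms {p, q} = [ms ! p, ms ! q]" using assms(2) pq by (intro nths_pair) (simp_all add: n)
    then show ?thesis unfolding Fmor_part[OF *(2)] *(1) by simp
  qed
  \<comment> \<open>If p and q lie on the same side of the splitting, the factor on that side has
    two further arguments and vanishes.\<close>
  have T0: "Tval gs A = (0 :: 'k)" and T3: "Tval gs (insert p (insert q A)) = (0 :: 'k)" if A: "A \<subseteq> S" for A
  proof -
    have "{..<n} - A = insert p (insert q (S - A))" using A S by auto
    then show "Tval gs A = (0 :: 'k)" using Fpq[of "S - A"] by (simp add: Tval_def)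
    show "Tval gs (insert p (insert q A)) = (0 :: 'k)" using Fpq[OF A] by (simp add: Tval_def)
  qed
  have Tp: "Tval gs (insert p A) = (V.EV (r2D (fx x (card A)) (fx y (m - card A))) gs :: 'k)" if A: "A \<subseteq> S" for A
  proof -
    have c: "{..<n} - insert p A = insert q (S - A)" "insert p A \<subseteq> {..<n}" "insert p A \<inter> X = {p}" "X - insert p A = {q}"
      using A S assms by auto
    have "koz ms (insert p A) = (1 :: 'k)"
      using assms(2) by (simp only: koz_X[OF c(2)] c(3,4)) simp
    then show ?thesis unfolding Tval_def c(1) Fp[OF A] Fq[OF Diff_subset] card_m[OF A] by simp
  qed
  have Tq: "Tval gs (insert q A) = \<epsilon> * (V.EV (r2D (fx y (card A)) (fx x (m - card A))) gs :: 'k)" if A: "A \<subseteq> S" for A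
  proof -
    have c: "{..<n} - insert q A = insert p (S - A)" "insert q A \<subseteq> {..<n}" "insert q A \<inter> X = {q}" "X - insert q A = {p}"
      using A S assms by auto
    \<comment> \<open>Only here is q moved in front of p, which costs the sign of exchanging
      them.\<close>
    have "koz ms (insert q A) = \<epsilon>"
      using assms(2) by (simp only: koz_X[OF c(2)] c(3,4)) (simp add: \<epsilon>_def x_def y_def mult.commute)
    then show ?thesis unfolding Tval_def c(1) Fq[OF A] Fp[OF Diff_subset] card_m[OF A] by simp
  qed
  have "(\<Sum>A\<in>Pow {..<n}. Tval gs A) = (\<Sum>A\<in>Pow S. Tval gs A) + (\<Sum>A\<in>Pow S. Tval gs (insert q A))
     + ((\<Sum>A\<in>Pow S. Tval gs (insert p A)) + (\<Sum>A\<in>Pow S. Tval gs (insert p (insert q A)) :: 'k))"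
    unfolding S(5) using S(1-4) by (simp add: sum_Pow_insert)
  also have "(\<Sum>A\<in>Pow S. Tval gs A) = (0 :: 'k)" using T0 by (intro sum.neutral) auto
  also have "(\<Sum>A\<in>Pow S. Tval gs (insert p (insert q A))) = (0 :: 'k)" using T3 by (intro sum.neutral) auto
  also have "(\<Sum>A\<in>Pow S. Tval gs (insert p A)) = (\<Sum>A\<in>Pow S. V.EV (r2D (fx x (card A)) (fx y (m - card A))) gs :: 'k)"
    using Tp by (intro sum.cong) auto
  also have "\<dots> = (\<Sum>j\<le>m. of_nat (m choose j) * V.EV (r2D (fx x j) (fx y (m - j))) gs)"
    using sum_Pow_card[OF S(1), of "\<lambda>k. V.EV (r2D (fx x k) (fx y (m - k))) gs"] S by simp
  also have "(\<Sum>A\<in>Pow S. Tval gs (insert q A)) = (\<Sum>A\<in>Pow S. \<epsilon> * V.EV (r2D (fx y (card A)) (fx x (m - card A))) gs :: 'k)"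
    using Tq by (intro sum.cong) auto
  also have "\<dots> = (\<Sum>j\<le>m. of_nat (m choose j) * (\<epsilon> * V.EV (r2D (fx y j) (fx x (m - j))) gs))"
    using sum_Pow_card[OF S(1), of "\<lambda>k. \<epsilon> * V.EV (r2D (fx y k) (fx x (m - k))) gs"] S by simp
  also have "\<dots> = (\<Sum>j\<le>m. of_nat (m choose j) * (\<epsilon> * V.EV (r2D (fx y (m - j)) (fx x j)) gs))"
    by (subst sum_atMost_rev[symmetric], intro sum.cong refl) (simp add: binomial_symmetric[symmetric])
  finally have T: "(\<Sum>A\<in>Pow {..<n}. Tval gs A) = (\<Sum>j\<le>m. of_nat (m choose j) *
      (V.EV (r2D (fx x j) (fx y (m - j))) gs + \<epsilon> * V.EV (r2D (fx y (m - j)) (fx x j)) gs) :: 'k)"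
    by (simp add: sum.distrib distrib_left add.commute)
  have "Fmor ms = (Fmor (nths ms {..<n}) :: 'k tens)" by (simp add: n)
  then have F: "Fmor ms = (\<lambda>_. 0 :: 'k)" unfolding S(5) Fpq[OF subset_refl] .
  have "(\<Sum>A | A \<subseteq> {..<n} \<and> card A = 2. Wval gs A)
    = (\<Sum>A | A \<subseteq> S \<and> card A = 2. Wval gs A) + (\<Sum>i\<in>S. Wval gs {q, i}) + (Wval gs {p, q} + (\<Sum>i\<in>S. Wval gs {p, i} :: 'k))"
    unfolding S(5) using S(1-4) by (simp add: sum_pairs_insert)
  also have "(\<Sum>A | A \<subseteq> S \<and> card A = 2. Wval gs A) = (0 :: 'k)"
    using assms Wval_rr by (intro sum.neutral) (auto simp: card_2_iff S_def)
  also have "(\<Sum>i\<in>S. Wval gs {p, i}) = (\<Sum>i\<in>S. qk x [False, True] * V.EV (fx y m) gs :: 'k)"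
  proof (intro sum.cong refl)
    fix i assume i: "i \<in> S"
    have c: "{p, i} \<subseteq> {..<n}" "{p, i} \<inter> X = {p}" "X - {p, i} = {q}" using i S assms by auto
    have "koz ms {p, i} = (1 :: 'k)"
      using assms(2) by (simp only: koz_X[OF c(1)] c(2,3)) simp
    moreover have "X - {p} = {q}" using assms by auto
    then have "nths ms (X - {p}) = [y]" using pq by (simp add: nths_sing n y_def)
    moreover have "i < n" "i \<notin> X" "p \<in> X" using assms i by (auto simp: S_def)
    ultimately show "Wval gs {p, i} = qk x [False, True] * (V.EV (fx y m) gs :: 'k)"
      by (simp add: Wval_xr x_def[symmetric] y_def[symmetric] m_def numeral_2_eq_2)
  qed
  also have "(\<Sum>i\<in>S. Wval gs {q, i}) = (\<Sum>i\<in>S. \<epsilon> * qk y [False, True] * V.EV (fx x m) gs :: 'k)"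
  proof (intro sum.cong refl)
    fix i assume i: "i \<in> S"
    have c: "{q, i} \<subseteq> {..<n}" "{q, i} \<inter> X = {q}" "X - {q, i} = {p}" using i S assms by auto
    have "koz ms {q, i} = \<epsilon>"
      using assms(2) by (simp only: koz_X[OF c(1)] c(2,3)) (simp add: \<epsilon>_def x_def y_def mult.commute)
    moreover have "X - {q} = {p}" using assms by auto
    then have "nths ms (X - {q}) = [x]" using pq by (simp add: nths_sing n x_def)
    moreover have "i < n" "i \<notin> X" "q \<in> X" using assms i by (auto simp: S_def)
    ultimately show "Wval gs {q, i} = \<epsilon> * qk y [False, True] * (V.EV (fx x m) gs :: 'k)"
      by (simp add: Wval_xr x_def[symmetric] y_def[symmetric] m_def numeral_2_eq_2)
  qed
  also have "Wval gs {p, q} = qk x y * (V.EV (fx [False] m) gs :: 'k)"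
  proof -
    have "koz ms {p, q} = (1 :: 'k)" using assms S by (intro koz_1) auto
    moreover have "nths ms (X - {p, q}) = []" using assms by simp
    ultimately show ?thesis using assms by (simp add: Wval_xx x_def y_def m_def numeral_2_eq_2)
  qed
  finally have W: "(\<Sum>A | A \<subseteq> {..<n} \<and> card A = 2. Wval gs A) = qk x y * V.EV (fx [False] m) gs
     + of_nat m * (qk x [False, True] * V.EV (fx y m) gs + \<epsilon> * qk y [False, True] * (V.EV (fx x m) gs :: 'k))"
    using S by (simp add: algebra_simps)
  show ?thesis unfolding T F W \<epsilon>_def rel_xy[OF x y] by simp
qed

text \<open>By pigeonhole one part of every splitting has two further arguments. A bracket reduces
  their number by at most one, so at least two remain there as well; every term vanishes.\<close>

lemma rel_X3:
  assumes "3 \<le> card X"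
  shows "V.EV (hdiff (Fmor ms)) gs + 1 / 2 * (\<Sum>A\<in>Pow {..<n}. Tval gs A)
    = (\<Sum>A | A \<subseteq> {..<n} \<and> card A = 2. Wval gs A :: 'k::field_char_0)"
proof -
  have Z: "Fmor (nths ms A) = (\<lambda>_. 0 :: 'k)" if "A \<subseteq> {..<n}" "2 \<le> card (A \<inter> X)" for A
    using that by (simp add: Fmor_part Fval_zero nths_X_len)
  have "Tval gs A = (0 :: 'k)" if A: "A \<subseteq> {..<n}" for A
  proof (cases "2 \<le> card (A \<inter> X)")
    case True
    then show ?thesis using Z[OF A] by (simp add: Tval_def)
  next
    case False
    have "card X = card (A \<inter> X) + card (({..<n} - A) \<inter> X)"
      using finX by (subst card_Un_disjoint[symmetric]) (auto intro: arg_cong[of _ _ card])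
    then have "2 \<le> card (({..<n} - A) \<inter> X)" using False assms by linarith
    then show ?thesis using Z[of "{..<n} - A"] by (simp add: Tval_def)
  qed
  then have T: "(\<Sum>A\<in>Pow {..<n}. Tval gs A) = (0 :: 'k)" by (intro sum.neutral) auto
  have Wx: "Wval gs {p, j} = (0 :: 'k)" if "p \<in> X" "j < n" "j \<notin> X" for p j
  proof -
    have "2 \<le> card (X - {p})" using assms that(1) finX by simp
    then have "2 \<le> length (nths ms (X - {p}))" using nths_X_len[of "X - {p}"] by (simp add: Int_absorb2 Diff_subset)
    then show ?thesis using that by (simp add: Wval_xr Fval_zero)
  qed
  have Wxx: "Wval gs {p, q} = (0 :: 'k)" if "p \<in> X" "q \<in> X" "p < q" for p q
  proof -
    have "1 \<le> card (X - {p, q})" using assms that finX by (simp add: card_Diff_subset)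
    then have "1 \<le> length (nths ms (X - {p, q}))" using nths_X_len[of "X - {p, q}"] by (simp add: Int_absorb2 Diff_subset)
    then show ?thesis using that by (simp add: Wval_xx Fval_zero)
  qed
  have "Wval gs A = (0 :: 'k)" if A: "A \<subseteq> {..<n}" "card A = 2" for A
  proof -
    obtain i j where ij: "A = {i, j}" "i < j" using A(2)
      by (metis card_2_iff insert_commute linorder_neqE_nat)
    then have "i < n" "j < n" using A(1) by auto
    moreover have "{j, i} = {i, j}" by auto
    then have "Wval gs {i, j} = (0 :: 'k)" if "j \<in> X" "i < n" "i \<notin> X" using Wx[OF that] by simp
    ultimately show ?thesis unfolding ij(1) using ij(2)
      by (cases "i \<in> X"; cases "j \<in> X") (simp_all add: Wx Wxx Wval_rr)
  qed
  then have W: "(\<Sum>A | A \<subseteq> {..<n} \<and> card A = 2. Wval gs A) = (0 :: 'k)" by (intro sum.neutral) auto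
  have "nths ms {..<n} = ms" by (simp add: n)
  then have "Fmor ms = (\<lambda>_. 0 :: 'k)" using Z[of "{..<n}"] assms finX by (simp add: Int_absorb1)
  then show ?thesis unfolding T W by simp
qed

lemma relation:
  assumes "ms \<noteq> []"
  shows "V.EV (hdiff (Fmor ms)) gs + 1 / 2 * (\<Sum>A\<in>Pow {..<n}. Tval gs A)
    = (\<Sum>A | A \<subseteq> {..<n} \<and> card A = 2. Wval gs A :: 'k::field_char_0)"
proof -
  consider "card X = 0" | "card X = 1" | "card X = 2" | "3 \<le> card X" by linarith
  then show ?thesis
  proof cases
    case 1
    then show ?thesis using rel_X0[of gs] finX assms by (simp add: n)
  next
    case 2
    then show ?thesis using rel_X1 by (auto simp: card_1_singleton_iff)
  next
    case 3
    then obtain p q where "X = {p, q}" "p < q"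
      by (metis card_2_iff insert_commute linorder_neqE_nat)
    then show ?thesis by (rule rel_X2)
  next
    case 4
    then show ?thesis by (rule rel_X3)
  qed
qed

end

lemma Linf_Fmor: "Linf_morphism (Fmor :: bool list list \<Rightarrow> 'k::field_char_0 tens)"
  unfolding Linf_morphism_def Let_def
proof (intro allI impI conjI)
  fix ms :: "bool list list"
  assume ms: "ms \<noteq> [] \<and> (\<forall>m\<in>set ms. Emon m)"
  show "Dhom ((\<Sum>m\<leftarrow>ms. int (length m) - 1) + 1 - int (length ms)) (Fmor ms :: 'k tens)"
    using Dhom_Fmor ms by blast
  show "Jeq (Fmor ms) (\<lambda>z. sg (sdeg (ms ! i) * sdeg (ms ! Suc i)) * Fmor (ms[i := ms ! Suc i, Suc i := ms ! i]) z :: 'k)"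
    if "Suc i < length ms" for i
    unfolding Fmor_swap[OF that, symmetric] by (rule Jeq_refl)
  define n where "n = length ms"
  interpret monomials ms n "{i. i < n \<and> nonr (ms ! i)}"
    using ms by unfold_locales (auto simp: n_def)
  have W: "lext (\<lambda>c. Fmor (c # nths ms ({..<n} - A))) (q2E (nths ms A ! 0) (nths ms A ! 1))
      = (\<lambda>z. qk (nths ms A ! 0) (nths ms A ! 1) * Fmor (qm (nths ms A ! 0) (nths ms A ! 1) # nths ms ({..<n} - A)) z :: 'k)"
    if A: "A \<subseteq> {..<n}" "card A = 2" for A
  proof -
    have "length (nths ms A) = 2" using length_nths_subset[of A ms] A by (simp add: n_def)
    then have "nths ms A ! 0 \<in> set ms" "nths ms A ! 1 \<in> set ms"
      using set_nths_subset[of ms A] nth_mem[of _ "nths ms A"] by auto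
    then have "nths ms A ! 0 \<in> {[], [False], [True], [False, True]}" "nths ms A ! 1 \<in> {[], [False], [True], [False, True]}"
      using ms by (auto dest: EmonD)
    then show ?thesis by (simp add: q2E_eq fun_eq_iff lext_smul)
  qed
  show "Jeq (\<lambda>z. \<Sum>A\<in>{A. A \<subseteq> {..<length ms} \<and> card A = 2}. koz ms A *
          lext (\<lambda>c. Fmor (c # nths ms ({..<length ms} - A))) (q2E (nths ms A ! 0) (nths ms A ! 1)) z)
     (\<lambda>z. hdiff (Fmor ms) z + (1 / 2) * (\<Sum>A\<in>Pow {..<length ms} - {{}, {..<length ms}}. koz ms A *
          r2D (Fmor (nths ms A)) (Fmor (nths ms ({..<length ms} - A))) z) :: 'k)" (is "Jeq ?L ?R")
    unfolding n_def[symmetric]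
  \<comment> \<open>The relation is tested by the evaluation \<open>ev\<close>, for which
    \<open>relation\<close> has been proved argument by argument.\<close>
  proof (rule Jeq_V)
    let ?l = "\<lambda>A z. koz ms A * (qk (nths ms A ! 0) (nths ms A ! 1) * Fmor (qm (nths ms A ! 0) (nths ms A ! 1) # nths ms ({..<n} - A)) z) :: 'k"
    let ?r = "\<lambda>A z. koz ms A * r2D (Fmor (nths ms A)) (Fmor (nths ms ({..<n} - A))) z :: 'k"
    have L: "(\<lambda>z. \<Sum>A\<in>{A. A \<subseteq> {..<n} \<and> card A = 2}. koz ms A *
          lext (\<lambda>c. Fmor (c # nths ms ({..<n} - A))) (q2E (nths ms A ! 0) (nths ms A ! 1)) z)
        = (\<lambda>z. \<Sum>A\<in>{A. A \<subseteq> {..<n} \<and> card A = 2}. ?l A z)"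
      by (intro ext sum.cong refl, elim CollectE conjE) (simp only: W)
    have finl: "finite (supp (?l A))" for A by (intro fin_smul) simp
    have finr: "finite (supp (?r A))" for A by (intro fin_smul fin_r2D) simp_all
    show "finite (supp (\<lambda>z. \<Sum>A\<in>{A. A \<subseteq> {..<n} \<and> card A = 2}. koz ms A *
          lext (\<lambda>c. Fmor (c # nths ms ({..<n} - A))) (q2E (nths ms A ! 0) (nths ms A ! 1)) z :: 'k))"
      unfolding L by (rule fin_sum) (rule finl)
    show "finite (supp (\<lambda>z. hdiff (Fmor ms) z + (1 / 2) * (\<Sum>A\<in>Pow {..<n} - {{}, {..<n}}. ?r A z)))"
      by (intro fin_add fin_smul fin_sum finr V.fin_hdiff fin_Fmor)
    fix gs :: "('k \<times> nat) list"
    have "V.EV (\<lambda>z. \<Sum>A\<in>{A. A \<subseteq> {..<n} \<and> card A = 2}. ?l A z) gs = (\<Sum>A | A \<subseteq> {..<n} \<and> card A = 2. Wval gs A)"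
      by (subst V.EV_sum[OF finl]) (simp add: V.EV_smul fin_smul Wval_def)
    also have "\<dots> = V.EV (hdiff (Fmor ms)) gs + 1 / 2 * (\<Sum>A\<in>Pow {..<n}. Tval gs A)"
      using relation[of gs] ms by simp
    also have "(\<Sum>A\<in>Pow {..<n}. Tval gs A) = (\<Sum>A\<in>Pow {..<n} - {{}, {..<n}}. Tval gs A)"
      by (intro sum.mono_neutral_right) (auto simp: Tval_empty)
    also have "(\<Sum>A\<in>Pow {..<n} - {{}, {..<n}}. Tval gs A) = V.EV (\<lambda>z. \<Sum>A\<in>Pow {..<n} - {{}, {..<n}}. ?r A z) gs"
      by (subst V.EV_sum[OF finr]) (simp add: V.EV_smul fin_r2D Tval_def)
    also have "V.EV (hdiff (Fmor ms)) gs + 1 / 2 * \<dots>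
      = V.EV (\<lambda>z. hdiff (Fmor ms) z + (1 / 2) * (\<Sum>A\<in>Pow {..<n} - {{}, {..<n}}. ?r A z)) gs"
      by (subst V.EV_add, intro V.fin_hdiff fin_Fmor, intro fin_smul fin_sum finr, subst V.EV_smul, intro fin_sum finr, rule refl)
    finally show "V.EV (\<lambda>z. \<Sum>A\<in>{A. A \<subseteq> {..<n} \<and> card A = 2}. koz ms A *
          lext (\<lambda>c. Fmor (c # nths ms ({..<n} - A))) (q2E (nths ms A ! 0) (nths ms A ! 1)) z) gs
      = V.EV (\<lambda>z. hdiff (Fmor ms) z + (1 / 2) * (\<Sum>A\<in>Pow {..<n} - {{}, {..<n}}. ?r A z)) gs"
      unfolding L .
  qed
qed

theorem mainTheorem7:
  shows "\<exists>f :: bool list list \<Rightarrow> ('k::field_char_0) tens. Linf_morphism f \<and> quasi_iso f"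
proof (intro exI conjI)
  show "Linf_morphism (Fmor :: bool list list \<Rightarrow> 'k tens)" by (rule Linf_Fmor)
  show "quasi_iso (Fmor :: bool list list \<Rightarrow> 'k tens)"
  proof (rule quasi_isoI)
    show "Fmor [[]] = (bas [] :: 'k tens)" "Fmor [[False]] = (bas [[False]] :: 'k tens)" "Fmor [[True]] = (bas [[True]] :: 'k tens)"
      by (simp_all add: Fmor_def fx_def)
    show "Fmor [[False, True]] = (\<lambda>z. (- 1 / 2) * bas [[True], [False]] z :: 'k)"
      unfolding fr_1[symmetric] by (simp add: Fmor_def)
  qed
qed

end
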